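(* Let $M$ be a strictly pseudoconvex CR manifold and $\theta$ a contact form on $M$ such that $G_\theta$ is positive definite. If $(M,\theta)$ has nonpositive pseudohermitian sectional curvature, i.e. $k_\theta(\sigma)\le 0$ for every $2$-plane $\sigma\subset T_x(M)$ and every $x\in M$, then $(M,\theta)$ has no horizontally conjugate points: for every lengthy geodesic $\gamma$ of the Tanaka-Webster connection $\nabla$, parametrized by arc length, no two points $\gamma(a),\gamma(b)$ with $a\neq b$ are horizontally conjugate along $\gamma$.
   Context: Setting. $M$ is an orientable $C^\infty$ manifold of dimension $2n+1$ with a CR structure $T_{1,0}(M)\subset T(M)\otimes\mathbb C$ (a complex subbundle of complex rank $n$, with $T_{1,0}(M)\cap\overline{T_{1,0}(M)}=(0)$, closed under Lie brackets; $n$ is the CR dimension). $H(M)=\mathrm{Re}\{T_{1,0}(M)\oplus\overline{T_{1,0}(M)}\}$ is the Levi distribution, with complex structure $J(Z+\overline Z)=i(Z-\overline Z)$, $Z\in T_{1,0}(M)$. $\theta$ is a nowhere zero real $1$-form with $\mathrm{Ker}(\theta)=H(M)$; convention: $d\theta(X,Y)=\frac12\{X(\theta(Y))-Y(\theta(X))-\theta([X,Y])\}$. $G_\theta(X,Y)=(d\theta)(X,JY)$ on $H(M)$, assumed positive definite (strict pseudoconvexity). $T$ is the vector field with $\theta(T)=1$, $T\rfloor d\theta=0$; set $JT=0$. The Webster metric is the Riemannian metric $g_\theta$ with $g_\theta=G_\theta$ on $H(M)$, $g_\theta(X,T)=0$ for $X\in H(M)$, $g_\theta(T,T)=1$. The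 Tanaka-Webster connection $\nabla$ is the unique linear connection such that $H(M)$ is parallel, $\nabla g_\theta=0$, $\nabla J=0$, and its torsion $T_\nabla$ satisfies $T_\nabla(Z,W)=0$, $T_\nabla(Z,\overline W)=2(d\theta)(Z,\overline W)T$ for $Z,W\in T_{1,0}(M)$, and $\tau\circ J+J\circ\tau=0$, where $\tau(X)=T_\nabla(T,X)$. $R$ is the curvature of $\nabla$, $R(X,Y)Z=\nabla_X\nabla_YZ-\nabla_Y\nabla_XZ-\nabla_{[X,Y]}Z$. Pseudohermitian sectional curvature: $k_\theta(\sigma)=\frac14 g_{\theta,x}(R_x(X,Y)Y,X)$ for a $2$-plane $\sigma\subset T_x(M)$ with $g_{\theta,x}$-orthonormal basis $\{X,Y\}$. A curve is lengthy if $\dot\gamma(t)\in H(M)_{\gamma(t)}$ for all $t$. A Jacobi field along a geodesic $\gamma$ of $\nabla$ is a vector field $X$ along $\gamma$ with $\nabla_{\dot\gamma}^2X+\nabla_{\dot\gamma}\big(T_\nabla(X,\dot\gamma)\big)+R(X,\dot\gamma)\dot\gamma=0$. Two points of a lengthy geodesic $\gamma$ are horizontally conjugate along $\gamma$ if there is a not identically zero Jacobi field $X$ along $\gamma$ with $X_{\gamma(t)}\in H(M)_{\gamma(t)}$ for every $t$, vanishing at both points. *)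

theory Defs
  imports "HOL-Analysis.Analysis"
begin

section \<open>Smooth maps between Euclidean spaces and smooth curves\<close>

text \<open>\<open>Ck_on k S f\<close> and \<open>smooth_on S f\<close> are only used for open \<open>S\<close>.\<close>

primrec Ck_on :: "nat \<Rightarrow> 'a::real_normed_vector set \<Rightarrow> ('a \<Rightarrow> 'b::real_normed_vector) \<Rightarrow> bool" where
  "Ck_on 0 S f \<longleftrightarrow> continuous_on S f"
| "Ck_on (Suc k) S f \<longleftrightarrow>
     (\<forall>x\<in>S. f differentiable (at x)) \<and> (\<forall>v. Ck_on k S (\<lambda>x. frechet_derivative f (at x) v))"

definition smooth_on :: "'a::real_normed_vector set \<Rightarrow> ('a \<Rightarrow> 'b::real_normed_vector) \<Rightarrow> bool" where
  "smooth_on S f \<longleftrightarrow> (\<forall>k. Ck_on k S f)"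

text \<open>Curves may be defined on intervals that contain endpoints, where derivatives are one-sided.
  Below, \<open>S\<close> is a relatively open subset of a nondegenerate interval, so that the vector
  derivatives within \<open>S\<close> are unique.\<close>

primrec Ck_curve_on :: "nat \<Rightarrow> real set \<Rightarrow> (real \<Rightarrow> 'b::real_normed_vector) \<Rightarrow> bool" where
  "Ck_curve_on 0 S f \<longleftrightarrow> continuous_on S f"
| "Ck_curve_on (Suc k) S f \<longleftrightarrow>
     f differentiable_on S \<and> Ck_curve_on k S (\<lambda>t. vector_derivative f (at t within S))"

definition smooth_curve_on :: "real set \<Rightarrow> (real \<Rightarrow> 'b::real_normed_vector) \<Rightarrow> bool" where
  "smooth_curve_on S f \<longleftrightarrow> (\<forall>k. Ck_curve_on k S f)"


section \<open>Smooth manifolds\<close>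

text \<open>The manifold is the whole (Hausdorff, second countable) type \<open>'a\<close>, its dimension is
  \<open>CARD('m)\<close>. A chart is a pair of its domain and its coordinate map; values of the coordinate map
  outside the domain are irrelevant.\<close>

type_synonym ('a, 'm) chart = "'a set \<times> ('a \<Rightarrow> real^'m)"

definition chart_inv :: "('a, 'm) chart \<Rightarrow> real^'m \<Rightarrow> 'a" where
  "chart_inv c = inv_into (fst c) (snd c)"

definition smooth_atlas ::
  "('a::{t2_space,second_countable_topology}, 'm::finite) chart set \<Rightarrow> bool" where
  "smooth_atlas A \<longleftrightarrow>
     (\<Union>c\<in>A. fst c) = UNIV \<and>
     (\<forall>c\<in>A. open (fst c) \<and> open (snd c ` fst c) \<and>
        homeomorphism (fst c) (snd c ` fst c) (snd c) (chart_inv c)) \<and>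
     (\<forall>c\<in>A. \<forall>d\<in>A. smooth_on (snd c ` (fst c \<inter> fst d)) (snd d \<circ> chart_inv c))"

definition orientable_atlas ::
  "('a::{t2_space,second_countable_topology}, 'm::finite) chart set \<Rightarrow> bool" where
  "orientable_atlas A \<longleftrightarrow>
     (\<exists>B. smooth_atlas B \<and> smooth_atlas (A \<union> B) \<and>
        (\<forall>c\<in>B. \<forall>d\<in>B. \<forall>p\<in>fst c \<inter> fst d.
           det (matrix (frechet_derivative (snd d \<circ> chart_inv c) (at (snd c p)))) > 0))"

text \<open>Every point \<open>p\<close> has a preferred chart \<open>chart_at A p\<close>. The tangent space at \<open>p\<close> is
  the space \<open>real^'m\<close> of component vectors with respect to the preferred chart at \<open>p\<close>; components
  with respect to any other chart are obtained by applying the Jacobian of the transition map.\<close>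

definition chart_at :: "('a, 'm::finite) chart set \<Rightarrow> 'a \<Rightarrow> ('a, 'm) chart" where
  "chart_at A p = (SOME c. c \<in> A \<and> p \<in> fst c)"

text \<open>The derivative \<open>v(f)\<close> of a function \<open>f\<close> on the manifold along a tangent vector \<open>v\<close> at \<open>p\<close>.
  In particular \<open>tderiv A (snd c) p v\<close> are the components of \<open>v\<close> with respect to a chart \<open>c\<close>.\<close>

definition tderiv ::
  "('a, 'm::finite) chart set \<Rightarrow> ('a \<Rightarrow> 'b::real_normed_vector) \<Rightarrow> 'a \<Rightarrow> real^'m \<Rightarrow> 'b" where
  "tderiv A f p v =
     frechet_derivative (f \<circ> chart_inv (chart_at A p)) (at (snd (chart_at A p) p)) v"

definition smooth_fun_on ::
  "('a::topological_space, 'm::finite) chart set \<Rightarrow> 'a set \<Rightarrow> ('a \<Rightarrow> 'b::real_normed_vector) \<Rightarrow> bool" where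
  "smooth_fun_on A U f \<longleftrightarrow> (\<forall>c\<in>A. smooth_on (snd c ` (fst c \<inter> U)) (f \<circ> chart_inv c))"

definition smooth_field_on ::
  "('a::topological_space, 'm::finite) chart set \<Rightarrow> 'a set \<Rightarrow> ('a \<Rightarrow> real^'m) \<Rightarrow> bool" where
  "smooth_field_on A U X \<longleftrightarrow>
     (\<forall>c\<in>A. smooth_fun_on A (fst c \<inter> U) (\<lambda>q. tderiv A (snd c) q (X q)))"

text \<open>The local vector field on the domain of the chart \<open>c\<close> with constant components \<open>w\<close> in that
  chart; for \<open>w = axis i 1\<close> it is the coordinate field \<open>\<partial>\<^sub>i\<close>.\<close>

definition coord_field ::
  "('a, 'm::finite) chart set \<Rightarrow> ('a, 'm) chart \<Rightarrow> real^'m \<Rightarrow> 'a \<Rightarrow> real^'m" where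
  "coord_field A c w q = frechet_derivative (snd (chart_at A q) \<circ> chart_inv c) (at (snd c q)) w"

text \<open>A local extension of the tangent vector \<open>v\<close> at \<open>p\<close> to a vector field.  It is used to evaluate
  tensors that are given by formulas in vector fields; their values do not depend on the
  extension.\<close>

definition extend_vec :: "('a, 'm::finite) chart set \<Rightarrow> 'a \<Rightarrow> real^'m \<Rightarrow> 'a \<Rightarrow> real^'m" where
  "extend_vec A p v = coord_field A (chart_at A p) v"

text \<open>\<open>[X,Y]\<^sup>i = X(Y\<^sup>i) - Y(X\<^sup>i)\<close> in the preferred chart.\<close>

definition lie_bracket ::
  "('a, 'm::finite) chart set \<Rightarrow> ('a \<Rightarrow> real^'m) \<Rightarrow> ('a \<Rightarrow> real^'m) \<Rightarrow> 'a \<Rightarrow> real^'m" where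
  "lie_bracket A X Y p = (let \<phi> = snd (chart_at A p) in
     tderiv A (\<lambda>q. tderiv A \<phi> q (Y q)) p (X p) - tderiv A (\<lambda>q. tderiv A \<phi> q (X q)) p (Y p))"

definition one_form ::
  "('a::topological_space, 'm::finite) chart set \<Rightarrow> ('a \<Rightarrow> real^'m \<Rightarrow> real) \<Rightarrow> bool" where
  "one_form A \<theta> \<longleftrightarrow> (\<forall>p. linear (\<theta> p)) \<and>
     (\<forall>U X. open U \<and> smooth_field_on A U X \<longrightarrow> smooth_fun_on A U (\<lambda>q. \<theta> q (X q)))"

definition ext_deriv ::
  "('a, 'm::finite) chart set \<Rightarrow> ('a \<Rightarrow> real^'m \<Rightarrow> real) \<Rightarrow> 'a \<Rightarrow> real^'m \<Rightarrow> real^'m \<Rightarrow> real" where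
  "ext_deriv A \<theta> p u v = (let X = extend_vec A p u; Y = extend_vec A p v in
     1/2 * (tderiv A (\<lambda>q. \<theta> q (Y q)) p (X p) - tderiv A (\<lambda>q. \<theta> q (X q)) p (Y p)
            - \<theta> p (lie_bracket A X Y p)))"

definition riemannian_metric ::
  "('a::topological_space, 'm::finite) chart set \<Rightarrow> ('a \<Rightarrow> real^'m \<Rightarrow> real^'m \<Rightarrow> real) \<Rightarrow> bool" where
  "riemannian_metric A g \<longleftrightarrow>
     (\<forall>p. bilinear (g p) \<and> (\<forall>u v. g p u v = g p v u) \<and> (\<forall>u. u \<noteq> 0 \<longrightarrow> g p u u > 0)) \<and>
     (\<forall>U X Y. open U \<and> smooth_field_on A U X \<and> smooth_field_on A U Y \<longrightarrow>
        smooth_fun_on A U (\<lambda>q. g q (X q) (Y q)))"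


section \<open>Linear connections\<close>

text \<open>\<open>D Y p v\<close> is \<open>\<nabla>\<^sub>v Y\<close> at \<open>p\<close>, for a tangent vector \<open>v\<close> at \<open>p\<close> and a vector field \<open>Y\<close> that is
  smooth on some open neighbourhood of \<open>p\<close>.\<close>

type_synonym ('a, 'm) connection = "('a \<Rightarrow> real^'m) \<Rightarrow> 'a \<Rightarrow> real^'m \<Rightarrow> real^'m"

definition linear_connection ::
  "('a::topological_space, 'm::finite) chart set \<Rightarrow> ('a, 'm) connection \<Rightarrow> bool" where
  "linear_connection A D \<longleftrightarrow> (\<forall>U. open U \<longrightarrow>
     (\<forall>Y. smooth_field_on A U Y \<longrightarrow> (\<forall>p\<in>U. linear (D Y p))) \<and>
     (\<forall>Y Y'. smooth_field_on A U Y \<and> smooth_field_on A U Y' \<and> (\<forall>q\<in>U. Y q = Y' q) \<longrightarrow>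
        (\<forall>p\<in>U. \<forall>v. D Y p v = D Y' p v)) \<and>
     (\<forall>Y Y'. smooth_field_on A U Y \<and> smooth_field_on A U Y' \<longrightarrow>
        (\<forall>p\<in>U. \<forall>v. D (\<lambda>q. Y q + Y' q) p v = D Y p v + D Y' p v)) \<and>
     (\<forall>(f::'a \<Rightarrow> real) Y. smooth_fun_on A U f \<and> smooth_field_on A U Y \<longrightarrow>
        (\<forall>p\<in>U. \<forall>v. D (\<lambda>q. f q *\<^sub>R Y q) p v = tderiv A f p v *\<^sub>R Y p + f p *\<^sub>R D Y p v)) \<and>
     (\<forall>X Y. smooth_field_on A U X \<and> smooth_field_on A U Y \<longrightarrow>
        smooth_field_on A U (\<lambda>q. D Y q (X q))))"

definition torsion ::
  "('a, 'm::finite) chart set \<Rightarrow> ('a, 'm) connection \<Rightarrow> 'a \<Rightarrow> real^'m \<Rightarrow> real^'m \<Rightarrow> real^'m" where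
  "torsion A D p u v = (let X = extend_vec A p u; Y = extend_vec A p v in
     D Y p (X p) - D X p (Y p) - lie_bracket A X Y p)"

definition curvature ::
  "('a, 'm::finite) chart set \<Rightarrow> ('a, 'm) connection
     \<Rightarrow> 'a \<Rightarrow> real^'m \<Rightarrow> real^'m \<Rightarrow> real^'m \<Rightarrow> real^'m" where
  "curvature A D p u v w =
     (let X = extend_vec A p u; Y = extend_vec A p v; Z = extend_vec A p w in
      D (\<lambda>q. D Z q (Y q)) p (X p) - D (\<lambda>q. D Z q (X q)) p (Y p) - D Z p (lie_bracket A X Y p))"


section \<open>Fields along curves, geodesics, Jacobi fields\<close>

definition smooth_curve ::
  "('a::topological_space, 'm::finite) chart set \<Rightarrow> real set \<Rightarrow> (real \<Rightarrow> 'a) \<Rightarrow> bool" where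
  "smooth_curve A I \<gamma> \<longleftrightarrow> continuous_on I \<gamma> \<and>
     (\<forall>c\<in>A. smooth_curve_on {t\<in>I. \<gamma> t \<in> fst c} (snd c \<circ> \<gamma>))"

definition velocity ::
  "('a, 'm::finite) chart set \<Rightarrow> real set \<Rightarrow> (real \<Rightarrow> 'a) \<Rightarrow> real \<Rightarrow> real^'m" where
  "velocity A I \<gamma> t = vector_derivative (snd (chart_at A (\<gamma> t)) \<circ> \<gamma>) (at t within I)"

definition smooth_field_along ::
  "('a, 'm::finite) chart set \<Rightarrow> real set \<Rightarrow> (real \<Rightarrow> 'a) \<Rightarrow> (real \<Rightarrow> real^'m) \<Rightarrow> bool" where
  "smooth_field_along A I \<gamma> V \<longleftrightarrow>
     (\<forall>c\<in>A. smooth_curve_on {t\<in>I. \<gamma> t \<in> fst c} (\<lambda>t. tderiv A (snd c) (\<gamma> t) (V t)))"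

text \<open>The covariant derivative along \<open>\<gamma>\<close> of \<open>V = \<Sum>\<^sub>i V\<^sup>i \<partial>\<^sub>i\<close>, computed at the parameter \<open>t\<close> in the
  preferred chart at \<open>\<gamma> t\<close>: it is \<open>\<Sum>\<^sub>i ((V\<^sup>i)' \<partial>\<^sub>i + V\<^sup>i \<nabla>\<^bsub>\<gamma>'\<^esub> \<partial>\<^sub>i)\<close>.\<close>

definition cov_deriv_along ::
  "('a, 'm::finite) chart set \<Rightarrow> ('a, 'm) connection \<Rightarrow> real set \<Rightarrow> (real \<Rightarrow> 'a)
     \<Rightarrow> (real \<Rightarrow> real^'m) \<Rightarrow> real \<Rightarrow> real^'m" where
  "cov_deriv_along A D I \<gamma> V t = (let c = chart_at A (\<gamma> t) in
     vector_derivative (\<lambda>s. tderiv A (snd c) (\<gamma> s) (V s)) (at t within I)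
     + (\<Sum>i\<in>UNIV. V t $ i *\<^sub>R D (coord_field A c (axis i 1)) (\<gamma> t) (velocity A I \<gamma> t)))"

definition geodesic ::
  "('a::topological_space, 'm::finite) chart set \<Rightarrow> ('a, 'm) connection \<Rightarrow> real set
     \<Rightarrow> (real \<Rightarrow> 'a) \<Rightarrow> bool" where
  "geodesic A D I \<gamma> \<longleftrightarrow> is_interval I \<and> smooth_curve A I \<gamma> \<and>
     (\<forall>t\<in>I. cov_deriv_along A D I \<gamma> (velocity A I \<gamma>) t = 0)"

definition jacobi_field ::
  "('a, 'm::finite) chart set \<Rightarrow> ('a, 'm) connection \<Rightarrow> real set \<Rightarrow> (real \<Rightarrow> 'a)
     \<Rightarrow> (real \<Rightarrow> real^'m) \<Rightarrow> bool" where
  "jacobi_field A D I \<gamma> X \<longleftrightarrow> smooth_field_along A I \<gamma> X \<and>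
     (\<forall>t\<in>I. cov_deriv_along A D I \<gamma> (cov_deriv_along A D I \<gamma> X) t
          + cov_deriv_along A D I \<gamma> (\<lambda>s. torsion A D (\<gamma> s) (X s) (velocity A I \<gamma> s)) t
          + curvature A D (\<gamma> t) (X t) (velocity A I \<gamma> t) (velocity A I \<gamma> t) = 0)"


section \<open>CR structures\<close>

text \<open>The complexified tangent space at a point is \<open>complex^'m\<close>: real and imaginary parts are
  components with respect to the preferred chart.\<close>

definition vec_Re :: "complex^'m \<Rightarrow> real^'m" where
  "vec_Re Z = (\<chi> i. Re (Z $ i))"

definition vec_Im :: "complex^'m \<Rightarrow> real^'m" where
  "vec_Im Z = (\<chi> i. Im (Z $ i))"

definition vec_cnj :: "complex^'m \<Rightarrow> complex^'m" where
  "vec_cnj Z = (\<chi> i. cnj (Z $ i))"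

definition vec_complex :: "real^'m \<Rightarrow> complex^'m" where
  "vec_complex X = (\<chi> i. complex_of_real (X $ i))"

text \<open>All extensions to complex vectors are complex bilinear (no conjugation in either argument).\<close>

definition cLie_bracket ::
  "('a, 'm::finite) chart set \<Rightarrow> ('a \<Rightarrow> complex^'m) \<Rightarrow> ('a \<Rightarrow> complex^'m) \<Rightarrow> 'a \<Rightarrow> complex^'m" where
  "cLie_bracket A Z W p =
     (let X = vec_Re \<circ> Z; Y = vec_Im \<circ> Z; U = vec_Re \<circ> W; V = vec_Im \<circ> W in
      vec_complex (lie_bracket A X U p - lie_bracket A Y V p)
      + \<i> *s vec_complex (lie_bracket A X V p + lie_bracket A Y U p))"

definition cext_form ::
  "(real^'m \<Rightarrow> real^'m \<Rightarrow> real) \<Rightarrow> complex^'m \<Rightarrow> complex^'m \<Rightarrow> complex" where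
  "cext_form B Z W =
     Complex (B (vec_Re Z) (vec_Re W) - B (vec_Im Z) (vec_Im W))
             (B (vec_Re Z) (vec_Im W) + B (vec_Im Z) (vec_Re W))"

definition cext_vec ::
  "(real^'m \<Rightarrow> real^'m \<Rightarrow> real^'m) \<Rightarrow> complex^'m \<Rightarrow> complex^'m \<Rightarrow> complex^'m" where
  "cext_vec B Z W = (\<chi> i. cext_form (\<lambda>u v. B u v $ i) Z W)"

definition smooth_cfield_on ::
  "('a::topological_space, 'm::finite) chart set \<Rightarrow> 'a set \<Rightarrow> ('a \<Rightarrow> complex^'m) \<Rightarrow> bool" where
  "smooth_cfield_on A U Z \<longleftrightarrow> smooth_field_on A U (vec_Re \<circ> Z) \<and> smooth_field_on A U (vec_Im \<circ> Z)"

definition complex_subbundle ::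
  "('a::topological_space, 'm::finite) chart set \<Rightarrow> nat \<Rightarrow> ('a \<Rightarrow> (complex^'m) set) \<Rightarrow> bool" where
  "complex_subbundle A n E \<longleftrightarrow>
     (\<forall>p. \<exists>U Z. open U \<and> p \<in> U \<and> (\<forall>j<n. smooth_cfield_on A U (Z j)) \<and>
        (\<forall>q\<in>U. E q = vec.span ((\<lambda>j. Z j q) ` {..<n}) \<and> vec.dim (E q) = n))"

definition CR_manifold ::
  "('a::{t2_space,second_countable_topology}, 'm::finite) chart set \<Rightarrow> nat
     \<Rightarrow> ('a \<Rightarrow> (complex^'m) set) \<Rightarrow> bool" where
  "CR_manifold A n T10 \<longleftrightarrow>
     smooth_atlas A \<and> orientable_atlas A \<and> CARD('m) = 2 * n + 1 \<and>
     complex_subbundle A n T10 \<and>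
     (\<forall>p. T10 p \<inter> vec_cnj ` T10 p = {0}) \<and>
     (\<forall>U Z W. open U \<and> smooth_cfield_on A U Z \<and> smooth_cfield_on A U W \<and>
        (\<forall>q\<in>U. Z q \<in> T10 q \<and> W q \<in> T10 q) \<longrightarrow> (\<forall>q\<in>U. cLie_bracket A Z W q \<in> T10 q))"

definition levi_distribution :: "('a \<Rightarrow> (complex^'m) set) \<Rightarrow> 'a \<Rightarrow> (real^'m) set" where
  "levi_distribution T10 p = {vec_Re (Z + vec_cnj W) | Z W. Z \<in> T10 p \<and> W \<in> T10 p}"

definition levi_J :: "('a \<Rightarrow> (complex^'m::finite) set) \<Rightarrow> 'a \<Rightarrow> real^'m \<Rightarrow> real^'m" where
  "levi_J T10 p X = (THE Y. \<exists>Z\<in>T10 p.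
     vec_complex X = Z + vec_cnj Z \<and> vec_complex Y = \<i> *s (Z - vec_cnj Z))"

definition contact_form ::
  "('a::topological_space, 'm::finite) chart set \<Rightarrow> ('a \<Rightarrow> (complex^'m) set)
     \<Rightarrow> ('a \<Rightarrow> real^'m \<Rightarrow> real) \<Rightarrow> bool" where
  "contact_form A T10 \<theta> \<longleftrightarrow> one_form A \<theta> \<and> (\<forall>p. \<exists>v. \<theta> p v \<noteq> 0) \<and>
     (\<forall>p. {v. \<theta> p v = 0} = levi_distribution T10 p)"

definition G_form ::
  "('a, 'm::finite) chart set \<Rightarrow> ('a \<Rightarrow> (complex^'m) set) \<Rightarrow> ('a \<Rightarrow> real^'m \<Rightarrow> real)
     \<Rightarrow> 'a \<Rightarrow> real^'m \<Rightarrow> real^'m \<Rightarrow> real" where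
  "G_form A T10 \<theta> p X Y = ext_deriv A \<theta> p X (levi_J T10 p Y)"

definition G_positive_definite ::
  "('a, 'm::finite) chart set \<Rightarrow> ('a \<Rightarrow> (complex^'m) set) \<Rightarrow> ('a \<Rightarrow> real^'m \<Rightarrow> real) \<Rightarrow> bool" where
  "G_positive_definite A T10 \<theta> \<longleftrightarrow>
     (\<forall>p. \<forall>X\<in>levi_distribution T10 p. X \<noteq> 0 \<longrightarrow> G_form A T10 \<theta> p X X > 0)"

definition characteristic_field ::
  "('a::topological_space, 'm::finite) chart set \<Rightarrow> ('a \<Rightarrow> real^'m \<Rightarrow> real) \<Rightarrow> ('a \<Rightarrow> real^'m) \<Rightarrow> bool" where
  "characteristic_field A \<theta> T \<longleftrightarrow> smooth_field_on A UNIV T \<and>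
     (\<forall>p. \<theta> p (T p) = 1 \<and> (\<forall>v. ext_deriv A \<theta> p (T p) v = 0))"

text \<open>The extension of \<open>levi_J\<close> to the whole tangent space by \<open>J T = 0\<close>: the vector
  \<open>v - \<theta>(v) T\<close> is the component of \<open>v\<close> in the Levi distribution.\<close>

definition full_J ::
  "('a \<Rightarrow> (complex^'m::finite) set) \<Rightarrow> ('a \<Rightarrow> real^'m \<Rightarrow> real) \<Rightarrow> ('a \<Rightarrow> real^'m)
     \<Rightarrow> 'a \<Rightarrow> real^'m \<Rightarrow> real^'m" where
  "full_J T10 \<theta> T p v = levi_J T10 p (v - \<theta> p v *\<^sub>R T p)"

definition webster_metric ::
  "('a::topological_space, 'm::finite) chart set \<Rightarrow> ('a \<Rightarrow> (complex^'m) set)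
     \<Rightarrow> ('a \<Rightarrow> real^'m \<Rightarrow> real) \<Rightarrow> ('a \<Rightarrow> real^'m) \<Rightarrow> ('a \<Rightarrow> real^'m \<Rightarrow> real^'m \<Rightarrow> real) \<Rightarrow> bool" where
  "webster_metric A T10 \<theta> T g \<longleftrightarrow> riemannian_metric A g \<and>
     (\<forall>p. (\<forall>X\<in>levi_distribution T10 p. \<forall>Y\<in>levi_distribution T10 p.
             g p X Y = G_form A T10 \<theta> p X Y) \<and>
          (\<forall>X\<in>levi_distribution T10 p. g p X (T p) = 0) \<and> g p (T p) (T p) = 1)"

definition tanaka_webster ::
  "('a::topological_space, 'm::finite) chart set \<Rightarrow> ('a \<Rightarrow> (complex^'m) set)
     \<Rightarrow> ('a \<Rightarrow> real^'m \<Rightarrow> real) \<Rightarrow> ('a \<Rightarrow> real^'m) \<Rightarrow> ('a \<Rightarrow> real^'m \<Rightarrow> real^'m \<Rightarrow> real)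
     \<Rightarrow> ('a, 'm) connection \<Rightarrow> bool" where
  "tanaka_webster A T10 \<theta> T g D \<longleftrightarrow> linear_connection A D \<and>
     (\<forall>U Y. open U \<and> smooth_field_on A U Y \<longrightarrow>
        ((\<forall>q\<in>U. Y q \<in> levi_distribution T10 q) \<longrightarrow>
           (\<forall>p\<in>U. \<forall>v. D Y p v \<in> levi_distribution T10 p)) \<and>
        (\<forall>Z. smooth_field_on A U Z \<longrightarrow>
           (\<forall>p\<in>U. \<forall>v. tderiv A (\<lambda>q. g q (Y q) (Z q)) p v = g p (D Y p v) (Z p) + g p (Y p) (D Z p v))) \<and>
        (\<forall>p\<in>U. \<forall>v. D (\<lambda>q. full_J T10 \<theta> T q (Y q)) p v = full_J T10 \<theta> T p (D Y p v))) \<and>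
     (\<forall>p. \<forall>Z\<in>T10 p. \<forall>W\<in>T10 p.
        cext_vec (torsion A D p) Z W = 0 \<and>
        cext_vec (torsion A D p) Z (vec_cnj W)
          = (2 * cext_form (ext_deriv A \<theta> p) Z (vec_cnj W)) *s vec_complex (T p)) \<and>
     (\<forall>p X. torsion A D p (T p) (full_J T10 \<theta> T p X)
          + full_J T10 \<theta> T p (torsion A D p (T p) X) = 0)"


section \<open>Pseudohermitian sectional curvature and horizontally conjugate points\<close>

definition psh_sectional_curvature ::
  "('a, 'm::finite) chart set \<Rightarrow> ('a \<Rightarrow> real^'m \<Rightarrow> real^'m \<Rightarrow> real) \<Rightarrow> ('a, 'm) connection
     \<Rightarrow> 'a \<Rightarrow> (real^'m) set \<Rightarrow> real" where
  "psh_sectional_curvature A g D p \<sigma> =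
     (THE k. \<exists>X Y. span {X, Y} = \<sigma> \<and> g p X X = 1 \<and> g p Y Y = 1 \<and> g p X Y = 0 \<and>
        k = 1/4 * g p (curvature A D p X Y Y) X)"

definition lengthy ::
  "('a, 'm::finite) chart set \<Rightarrow> ('a \<Rightarrow> (complex^'m) set) \<Rightarrow> real set \<Rightarrow> (real \<Rightarrow> 'a) \<Rightarrow> bool" where
  "lengthy A T10 I \<gamma> \<longleftrightarrow> (\<forall>t\<in>I. velocity A I \<gamma> t \<in> levi_distribution T10 (\<gamma> t))"

definition horizontally_conjugate ::
  "('a, 'm::finite) chart set \<Rightarrow> ('a \<Rightarrow> (complex^'m) set) \<Rightarrow> ('a, 'm) connection \<Rightarrow> real set
     \<Rightarrow> (real \<Rightarrow> 'a) \<Rightarrow> real \<Rightarrow> real \<Rightarrow> bool" where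
  "horizontally_conjugate A T10 D I \<gamma> a b \<longleftrightarrow>
     (\<exists>X. jacobi_field A D I \<gamma> X \<and> (\<exists>t\<in>I. X t \<noteq> 0) \<and>
        (\<forall>t\<in>I. X t \<in> levi_distribution T10 (\<gamma> t)) \<and> X a = 0 \<and> X b = 0)"

end

theory Submission
  imports Defs
begin

text \<open>The torsion of two horizontal vectors is a multiple of \<open>T\<close>, and \<open>T\<close> is parallel, so the torsion
  term of the Jacobi equation is orthogonal to every horizontal field. For a horizontal Jacobi field
  \<open>X\<close> along \<open>\<gamma>\<close> this leaves \<open>g(X'',X) = -g(R(X,\<gamma>')\<gamma>',X) \<ge> 0\<close>; hence \<open>g(X,X')\<close> is nondecreasing. It
  vanishes at both zeros of \<open>X\<close>, so \<open>X\<close> vanishes between them. The energy \<open>g(X,X) + g(X',X')\<close> then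
  has a zero, and since \<open>R\<close> is a smooth tensor, Gronwall's inequality spreads this zero along \<open>\<gamma>\<close>.\<close>

section \<open>Smooth maps\<close>

text \<open>The definitions evaluate torsion and curvature at p on the extensions
  \<open>extend_vec A p v\<close>, and the covariant derivative along \<gamma> in the chart
  \<open>chart_at A (\<gamma> t)\<close>. Both choices may jump as the point moves, so linearity,
  smoothness and differentiability along \<gamma> cannot be read off directly. Most of the work
  rewrites these objects over one fixed chart, where the terms depending on the choice cancel; for
  torsion and curvature this is the symmetry of second derivatives of transition maps. Since
  \<nabla> has torsion, the pair symmetry known for a Levi-Civita connection is not at hand. The
  passage from 2-planes to g(R(u,v)v,u) rests on two skew symmetries: of R in its first two
  arguments, and of g(R(u,v)w,x) in w and x. The Jacobi equation is used only through its pairings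
  with X and X', both horizontal. The derivative of the energy then contains only g(X,X') and
  g(R(X,\<gamma>')\<gamma>',X'), each dominated locally by a multiple of the energy, so no theory of
  linear differential equations enters.\<close>

lemma Ck_on_cong:
  assumes "open S" "\<And>x. x \<in> S \<Longrightarrow> f x = g x" "Ck_on k S f"
  shows "Ck_on k S g"
  using assms(2,3)
proof (induction k arbitrary: f g)
  case 0
  then show ?case by (simp cong: continuous_on_cong)
next
  case (Suc k)
  have d: "(g has_derivative frechet_derivative f (at x)) (at x)" if "x \<in> S" for x
  proof -
    have "(f has_derivative frechet_derivative f (at x)) (at x)"
      using Suc.prems(2) that frechet_derivative_works by auto
    then show ?thesis
      by (rule has_derivative_transform_within_open[OF _ assms(1) that]) (rule Suc.prems(1))
  qed
  have eq: "frechet_derivative f (at x) v = frechet_derivative g (at x) v" if "x \<in> S" for x v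
    using frechet_derivative_at[OF d[OF that]] by simp
  have "Ck_on k S (\<lambda>x. frechet_derivative g (at x) v)" for v
    by (rule Suc.IH[of "\<lambda>x. frechet_derivative f (at x) v"]) (use Suc.prems(2) in \<open>simp_all add: eq\<close>)
  then show ?case
    using differentiableI[OF d] by simp
qed

lemma Ck_on_subset: "Ck_on k S f \<Longrightarrow> S' \<subseteq> S \<Longrightarrow> Ck_on k S' f"
  by (induction k arbitrary: f) (auto intro: continuous_on_subset)

lemma Ck_on_SucD: "Ck_on (Suc k) S f \<Longrightarrow> Ck_on k S f"
proof (induction k arbitrary: f)
  case 0
  then show ?case
    by (auto intro!: differentiable_imp_continuous_on differentiable_at_imp_differentiable_on)
next
  case (Suc k)
  then show ?case by (metis Ck_on.simps(2))
qed

lemma Ck_on_const: "Ck_on k S (\<lambda>x. a)"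
  by (induction k arbitrary: a) auto

lemma Ck_on_add:
  assumes "open S" "Ck_on k S f" "Ck_on k S g"
  shows "Ck_on k S (\<lambda>x. f x + g x)"
  using assms(2,3)
proof (induction k arbitrary: f g)
  case 0
  then show ?case by (auto intro: continuous_intros)
next
  case (Suc k)
  have d: "((\<lambda>x. f x + g x) has_derivative
      (\<lambda>v. frechet_derivative f (at x) v + frechet_derivative g (at x) v)) (at x)" if "x \<in> S" for x
    using Suc.prems that by (auto intro!: has_derivative_add simp: frechet_derivative_works[symmetric])
  have "Ck_on k S (\<lambda>x. frechet_derivative (\<lambda>x. f x + g x) (at x) v)" for v
  proof (rule Ck_on_cong[OF assms(1)])
    show "Ck_on k S (\<lambda>x. frechet_derivative f (at x) v + frechet_derivative g (at x) v)"
      using Suc by auto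
  qed (simp add: frechet_derivative_at[OF d, symmetric])
  then show ?case using differentiableI[OF d] by simp
qed

lemma Ck_on_linear:
  assumes "open S" "bounded_linear L" "Ck_on k S f"
  shows "Ck_on k S (\<lambda>x. L (f x))"
  using assms(3)
proof (induction k arbitrary: f)
  case 0
  then show ?case using assms(2) by (simp add: linear_continuous_on_compose bounded_linear.linear
     bounded_linear.continuous_on)
next
  case (Suc k)
  have d: "((\<lambda>x. L (f x)) has_derivative (\<lambda>v. L (frechet_derivative f (at x) v))) (at x)"
    if "x \<in> S" for x
    using Suc.prems that
    by (auto intro!: bounded_linear.has_derivative[OF assms(2)] simp: frechet_derivative_works[symmetric])
  have "Ck_on k S (\<lambda>x. frechet_derivative (\<lambda>x. L (f x)) (at x) v)" for v
  proof (rule Ck_on_cong[OF assms(1)])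
    show "Ck_on k S (\<lambda>x. L (frechet_derivative f (at x) v))"
      using Suc by auto
  qed (simp add: frechet_derivative_at[OF d, symmetric])
  then show ?case using differentiableI[OF d] by simp
qed

lemma Ck_on_scaleR:
  assumes "open S" "Ck_on k S f" "Ck_on k S g"
  shows "Ck_on k S (\<lambda>x. f x *\<^sub>R g x)"
  using assms(2,3)
proof (induction k arbitrary: f g)
  case 0
  then show ?case by (auto intro: continuous_intros)
next
  case (Suc k)
  have d: "((\<lambda>x. f x *\<^sub>R g x) has_derivative
      (\<lambda>v. f x *\<^sub>R frechet_derivative g (at x) v + frechet_derivative f (at x) v *\<^sub>R g x)) (at x)"
    if "x \<in> S" for x
    using Suc.prems that
      by (auto intro!: has_derivative_scaleR simp: frechet_derivative_works[symmetric])
  have "Ck_on k S (\<lambda>x. frechet_derivative (\<lambda>x. f x *\<^sub>R g x) (at x) v)" for v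
  proof (rule Ck_on_cong[OF assms(1)])
    show "Ck_on k S (\<lambda>x. f x *\<^sub>R frechet_derivative g (at x) v + frechet_derivative f (at x) v *\<^sub>R g x)"
      by (intro Ck_on_add Suc.IH Ck_on_SucD[OF Suc.prems(1)] Ck_on_SucD[OF Suc.prems(2)] assms(1))
        (use Suc.prems in simp_all)
  qed (simp add: frechet_derivative_at[OF d, symmetric])
  then show ?case using differentiableI[OF d] by simp
qed

lemma Ck_on_sum:
  assumes "open S" "\<And>i. i \<in> J \<Longrightarrow> Ck_on k S (f i)"
  shows "Ck_on k S (\<lambda>x. \<Sum>i\<in>J. f i x)"
  using assms(2)
  by (induction J rule: infinite_finite_induct) (auto intro: Ck_on_const Ck_on_add assms(1))

text \<open>The chain rule alone does not fit the recursion of \<open>Ck_on\<close>, because the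
  direction in which \<open>f\<close> is differentiated varies with \<open>x\<close>. Expanding that
  direction in the basis of the Euclidean space in the middle gives a finite sum of products of
  functions that are one order less smooth.\<close>

lemma Ck_on_compose:
  fixes h :: "'a::real_normed_vector \<Rightarrow> 'b::euclidean_space"
  assumes "open S" "Ck_on k S h" "h ` S \<subseteq> S'" "Ck_on k S' f"
  shows "Ck_on k S (f \<circ> h)"
  using assms(2,4)
proof (induction k arbitrary: f)
  case 0
  then show ?case using assms(3) continuous_on_compose continuous_on_subset by (metis Ck_on.simps(1))
next
  case (Suc k)
  have d: "((f \<circ> h) has_derivative
      (frechet_derivative f (at (h x)) \<circ> frechet_derivative h (at x))) (at x)"
    if "x \<in> S" for x
    using Suc.prems that assms(3)
    by (auto intro!: diff_chain_at simp: frechet_derivative_works[symmetric])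
  have eq: "frechet_derivative (f \<circ> h) (at x) v =
      (\<Sum>b\<in>Basis. (frechet_derivative h (at x) v \<bullet> b) *\<^sub>R ((\<lambda>y. frechet_derivative f (at y) b) \<circ> h) x)"
    if "x \<in> S" for x v
  proof -
    have l: "linear (frechet_derivative f (at (h x)))"
      using Suc.prems that assms(3) by (intro linear_frechet_derivative) auto
    have "frechet_derivative (f \<circ> h) (at x) v
        = frechet_derivative f (at (h x)) (frechet_derivative h (at x) v)"
      by (simp add: frechet_derivative_at[OF d[OF that], symmetric])
    also have "\<dots>
        = frechet_derivative f (at (h x)) (\<Sum>b\<in>Basis. (frechet_derivative h (at x) v \<bullet> b) *\<^sub>R b)"
      by (simp add: euclidean_representation)
    finally show ?thesis by (simp add: linear_sum[OF l] linear_scale[OF l])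
  qed
  have "Ck_on k S (\<lambda>x. frechet_derivative (f \<circ> h) (at x) v)" for v
  proof (rule Ck_on_cong[OF assms(1)])
    show "Ck_on k S (\<lambda>x. \<Sum>b\<in>Basis. (frechet_derivative h (at x) v \<bullet> b) *\<^sub>R ((\<lambda>y. frechet_derivative f (at y) b) \<circ> h) x)"
    proof (intro Ck_on_sum Ck_on_scaleR assms(1))
      fix b :: 'b assume "b \<in> Basis"
      show "Ck_on k S (\<lambda>x. frechet_derivative h (at x) v \<bullet> b)"
        using Suc.prems(1) by (intro Ck_on_linear[OF assms(1) bounded_linear_inner_left]) simp
      have "Ck_on k S' (\<lambda>y. frechet_derivative f (at y) b)"
        using Suc.prems(2) by simp
      then show "Ck_on k S (\<lambda>x. ((\<lambda>y. frechet_derivative f (at y) b) \<circ> h) x)"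
        using Suc.IH[OF Ck_on_SucD[OF Suc.prems(1)], of "\<lambda>y. frechet_derivative f (at y) b"]
          by (simp add: o_def)
    qed
  qed (simp add: eq)
  then show ?case using differentiableI[OF d] unfolding Ck_on.simps by blast
qed

lemma smooth_on_cong:
  "open S \<Longrightarrow> (\<And>x. x \<in> S \<Longrightarrow> f x = g x) \<Longrightarrow> smooth_on S f \<Longrightarrow> smooth_on S g"
  unfolding smooth_on_def using Ck_on_cong by blast

lemma smooth_on_subset: "smooth_on S f \<Longrightarrow> S' \<subseteq> S \<Longrightarrow> smooth_on S' f"
  unfolding smooth_on_def using Ck_on_subset by blast

lemma smooth_on_const: "smooth_on S (\<lambda>x. a)"
  by (simp add: smooth_on_def Ck_on_const)

lemma smooth_on_add:
  "open S \<Longrightarrow> smooth_on S f \<Longrightarrow> smooth_on S g \<Longrightarrow> smooth_on S (\<lambda>x. f x + g x)"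
  by (simp add: smooth_on_def Ck_on_add)

lemma smooth_on_scaleR:
  "open S \<Longrightarrow> smooth_on S f \<Longrightarrow> smooth_on S g \<Longrightarrow> smooth_on S (\<lambda>x. f x *\<^sub>R g x)"
  by (simp add: smooth_on_def Ck_on_scaleR)

lemma smooth_on_linear:
  "open S \<Longrightarrow> bounded_linear L \<Longrightarrow> smooth_on S f \<Longrightarrow> smooth_on S (\<lambda>x. L (f x))"
  by (simp add: smooth_on_def Ck_on_linear)

lemma smooth_on_compose:
  fixes h :: "'a::real_normed_vector \<Rightarrow> 'b::euclidean_space"
  shows "open S \<Longrightarrow> smooth_on S h \<Longrightarrow> h ` S \<subseteq> S' \<Longrightarrow> smooth_on S' f \<Longrightarrow> smooth_on S (f \<circ> h)"
  by (simp add: smooth_on_def Ck_on_compose)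

lemma smooth_on_sum:
  "open S \<Longrightarrow> (\<And>i. i \<in> J \<Longrightarrow> smooth_on S (f i)) \<Longrightarrow> smooth_on S (\<lambda>x. \<Sum>i\<in>J. f i x)"
  by (simp add: smooth_on_def Ck_on_sum)

lemma smooth_on_differentiable: "smooth_on S f \<Longrightarrow> x \<in> S \<Longrightarrow> f differentiable (at x)"
  unfolding smooth_on_def by (metis Ck_on.simps(2))

lemma smooth_on_continuous: "smooth_on S f \<Longrightarrow> continuous_on S f"
  unfolding smooth_on_def by (metis Ck_on.simps(1))

lemma smooth_on_frechet: "smooth_on S f \<Longrightarrow> smooth_on S (\<lambda>x. frechet_derivative f (at x) v)"
  unfolding smooth_on_def by (metis Ck_on.simps(2))

section \<open>Symmetry of second derivatives\<close>

text \<open>The mean value theorem is applied twice: in direction \<open>u\<close> to the difference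
  of \<open>f\<close> between \<open>x + h v + s u\<close> and \<open>x + s u\<close>, then in
  direction \<open>v\<close> to the resulting difference of \<open>u\<close>-derivatives. The
  left-hand side of the conclusion is symmetric in \<open>u\<close> and \<open>v\<close>, which is
  the point of the formula.\<close>

lemma second_difference_mvt:
  fixes f :: "'a::real_normed_vector \<Rightarrow> real"
  assumes f: "smooth_on S f" and h: "h > 0"
    and S: "\<And>s t. 0 \<le> s \<Longrightarrow> s \<le> h \<Longrightarrow> 0 \<le> t \<Longrightarrow> t \<le> h \<Longrightarrow> x + s *\<^sub>R u + t *\<^sub>R v \<in> S"
  obtains s t where "0 < s" "s < h" "0 < t" "t < h"
    "f (x + h *\<^sub>R u + h *\<^sub>R v) - f (x + h *\<^sub>R u) - f (x + h *\<^sub>R v) + f x =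
      h * h * frechet_derivative (\<lambda>y. frechet_derivative f (at y) u) (at (x + s *\<^sub>R u + t *\<^sub>R v)) v"
proof -
  have der: "((\<lambda>s. p (y + s *\<^sub>R w))
      has_real_derivative frechet_derivative p (at (y + s *\<^sub>R w)) w) (at s)"
    if "smooth_on S p" "y + s *\<^sub>R w \<in> S" for p :: "'a \<Rightarrow> real" and y w s
  proof -
    have p: "(p has_derivative frechet_derivative p (at (y + s *\<^sub>R w))) (at (y + s *\<^sub>R w))"
      using smooth_on_differentiable[OF that] frechet_derivative_works by blast
    have i: "((\<lambda>s. y + s *\<^sub>R w) has_derivative (\<lambda>r. r *\<^sub>R w)) (at s)"
      by (auto intro!: derivative_eq_intros)
    have "((\<lambda>s. p (y
        + s *\<^sub>R w)) has_derivative (\<lambda>r. frechet_derivative p (at (y + s *\<^sub>R w)) (r *\<^sub>R w))) (at s)"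
      using diff_chain_at[OF i p] by (simp add: o_def)
    then show ?thesis
      using linear_scale[OF has_derivative_linear[OF p]]
      by (simp add: has_field_derivative_def mult.commute[of _ "_::real"] fun_eq_iff)
        (metis (lifting) ext mult.commute)
  qed
  let ?D = "\<lambda>y. frechet_derivative f (at y) u"
  let ?F = "\<lambda>s. f (x + h *\<^sub>R v + s *\<^sub>R u) - f (x + s *\<^sub>R u)"
  have "\<exists>s. 0 < s \<and> s < h \<and> ?F h - ?F 0 = (h - 0) * (?D (x + h *\<^sub>R v + s *\<^sub>R u) - ?D (x + s *\<^sub>R u))"
    by (rule MVT2[OF h], rule DERIV_diff; rule der[OF f])
      (use S[of _ h] S[of _ 0] h in \<open>auto simp: algebra_simps\<close>)
  then obtain s where s: "0 < s"
      "s < h" "?F h - ?F 0 = h * (?D (x + h *\<^sub>R v + s *\<^sub>R u) - ?D (x + s *\<^sub>R u))"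
    by auto
  have "\<exists>t. 0 < t \<and> t < h \<and> ?D (x + s *\<^sub>R u + h *\<^sub>R v) - ?D (x + s *\<^sub>R u + 0 *\<^sub>R v)
      = (h - 0) * frechet_derivative ?D (at (x + s *\<^sub>R u + t *\<^sub>R v)) v"
    by (rule MVT2[OF h], rule der[OF smooth_on_frechet[OF f]]) (use S[of s] s in auto)
  then obtain t where "0 < t" "t < h"
    "?D (x + s *\<^sub>R u + h *\<^sub>R v) - ?D (x + s *\<^sub>R u)
        = h * frechet_derivative ?D (at (x + s *\<^sub>R u + t *\<^sub>R v)) v"
    by auto
  then show thesis using s by (intro that[of s t]) (auto simp: algebra_simps)
qed

text \<open>The same second difference is computed in both orders. Divided by \<open>h * h\<close>
  it is one mixed derivative at a point near \<open>x\<close> and the other mixed derivative at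
  another such point; both are continuous, so they agree at \<open>x\<close>.\<close>

lemma frechet_derivative_symmetric:
  fixes f :: "'a::real_normed_vector \<Rightarrow> real"
  assumes "open S" "x \<in> S" and f: "smooth_on S f"
  shows "frechet_derivative (\<lambda>y. frechet_derivative f (at y) u) (at x) v =
         frechet_derivative (\<lambda>y. frechet_derivative f (at y) v) (at x) u"
proof -
  define P where "P = (\<lambda>u v z. frechet_derivative (\<lambda>y. frechet_derivative f (at y) u) (at z) v)"
  have cont: "\<exists>d>0. \<forall>z. dist z x < d \<longrightarrow> dist (P u v z) (P u v x) < e" if "e > 0" for u v e
  proof -
    have "continuous_on S (P u v)"
      unfolding P_def by (intro smooth_on_continuous smooth_on_frechet f)
    then have "isCont (P u v) x"
      using assms continuous_on_eq_continuous_at by blast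
    then show ?thesis
      using that by (simp add: continuous_at_eps_delta)
  qed
  have "dist (P u v x) (P v u x) < e" if "e > 0" for e
  proof -
    have e2: "e/2 > 0" using that by simp
    obtain d1 where d1: "d1 > 0" "\<And>z. dist z x < d1 \<Longrightarrow> dist (P u v z) (P u v x) < e/2"
      using cont[OF e2] by blast
    obtain d2 where d2: "d2 > 0" "\<And>z. dist z x < d2 \<Longrightarrow> dist (P v u z) (P v u x) < e/2"
      using cont[OF e2] by blast
    obtain d3 where d3: "d3 > 0" "ball x d3 \<subseteq> S"
      using assms openE by blast
    define d where "d = min d1 (min d2 d3)"
    have d: "d > 0" "d \<le> d1" "d \<le> d2" "d \<le> d3" using d1 d2 d3 by (auto simp: d_def)
    \<comment> \<open>The whole parallelogram spanned by \<open>h u\<close> and \<open>h v\<close>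
      at \<open>x\<close> stays within distance \<open>d\<close>; the summand 1 makes the
      denominator positive and the estimate strict.\<close>
    define h where "h = d / (norm u + norm v + 1)"
    have n: "norm u + norm v + 1 > 0" by (smt (verit) norm_ge_zero)
    have h: "h > 0" using d n by (simp add: h_def)
    have near: "dist (x + s *\<^sub>R u + t *\<^sub>R v) x < d" if "0 \<le> s" "s \<le> h" "0 \<le> t" "t \<le> h" for s t
    proof -
      have "dist (x + s *\<^sub>R u + t *\<^sub>R v) x = norm (s *\<^sub>R u + t *\<^sub>R v)"
        by (simp add: dist_norm algebra_simps)
      also have "\<dots> \<le> s * norm u + t * norm v"
        using norm_triangle_ineq[of "s *\<^sub>R u" "t *\<^sub>R v"] that by simp
      also have "\<dots> \<le> h * norm u + h * norm v"
        using that by (intro add_mono mult_right_mono) auto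
      also have "\<dots> < h * (norm u + norm v + 1)" using h by (simp add: algebra_simps)
      also have "\<dots> = d" using n by (simp add: h_def)
      finally show ?thesis .
    qed
    have inS: "x + s *\<^sub>R u + t *\<^sub>R v \<in> S" if "0 \<le> s" "s \<le> h" "0 \<le> t" "t \<le> h" for s t
      using near[OF that] d d3 by (auto simp: mem_ball dist_commute)
    obtain s t where st: "0 < s" "s < h" "0 < t" "t < h"
      "f (x + h *\<^sub>R u + h *\<^sub>R v) - f (x + h *\<^sub>R u) - f (x + h *\<^sub>R v) + f x
          = h * h * P u v (x + s *\<^sub>R u + t *\<^sub>R v)"
      using second_difference_mvt[OF f h, of x u v] inS unfolding P_def by blast
    have inS': "x + s *\<^sub>R v + t *\<^sub>R u \<in> S" if "0 \<le> s" "s \<le> h" "0 \<le> t" "t \<le> h" for s t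
      using inS[of t s] that by (simp add: algebra_simps)
    obtain s' t' where st': "0 < s'" "s' < h" "0 < t'" "t' < h"
      "f (x + h *\<^sub>R v + h *\<^sub>R u) - f (x + h *\<^sub>R v) - f (x + h *\<^sub>R u) + f x
          = h * h * P v u (x + s' *\<^sub>R v + t' *\<^sub>R u)"
      using second_difference_mvt[OF f h, of x v u] inS' unfolding P_def by blast
    have "h * h * P u v (x + s *\<^sub>R u + t *\<^sub>R v) = h * h * P v u (x + t' *\<^sub>R u + s' *\<^sub>R v)"
      using st(5) st'(5) by (simp add: algebra_simps)
    then have "P u v (x + s *\<^sub>R u + t *\<^sub>R v) = P v u (x + t' *\<^sub>R u + s' *\<^sub>R v)"
      using h by simp
    moreover have "dist (P u v (x + s *\<^sub>R u + t *\<^sub>R v)) (P u v x) < e/2"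
      using st near[of s t] d by (intro d1) auto
    moreover have "dist (P v u (x + t' *\<^sub>R u + s' *\<^sub>R v)) (P v u x) < e/2"
      using st' near[of t' s'] d by (intro d2) auto
    ultimately show ?thesis
      using dist_triangle_half_r by metis
  qed
  then have "P u v x = P v u x"
    by (metis dist_eq_0_iff less_irrefl zero_less_dist_iff)
  then show ?thesis by (simp add: P_def)
qed

section \<open>Calculus on a manifold\<close>

text \<open>\<open>frechet_derivative\<close> is chosen from the predicate
  \<open>has_derivative\<close> alone, so equality of the two predicates suffices. It covers the
  unspecified value at points without a derivative as well.\<close>

lemma frechet_derivative_cong_open:
  assumes "open S" "x \<in> S" "\<And>y. y \<in> S \<Longrightarrow> f y = g y"
  shows "frechet_derivative f (at x) = frechet_derivative g (at x)"
proof -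
  have "(f has_derivative f') (at x) \<longleftrightarrow> (g has_derivative f') (at x)" for f'
    using assms(3) has_derivative_transform_within_open[OF _ assms(1,2), of f f' UNIV g]
      has_derivative_transform_within_open[OF _ assms(1,2), of g f' UNIV f] by force
  then show ?thesis by (simp add: frechet_derivative_def)
qed

locale atlas =
  fixes A :: "('a::{t2_space,second_countable_topology}, 'm::finite) chart set"
  assumes atlas: "smooth_atlas A"
begin

lemma chart_at_mem: "chart_at A p \<in> A" "p \<in> fst (chart_at A p)"
proof -
  obtain c where "c \<in> A \<and> p \<in> fst c" using atlas unfolding smooth_atlas_def by blast
  then have "chart_at A p \<in> A \<and> p \<in> fst (chart_at A p)"
    unfolding chart_at_def by (rule someI)
  then show "chart_at A p \<in> A" "p \<in> fst (chart_at A p)" by auto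
qed

lemma open_chart_domain: "c \<in> A \<Longrightarrow> open (fst c)"
  using atlas unfolding smooth_atlas_def by blast

lemma open_chart_domain_Int: "c \<in> A \<Longrightarrow> open U \<Longrightarrow> open (fst c \<inter> U)"
  by (intro open_Int open_chart_domain)

lemma chart_homeomorphism: "c \<in> A \<Longrightarrow> homeomorphism (fst c) (snd c ` fst c) (snd c) (chart_inv c)"
  using atlas unfolding smooth_atlas_def by blast

lemma chart_inv_chart: "c \<in> A \<Longrightarrow> p \<in> fst c \<Longrightarrow> chart_inv c (snd c p) = p"
  using chart_homeomorphism homeomorphism_apply1 by blast

lemma open_chart_image:
  assumes "c \<in> A" "open U"
  shows "open (snd c ` (fst c \<inter> U))"
proof -
  have "openin (top_of_set (fst c)) (fst c \<inter> U)"
    using assms by (simp add: openin_open_Int)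
  then have "openin (top_of_set (snd c ` fst c)) (snd c ` (fst c \<inter> U))"
    using homeomorphism_imp_open_map[OF chart_homeomorphism[OF assms(1)]] by blast
  moreover have "open (snd c ` fst c)"
    using atlas assms unfolding smooth_atlas_def by blast
  ultimately show ?thesis using openin_open_trans by blast
qed

lemma transition_smooth:
  "c \<in> A \<Longrightarrow> d \<in> A \<Longrightarrow> smooth_on (snd c ` (fst c \<inter> fst d)) (snd d \<circ> chart_inv c)"
  using atlas unfolding smooth_atlas_def by blast

section \<open>Derivatives along tangent vectors in an arbitrary chart\<close>

lemma tderiv_cong:
  assumes "open U" "p \<in> U" "\<And>q. q \<in> U \<Longrightarrow> f q = h q"
  shows "tderiv A f p v = tderiv A h p v"
proof -
  let ?c = "chart_at A p"
  have "frechet_derivative (f \<circ> chart_inv ?c) (at (snd ?c p))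
      = frechet_derivative (h \<circ> chart_inv ?c) (at (snd ?c p))"
    by (rule frechet_derivative_cong_open[OF open_chart_image[OF chart_at_mem(1) assms(1)]])
      (use assms chart_at_mem in \<open>auto simp: chart_inv_chart\<close>)
  then show ?thesis by (simp add: tderiv_def)
qed

lemma transition_has_derivative:
  assumes "c \<in> A" "d \<in> A" "p \<in> fst c" "p \<in> fst d"
  shows "((snd d \<circ> chart_inv c) has_derivative frechet_derivative (snd d \<circ> chart_inv c) (at (snd c p))) (at (snd c p))"
  using smooth_on_differentiable[OF transition_smooth[OF assms(1,2)]] assms(3,4)
  by (auto simp: frechet_derivative_works[symmetric])

text \<open>Chain rule through the transition map. The factorisation of
  \<open>f \<circ> chart_inv d\<close> holds only on the image of the overlap of the two domains,
  hence the transfer within an open set.\<close>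

lemma has_derivative_change_chart:
  assumes c: "c \<in> A" "p \<in> fst c" and d: "d \<in> A" "p \<in> fst d"
    and f: "(f \<circ> chart_inv c has_derivative f') (at (snd c p))"
  shows "(f \<circ> chart_inv d has_derivative
    (\<lambda>v. f' (frechet_derivative (snd c \<circ> chart_inv d) (at (snd d p)) v))) (at (snd d p))"
proof -
  have "((f \<circ> chart_inv c) \<circ> (snd c \<circ> chart_inv d) has_derivative
    f' \<circ> frechet_derivative (snd c \<circ> chart_inv d) (at (snd d p))) (at (snd d p))"
    using f d by (intro diff_chain_at transition_has_derivative c d) (simp add: chart_inv_chart)
  then have "(f \<circ> chart_inv d has_derivative
    f' \<circ> frechet_derivative (snd c \<circ> chart_inv d) (at (snd d p))) (at (snd d p))"
    by (rule has_derivative_transform_within_open[OF _ open_chart_image[OF d(1) open_chart_domain[OF c(1)]]])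
      (use c d in \<open>auto simp: chart_inv_chart\<close>)
  then show ?thesis by (simp add: o_def)
qed

text \<open>This removes the preferred chart from \<open>tderiv\<close>: any chart around
  \<open>p\<close> computes the derivative once the vector is replaced by its components in that
  chart.\<close>

lemma tderiv_eq_chart:
  assumes c: "c \<in> A" "p \<in> fst c" and f: "(f \<circ> chart_inv c) differentiable (at (snd c p))"
  shows "tderiv A f p v = frechet_derivative (f \<circ> chart_inv c) (at (snd c p)) (tderiv A (snd c) p v)"
proof -
  have "(f \<circ> chart_inv c has_derivative frechet_derivative (f \<circ> chart_inv c) (at (snd c p))) (at (snd c p))"
    using f by (simp add: frechet_derivative_works)
  from frechet_derivative_at[OF has_derivative_change_chart[OF c chart_at_mem this]]
  show ?thesis unfolding tderiv_def by (rule fun_cong[OF sym])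
qed

lemma linear_tderiv_chart:
  assumes "c \<in> A" "p \<in> fst c"
  shows "linear (tderiv A (snd c) p)"
  using transition_has_derivative[OF chart_at_mem(1) assms(1) chart_at_mem(2) assms(2)]
  unfolding tderiv_def[abs_def] by (rule has_derivative_linear)

lemma tderiv_chart_at [simp]: "tderiv A (snd (chart_at A p)) p v = v"
proof -
  let ?c = "chart_at A p"
  have "((\<lambda>x. x) has_derivative (\<lambda>v. v)) (at (snd ?c p))" by simp
  then have "(snd ?c \<circ> chart_inv ?c has_derivative (\<lambda>v. v)) (at (snd ?c p))"
    by (rule has_derivative_transform_within_open[OF _ open_chart_image[OF chart_at_mem(1) open_UNIV]])
      (use chart_at_mem in \<open>auto simp: chart_inv_chart\<close>)
  from frechet_derivative_at[OF this] show ?thesis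
    unfolding tderiv_def by (rule fun_cong[OF sym])
qed

lemma tderiv_coord_field:
  assumes "c \<in> A" "p \<in> fst c" "(f \<circ> chart_inv c) differentiable (at (snd c p))"
  shows "tderiv A f p (coord_field A c w p) = frechet_derivative (f \<circ> chart_inv c) (at (snd c p)) w"
proof -
  let ?d = "chart_at A p"
  have f: "(f \<circ> chart_inv c has_derivative frechet_derivative (f \<circ> chart_inv c) (at (snd c p))) (at (snd c p))"
    using assms by (simp add: frechet_derivative_works)
  have g: "(f \<circ> chart_inv ?d has_derivative frechet_derivative (f \<circ> chart_inv ?d) (at (snd ?d p))) (at (snd ?d p))"
    unfolding frechet_derivative_works[symmetric]
    by (rule differentiableI[OF has_derivative_change_chart[OF assms(1,2) chart_at_mem f]])
  from frechet_derivative_at[OF has_derivative_change_chart[OF chart_at_mem assms(1,2) g]]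
  show ?thesis unfolding coord_field_def tderiv_def by (rule fun_cong)
qed

lemma chart_differentiable:
  assumes "c \<in> A" "p \<in> fst c"
  shows "(snd c \<circ> chart_inv c has_derivative (\<lambda>v. v)) (at (snd c p))"
  by (rule has_derivative_transform_within_open[OF has_derivative_ident open_chart_image[OF assms(1) open_UNIV]])
    (use assms in \<open>auto simp: chart_inv_chart\<close>)

lemma components_coord_field [simp]:
  assumes "c \<in> A" "p \<in> fst c"
  shows "tderiv A (snd c) p (coord_field A c w p) = w"
  unfolding tderiv_coord_field[OF assms differentiableI[OF chart_differentiable[OF assms]]]
    frechet_derivative_at[OF chart_differentiable[OF assms], symmetric] by (rule refl)

lemma coord_field_components [simp]:
  assumes "c \<in> A" "p \<in> fst c"
  shows "coord_field A c (tderiv A (snd c) p v) p = v"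
proof -
  let ?d = "chart_at A p"
  have "(snd ?d \<circ> chart_inv c) differentiable (at (snd c p))"
    using transition_has_derivative[OF assms(1) chart_at_mem(1) assms(2) chart_at_mem(2)] differentiableI by blast
  from tderiv_eq_chart[OF assms this] show ?thesis by (simp add: coord_field_def)
qed

lemma linear_coord_field:
  assumes "c \<in> A" "p \<in> fst c"
  shows "linear (\<lambda>w. coord_field A c w p)"
  using transition_has_derivative[OF assms(1) chart_at_mem(1) assms(2) chart_at_mem(2)]
  unfolding coord_field_def by (rule has_derivative_linear)

lemma vec_expansion:
  fixes x :: "real^'m"
  shows "(\<Sum>i\<in>UNIV. (x $ i) *\<^sub>R axis i 1) = x"
  using basis_expansion[of x] by (simp add: scalar_mult_eq_scaleR)

lemma coord_field_eq_sum:
  assumes "c \<in> A" "p \<in> fst c"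
  shows "coord_field A c w p = (\<Sum>i\<in>UNIV. w $ i *\<^sub>R coord_field A c (axis i 1) p)"
proof -
  have "coord_field A c (\<Sum>i\<in>UNIV. (w $ i) *\<^sub>R axis i 1) p
      = (\<Sum>i\<in>UNIV. w $ i *\<^sub>R coord_field A c (axis i 1) p)"
    by (simp add: linear_sum[OF linear_coord_field[OF assms]] linear_scale[OF linear_coord_field[OF assms]])
  then show ?thesis by (simp add: vec_expansion)
qed

lemma vec_eq_sum:
  assumes "c \<in> A" "p \<in> fst c"
  shows "v = (\<Sum>i\<in>UNIV. tderiv A (snd c) p v $ i *\<^sub>R coord_field A c (axis i 1) p)"
  using coord_field_eq_sum[OF assms, of "tderiv A (snd c) p v"] assms by simp

subsection \<open>Smooth functions\<close>

lemma smooth_fun_onD: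
  assumes "smooth_fun_on A U f" "c \<in> A" "p \<in> fst c" "p \<in> U"
  shows "(f \<circ> chart_inv c) differentiable (at (snd c p))"
  using assms smooth_on_differentiable unfolding smooth_fun_on_def by blast

lemma smooth_fun_on_subset: "smooth_fun_on A U f \<Longrightarrow> U' \<subseteq> U \<Longrightarrow> smooth_fun_on A U' f"
  unfolding smooth_fun_on_def by (meson Int_mono image_mono order_refl smooth_on_subset)

lemma smooth_fun_on_cong:
  assumes "open U" "smooth_fun_on A U f" "\<And>q. q \<in> U \<Longrightarrow> f q = h q"
  shows "smooth_fun_on A U h"
  unfolding smooth_fun_on_def
proof
  fix c assume c: "c \<in> A"
  show "smooth_on (snd c ` (fst c \<inter> U)) (h \<circ> chart_inv c)"
    by (rule smooth_on_cong[OF open_chart_image[OF c assms(1)], of "f \<circ> chart_inv c"])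
      (use assms c in \<open>auto simp: smooth_fun_on_def chart_inv_chart\<close>)
qed

lemma smooth_fun_on_const: "smooth_fun_on A U (\<lambda>q. a)"
  by (simp add: smooth_fun_on_def o_def smooth_on_const)

lemma smooth_fun_on_add:
  "open U \<Longrightarrow> smooth_fun_on A U f \<Longrightarrow> smooth_fun_on A U h \<Longrightarrow> smooth_fun_on A U (\<lambda>q. f q + h q)"
  unfolding smooth_fun_on_def o_def by (auto intro: smooth_on_add open_chart_image)

lemma smooth_fun_on_scaleR:
  "open U \<Longrightarrow> smooth_fun_on A U f \<Longrightarrow> smooth_fun_on A U h \<Longrightarrow> smooth_fun_on A U (\<lambda>q. f q *\<^sub>R h q)"
  unfolding smooth_fun_on_def o_def by (auto intro: smooth_on_scaleR open_chart_image)

lemma smooth_fun_on_mult: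
  fixes f h :: "'a \<Rightarrow> real"
  shows "open U \<Longrightarrow> smooth_fun_on A U f \<Longrightarrow> smooth_fun_on A U h \<Longrightarrow> smooth_fun_on A U (\<lambda>q. f q * h q)"
  using smooth_fun_on_scaleR[of U f h] by simp

lemma smooth_fun_on_linear:
  "open U \<Longrightarrow> bounded_linear L \<Longrightarrow> smooth_fun_on A U f \<Longrightarrow> smooth_fun_on A U (\<lambda>q. L (f q))"
  unfolding smooth_fun_on_def o_def by (auto intro: smooth_on_linear open_chart_image)

lemma smooth_fun_on_nth:
  "open U \<Longrightarrow> smooth_fun_on A U f \<Longrightarrow> smooth_fun_on A U (\<lambda>q. f q $ i)"
  by (rule smooth_fun_on_linear[OF _ bounded_linear_vec_nth])

text \<open>Smoothness has to be tested in all charts by definition; compatibility of the charts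
  reduces the test to a single one.\<close>

lemma smooth_fun_on_chartI:
  assumes "c \<in> A" "open W" "W \<subseteq> fst c" "smooth_on (snd c ` W) h"
  shows "smooth_fun_on A W (h \<circ> snd c)"
  unfolding smooth_fun_on_def
proof
  fix d assume d: "d \<in> A"
  have "smooth_on (snd d ` (fst d \<inter> W)) (snd c \<circ> chart_inv d)"
    using transition_smooth[OF d assms(1)] by (rule smooth_on_subset) (use assms in auto)
  then have "smooth_on (snd d ` (fst d \<inter> W)) (h \<circ> (snd c \<circ> chart_inv d))"
    by (rule smooth_on_compose[OF open_chart_image[OF d assms(2)] _ _ assms(4)])
      (use d in \<open>auto simp: chart_inv_chart\<close>)
  then show "smooth_on (snd d ` (fst d \<inter> W)) (h \<circ> snd c \<circ> chart_inv d)"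
    by (simp add: o_assoc)
qed

lemma smooth_fun_on_chart:
  assumes "c \<in> A"
  shows "smooth_fun_on A (fst c) (snd c)"
  using transition_smooth assms unfolding smooth_fun_on_def by blast

subsection \<open>Smooth vector fields\<close>

lemma smooth_field_onD:
  "smooth_field_on A U X \<Longrightarrow> c \<in> A \<Longrightarrow> smooth_fun_on A (fst c \<inter> U) (\<lambda>q. tderiv A (snd c) q (X q))"
  unfolding smooth_field_on_def by blast

lemma smooth_field_on_subset: "smooth_field_on A U X \<Longrightarrow> U' \<subseteq> U \<Longrightarrow> smooth_field_on A U' X"
  unfolding smooth_field_on_def by (meson Int_mono order_refl smooth_fun_on_subset)

lemma smooth_field_on_cong:
  assumes "open U" "smooth_field_on A U X" "\<And>q. q \<in> U \<Longrightarrow> X q = Y q"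
  shows "smooth_field_on A U Y"
  unfolding smooth_field_on_def
proof
  fix c assume c: "c \<in> A"
  show "smooth_fun_on A (fst c \<inter> U) (\<lambda>q. tderiv A (snd c) q (Y q))"
    by (rule smooth_fun_on_cong[OF _ smooth_field_onD[OF assms(2) c]])
      (use assms c open_chart_domain_Int in \<open>auto simp del: split_paired_All split_paired_all\<close>)
qed

lemma smooth_field_on_add:
  assumes "open U" "smooth_field_on A U X" "smooth_field_on A U Y"
  shows "smooth_field_on A U (\<lambda>q. X q + Y q)"
  unfolding smooth_field_on_def
proof
  fix c assume c: "c \<in> A"
  have "open (fst c \<inter> U)" using c assms open_chart_domain_Int by blast
  from smooth_fun_on_cong[OF this smooth_fun_on_add[OF this assms(2,3)[THEN smooth_field_onD, OF c]]]
  show "smooth_fun_on A (fst c \<inter> U) (\<lambda>q. tderiv A (snd c) q (X q + Y q))"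
    using linear_add[OF linear_tderiv_chart[OF c]] by simp
qed

lemma smooth_field_on_scaleR:
  assumes "open U" "smooth_fun_on A U f" "smooth_field_on A U Y"
  shows "smooth_field_on A U (\<lambda>q. f q *\<^sub>R Y q)"
  unfolding smooth_field_on_def
proof
  fix c assume c: "c \<in> A"
  have o: "open (fst c \<inter> U)" using c assms open_chart_domain_Int by blast
  have f: "smooth_fun_on A (fst c \<inter> U) f" using assms(2) by (rule smooth_fun_on_subset) auto
  from smooth_fun_on_cong[OF o smooth_fun_on_scaleR[OF o f smooth_field_onD[OF assms(3) c]]]
  show "smooth_fun_on A (fst c \<inter> U) (\<lambda>q. tderiv A (snd c) q (f q *\<^sub>R Y q))"
    using linear_scale[OF linear_tderiv_chart[OF c]] by simp
qed

lemma smooth_field_on_zero: "smooth_field_on A U (\<lambda>q. 0)"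
  unfolding smooth_field_on_def
proof
  fix c assume c: "c \<in> A"
  have "smooth_fun_on A (fst c) (\<lambda>q. tderiv A (snd c) q 0)"
    by (rule smooth_fun_on_cong[OF open_chart_domain[OF c] smooth_fun_on_const[of _ 0]])
      (use linear_0[OF linear_tderiv_chart[OF c]] in simp)
  then show "smooth_fun_on A (fst c \<inter> U) (\<lambda>q. tderiv A (snd c) q 0)"
    by (rule smooth_fun_on_subset) auto
qed

lemma smooth_field_on_sum:
  "open U \<Longrightarrow> (\<And>i. i \<in> J \<Longrightarrow> smooth_field_on A U (X i)) \<Longrightarrow> smooth_field_on A U (\<lambda>q. \<Sum>i\<in>J. X i q)"
  by (induction J rule: infinite_finite_induct) (auto intro: smooth_field_on_zero smooth_field_on_add)

text \<open>In a second chart \<open>d\<close> the components are the Jacobian of the transition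
  from \<open>c\<close> to \<open>d\<close> applied to \<open>w\<close>, hence a smooth function of
  the coordinates of \<open>c\<close>.\<close>

lemma smooth_coord_field:
  assumes c: "c \<in> A"
  shows "smooth_field_on A (fst c) (coord_field A c w)"
  unfolding smooth_field_on_def
proof
  fix d assume d: "d \<in> A"
  let ?h = "\<lambda>x. frechet_derivative (snd d \<circ> chart_inv c) (at x) w"
  have o: "open (fst d \<inter> fst c)" using c d open_chart_domain_Int open_chart_domain by blast
  have "smooth_on (snd c ` (fst d \<inter> fst c)) ?h"
    using smooth_on_frechet[OF transition_smooth[OF c d]] by (simp add: Int_commute)
  then have "smooth_fun_on A (fst d \<inter> fst c) (?h \<circ> snd c)"
    by (intro smooth_fun_on_chartI c o) auto
  moreover have "(?h \<circ> snd c) q = tderiv A (snd d) q (coord_field A c w q)" if "q \<in> fst d \<inter> fst c" for q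
    using tderiv_coord_field[OF c, of q "snd d" w] transition_has_derivative[OF c d, of q] that
    by (simp add: differentiableI)
  ultimately show "smooth_fun_on A (fst d \<inter> fst c) (\<lambda>q. tderiv A (snd d) q (coord_field A c w q))"
    by (rule smooth_fun_on_cong[OF o])
qed

text \<open>Read in a chart, the derivative is the sum of the components of \<open>X\<close> times
  the partial derivatives of \<open>f\<close>. Written this way, smoothness follows from closure
  under sums and products.\<close>

lemma smooth_tderiv:
  assumes "open U" "smooth_fun_on A U f" "smooth_field_on A U X"
  shows "smooth_fun_on A U (\<lambda>q. tderiv A f q (X q))"
  unfolding smooth_fun_on_def
proof
  fix d assume d: "d \<in> A"
  let ?S = "snd d ` (fst d \<inter> U)"
  have S: "open ?S" by (rule open_chart_image[OF d assms(1)])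
  have f: "smooth_on ?S (f \<circ> chart_inv d)"
    using assms(2) d by (simp add: smooth_fun_on_def)
  have "smooth_on (snd d ` (fst d \<inter> (fst d \<inter> U))) ((\<lambda>q. tderiv A (snd d) q (X q)) \<circ> chart_inv d)"
    using smooth_field_onD[OF assms(3) d, unfolded smooth_fun_on_def] d by (rule bspec)
  then have X: "smooth_on ?S ((\<lambda>q. tderiv A (snd d) q (X q)) \<circ> chart_inv d)"
    by (simp only: Int_left_absorb)
  have "smooth_on ?S (\<lambda>x. ((\<lambda>q. tderiv A (snd d) q (X q)) \<circ> chart_inv d) x $ i *\<^sub>R
      frechet_derivative (f \<circ> chart_inv d) (at x) (axis i 1))" for i
    by (rule smooth_on_scaleR[OF S smooth_on_linear[OF S bounded_linear_vec_nth X] smooth_on_frechet[OF f]])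
  then have "smooth_on ?S (\<lambda>x. \<Sum>i\<in>UNIV. ((\<lambda>q. tderiv A (snd d) q (X q)) \<circ> chart_inv d) x $ i *\<^sub>R
      frechet_derivative (f \<circ> chart_inv d) (at x) (axis i 1))"
    by (intro smooth_on_sum S)
  moreover have "(\<Sum>i\<in>UNIV. ((\<lambda>q. tderiv A (snd d) q (X q)) \<circ> chart_inv d) x $ i *\<^sub>R
      frechet_derivative (f \<circ> chart_inv d) (at x) (axis i 1))
          = ((\<lambda>q. tderiv A f q (X q)) \<circ> chart_inv d) x"
    if x: "x \<in> ?S" for x
  proof -
    obtain q where q: "q \<in> fst d" "q \<in> U" "x = snd d q" using x by blast
    have fd: "(f \<circ> chart_inv d) differentiable (at x)"
      using smooth_on_differentiable[OF f x] .
    let ?v = "tderiv A (snd d) q (X q)"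
    have "tderiv A f q (X q)
        = frechet_derivative (f \<circ> chart_inv d) (at x) (\<Sum>i\<in>UNIV. ?v $ i *\<^sub>R axis i 1)"
      unfolding vec_expansion q(3) by (rule tderiv_eq_chart[OF d q(1) fd[unfolded q(3)]])
    also have "\<dots> = (\<Sum>i\<in>UNIV. ?v $ i *\<^sub>R frechet_derivative (f \<circ> chart_inv d) (at x) (axis i 1))"
      by (simp add: linear_sum[OF linear_frechet_derivative[OF fd]] linear_scale[OF linear_frechet_derivative[OF fd]])
    finally show ?thesis unfolding q(3) o_def chart_inv_chart[OF d q(1)] by (rule sym)
  qed
  ultimately show "smooth_on ?S ((\<lambda>q. tderiv A f q (X q)) \<circ> chart_inv d)"
    by (rule smooth_on_cong[OF S, rotated])
qed

subsection \<open>Tangent vectors as derivations\<close>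

lemma tderiv_has_derivative:
  assumes "smooth_fun_on A U f" "p \<in> U"
  shows "(f \<circ> chart_inv (chart_at A p) has_derivative tderiv A f p) (at (snd (chart_at A p) p))"
  using smooth_fun_onD[OF assms(1) chart_at_mem assms(2)] unfolding tderiv_def[abs_def]
  by (simp add: frechet_derivative_works)

lemma tderivI:
  "(f \<circ> chart_inv (chart_at A p) has_derivative f') (at (snd (chart_at A p) p)) \<Longrightarrow> tderiv A f p v = f' v"
  unfolding tderiv_def by (rule fun_cong[OF frechet_derivative_at[symmetric]])

lemma tderiv_const [simp]: "tderiv A (\<lambda>q. a) p v = 0"
  by (simp add: tderiv_def o_def)

lemma tderiv_add:
  "smooth_fun_on A U f \<Longrightarrow> smooth_fun_on A U h \<Longrightarrow> p \<in> U \<Longrightarrow>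
    tderiv A (\<lambda>q. f q + h q) p v = tderiv A f p v + tderiv A h p v"
  using has_derivative_add[OF tderiv_has_derivative[of U f p] tderiv_has_derivative[of U h p]]
  by (intro tderivI) (simp add: o_def)

lemma tderiv_mult:
  fixes f h :: "'a \<Rightarrow> real"
  shows "smooth_fun_on A U f \<Longrightarrow> smooth_fun_on A U h \<Longrightarrow> p \<in> U \<Longrightarrow>
    tderiv A (\<lambda>q. f q * h q) p v = tderiv A f p v * h p + f p * tderiv A h p v"
  using has_derivative_mult[OF tderiv_has_derivative[of U f p] tderiv_has_derivative[of U h p]]
  by (intro tderivI) (simp add: o_def chart_inv_chart chart_at_mem algebra_simps)

lemma tderiv_nth:
  assumes "smooth_fun_on A U f" "p \<in> U"
  shows "tderiv A (\<lambda>q. f q $ i) p v = tderiv A f p v $ i"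
  using bounded_linear.has_derivative[OF bounded_linear_vec_nth tderiv_has_derivative[OF assms]]
  by (intro tderivI) (simp add: o_def)

text \<open>Coordinate fields of one chart commute as derivations: in that chart both sides are
  mixed second directional derivatives of the same function.\<close>

lemma tderiv_coord_field_symmetric:
  fixes f :: "'a \<Rightarrow> real"
  assumes "open U" "p \<in> U" "smooth_fun_on A U f" and c: "c \<in> A" "p \<in> fst c"
  shows "tderiv A (\<lambda>q. tderiv A f q (coord_field A c v q)) p (coord_field A c w p) =
         tderiv A (\<lambda>q. tderiv A f q (coord_field A c w q)) p (coord_field A c v p)"
proof -
  let ?S = "snd c ` (fst c \<inter> U)" and ?F = "f \<circ> chart_inv c"
  have S: "open ?S" by (rule open_chart_image[OF c(1) assms(1)])
  have pS: "snd c p \<in> ?S" using assms by blast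
  have F: "smooth_on ?S ?F"
    using assms(3) c unfolding smooth_fun_on_def by blast
  have "tderiv A (\<lambda>q. tderiv A f q (coord_field A c v q)) p (coord_field A c w p) =
    frechet_derivative (\<lambda>x. frechet_derivative ?F (at x) v) (at (snd c p)) w" for v w
  proof -
    have 1: "tderiv A f q (coord_field A c v q)
        = frechet_derivative ?F (at (snd c q)) v" if "q \<in> fst c \<inter> U" for q
      using that tderiv_coord_field[OF c(1)] smooth_fun_onD[OF assms(3) c(1)] by blast
    let ?h = "\<lambda>q. tderiv A f q (coord_field A c v q)"
    have 2: "(?h \<circ> chart_inv c) x = frechet_derivative ?F (at x) v" if "x \<in> ?S" for x
      using that 1 c by (auto simp: chart_inv_chart)
    have "smooth_on ?S (?h \<circ> chart_inv c)"
      by (rule smooth_on_cong[OF S _ smooth_on_frechet[OF F, of v]]) (simp only: 2)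
    then have "(?h \<circ> chart_inv c) differentiable (at (snd c p))"
      using pS smooth_on_differentiable by blast
    from tderiv_coord_field[OF c this]
    have "tderiv A ?h p (coord_field A c w p)
        = frechet_derivative (?h \<circ> chart_inv c) (at (snd c p)) w" .
    also have "frechet_derivative (?h \<circ> chart_inv c) (at (snd c p)) =
        frechet_derivative (\<lambda>x. frechet_derivative ?F (at x) v) (at (snd c p))"
      by (rule frechet_derivative_cong_open[OF S pS 2])
    finally show ?thesis .
  qed
  then show ?thesis using frechet_derivative_symmetric[OF S pS F] by metis
qed

end

section \<open>Torsion and curvature in a chart\<close>

locale connection
    = atlas A for A :: "('a::{t2_space,second_countable_topology}, 'm::finite) chart set" +
  fixes D :: "('a, 'm) connection"
  assumes connection: "linear_connection A D"
begin

lemmas connection_rules = connection[unfolded linear_connection_def, rule_format]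

lemma D_linear: "open U \<Longrightarrow> smooth_field_on A U Y \<Longrightarrow> p \<in> U \<Longrightarrow> linear (D Y p)"
  by (rule connection_rules[THEN conjunct1, rule_format])

lemma D_cong:
  assumes "open U" "smooth_field_on A U Y" "\<And>q. q \<in> U \<Longrightarrow> Y q = Y' q" "p \<in> U"
  shows "D Y p v = D Y' p v"
  by (rule connection_rules[OF assms(1), THEN conjunct2, THEN conjunct1, rule_format, OF _ assms(4)])
    (use assms smooth_field_on_cong[OF assms(1-3)] in blast)

lemma D_add:
  assumes "open U" "smooth_field_on A U Y" "smooth_field_on A U Y'" "p \<in> U"
  shows "D (\<lambda>q. Y q + Y' q) p v = D Y p v + D Y' p v"
  by (rule connection_rules[OF assms(1), THEN conjunct2, THEN conjunct2, THEN conjunct1, rule_format,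
    OF conjI[OF assms(2,3)] assms(4)])

lemma D_scaleR:
  assumes "open U" "smooth_fun_on A U f" "smooth_field_on A U Y" "p \<in> U"
  shows "D (\<lambda>q. f q *\<^sub>R Y q) p v = tderiv A f p v *\<^sub>R Y p + f p *\<^sub>R D Y p v"
  by (rule connection_rules[OF assms(1), THEN conjunct2, THEN conjunct2, THEN conjunct2, THEN conjunct1,
    rule_format, OF conjI[OF assms(2,3)] assms(4)])

lemma D_smooth:
  assumes "open U" "smooth_field_on A U X" "smooth_field_on A U Y"
  shows "smooth_field_on A U (\<lambda>q. D Y q (X q))"
  by (rule connection_rules[OF assms(1), THEN conjunct2, THEN conjunct2, THEN conjunct2, THEN conjunct2,
    rule_format, OF conjI[OF assms(2,3)]])

lemma D_zero: "D (\<lambda>q. 0) p v = 0"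
  using D_add[of UNIV "\<lambda>q. 0" "\<lambda>q. 0" p v] smooth_field_on_zero by simp

lemma D_sum:
  "open U \<Longrightarrow> (\<And>i. i \<in> J \<Longrightarrow> smooth_field_on A U (Y i)) \<Longrightarrow> p \<in> U \<Longrightarrow>
    D (\<lambda>q. \<Sum>i\<in>J. Y i q) p v = (\<Sum>i\<in>J. D (Y i) p v)"
proof (induction J rule: infinite_finite_induct)
  case (insert i J)
  then show ?case
    using D_add[of U "Y i" "\<lambda>q. \<Sum>i\<in>J. Y i q" p v] smooth_field_on_sum[of U J Y] by simp
qed (simp_all add: D_zero)

lemma D_sum_scaleR:
  assumes "open U" "\<And>i. i \<in> J \<Longrightarrow> smooth_fun_on A U (f i)" "\<And>i. i \<in> J \<Longrightarrow> smooth_field_on A U (Y i)" "p \<in> U"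
  shows "D (\<lambda>q. \<Sum>i\<in>J. f i q *\<^sub>R Y i q) p v
      = (\<Sum>i\<in>J. tderiv A (f i) p v *\<^sub>R Y i p + f i p *\<^sub>R D (Y i) p v)"
  using assms by (simp add: D_sum smooth_field_on_scaleR D_scaleR)

section \<open>Extensions of tangent vectors; tensoriality of torsion and curvature\<close>

lemma extend_vec_self [simp]: "extend_vec A p v p = v"
  using components_coord_field[OF chart_at_mem(1,2), of p v] by (simp add: extend_vec_def)

lemma smooth_extend_vec: "U \<subseteq> fst (chart_at A p) \<Longrightarrow> smooth_field_on A U (extend_vec A p v)"
  unfolding extend_vec_def by (rule smooth_field_on_subset[OF smooth_coord_field[OF chart_at_mem(1)]])

text \<open>Near \<open>p\<close> both extensions have constant components in the preferred chart at
  \<open>p\<close>. The bracket terms in the definitions of torsion and curvature therefore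
  vanish.\<close>

lemma lie_bracket_extend_vec [simp]: "lie_bracket A (extend_vec A p u) (extend_vec A p v) p = 0"
proof -
  let ?c = "chart_at A p"
  have "tderiv A (\<lambda>q. tderiv A (snd ?c) q (extend_vec A p v q)) p u = tderiv A (\<lambda>q. v) p u" for u v
    by (rule tderiv_cong[OF open_chart_domain[OF chart_at_mem(1)] chart_at_mem(2)])
      (simp add: extend_vec_def chart_at_mem)
  then show ?thesis by (simp add: lie_bracket_def Let_def)
qed

text \<open>The extension belongs to the preferred chart at \<open>p\<close>, which changes with
  \<open>p\<close>. Its components in an arbitrary chart \<open>c\<close> allow torsion and
  curvature at all points of the domain of \<open>c\<close> to be expressed by the coordinate fields
  of \<open>c\<close>.\<close>

definition ext_comp :: "('a, 'm) chart \<Rightarrow> 'a \<Rightarrow> real^'m \<Rightarrow> 'm \<Rightarrow> 'a \<Rightarrow> real" where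
  "ext_comp c p v i q = tderiv A (snd c) q (extend_vec A p v q) $ i"

lemma ext_comp_self [simp]: "ext_comp c p v i p = tderiv A (snd c) p v $ i"
  by (simp add: ext_comp_def)

lemma smooth_ext_comp:
  assumes "c \<in> A"
  shows "smooth_fun_on A (fst c \<inter> fst (chart_at A p)) (ext_comp c p v i)"
  unfolding ext_comp_def[abs_def]
  by (intro smooth_fun_on_nth open_chart_domain_Int open_chart_domain chart_at_mem assms
      smooth_field_onD smooth_extend_vec order_refl)

lemma extend_vec_eq_sum:
  "c \<in> A \<Longrightarrow> q \<in> fst c \<Longrightarrow> extend_vec A p v q
      = (\<Sum>i\<in>UNIV. ext_comp c p v i q *\<^sub>R coord_field A c (axis i 1) q)"
  unfolding ext_comp_def by (rule vec_eq_sum)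

text \<open>The extensions have constant components in the preferred chart, so this is the symmetry of the
  second derivatives of the transition map to \<open>c\<close>. It is the reason why torsion and curvature,
  which are defined by means of these extensions, are tensors.\<close>

lemma tderiv_ext_comp_symmetric:
  assumes c: "c \<in> A" "p \<in> fst c"
  shows "tderiv A (ext_comp c p u i) p v = tderiv A (ext_comp c p v i) p u"
proof -
  let ?f = "\<lambda>q. snd c q $ i"
  have f: "smooth_fun_on A (fst c) ?f"
    by (rule smooth_fun_on_nth[OF open_chart_domain[OF c(1)] smooth_fun_on_chart[OF c(1)]])
  have eq: "tderiv A (ext_comp c p u i) p v
      = tderiv A (\<lambda>q. tderiv A ?f q (extend_vec A p u q)) p v" for u v
    by (rule tderiv_cong[OF open_chart_domain[OF c(1)] c(2)])
      (simp add: ext_comp_def tderiv_nth[OF smooth_fun_on_chart[OF c(1)]])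
  show ?thesis
    using tderiv_coord_field_symmetric[OF open_chart_domain[OF c(1)] c(2) f chart_at_mem, of u v]
    unfolding eq by (simp add: extend_vec_def[symmetric])
qed

lemma D_extend_vec:
  assumes c: "c \<in> A" and q: "q \<in> fst c" "q \<in> fst (chart_at A p)"
  shows "D (extend_vec A p w) q v
      = (\<Sum>k\<in>UNIV. tderiv A (ext_comp c p w k) q v *\<^sub>R coord_field A c (axis k 1) q
      + ext_comp c p w k q *\<^sub>R D (coord_field A c (axis k 1)) q v)"
proof -
  let ?W = "fst c \<inter> fst (chart_at A p)"
  have W: "open ?W" "q \<in> ?W"
    using q open_chart_domain_Int[OF c open_chart_domain[OF chart_at_mem(1)]] by auto
  have "D (extend_vec A p w) q v
      = D (\<lambda>q. \<Sum>i\<in>UNIV. ext_comp c p w i q *\<^sub>R coord_field A c (axis i 1) q) q v"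
    by (rule D_cong[OF W(1) smooth_extend_vec extend_vec_eq_sum[OF c] W(2)]) auto
  also have "\<dots> = (\<Sum>k\<in>UNIV. tderiv A (ext_comp c p w k) q v *\<^sub>R coord_field A c (axis k 1) q
      + ext_comp c p w k q *\<^sub>R D (coord_field A c (axis k 1)) q v)"
    by (rule D_sum_scaleR[OF W(1) smooth_ext_comp[OF c] _ W(2)])
      (rule smooth_field_on_subset[OF smooth_coord_field[OF c]], simp)
  finally show ?thesis .
qed

text \<open>The derivatives of the components of the two extensions cancel by symmetry, and only
  Christoffel terms of the fixed chart remain. In this form the torsion can be differentiated along
  a curve inside the chart.\<close>

lemma torsion_eq_chart:
  assumes c: "c \<in> A" "p \<in> fst c"
  shows "torsion A D p u v = (\<Sum>j\<in>UNIV. tderiv A (snd c) p v $ j *\<^sub>R D (coord_field A c (axis j 1)) p u)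
    - (\<Sum>j\<in>UNIV. tderiv A (snd c) p u $ j *\<^sub>R D (coord_field A c (axis j 1)) p v)"
  unfolding torsion_def Let_def extend_vec_self D_extend_vec[OF c chart_at_mem(2)]
    lie_bracket_extend_vec ext_comp_self tderiv_ext_comp_symmetric[OF c, of u _ v] sum.distrib
  by simp

text \<open>This is \<nabla> in direction \<open>u\<close> of the fields \<nabla>_{\<partial>j}
  \<partial>k, weighted with the components of \<open>v\<close> and \<open>w\<close>. It is one half
  of the classical coordinate formula for R(u,v)w; since coordinate fields commute, antisymmetrising
  in \<open>u\<close> and \<open>v\<close> gives the whole.\<close>

definition chart_curvature :: "('a, 'm) chart \<Rightarrow> 'a \<Rightarrow> real^'m \<Rightarrow> real^'m \<Rightarrow> real^'m \<Rightarrow> real^'m" where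
  "chart_curvature c p u v w = (\<Sum>k\<in>UNIV. \<Sum>j\<in>UNIV.
     (tderiv A (snd c) p w $ k * tderiv A (snd c) p v $ j) *\<^sub>R
       D (\<lambda>q. D (coord_field A c (axis k 1)) q (coord_field A c (axis j 1) q)) p u)"

lemma smooth_christoffel:
  "c \<in> A \<Longrightarrow> smooth_field_on A (fst c) (\<lambda>q. D (coord_field A c v) q (coord_field A c w q))"
  by (intro D_smooth open_chart_domain smooth_coord_field)

lemma D_eq_sum:
  assumes c: "c \<in> A" "p \<in> fst c" and "open U" "smooth_field_on A U Y" "p \<in> U"
  shows "D Y p u = (\<Sum>j\<in>UNIV. tderiv A (snd c) p u $ j *\<^sub>R D Y p (coord_field A c (axis j 1) p))"
proof -
  note l = D_linear[OF assms(3-5)]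
  have "D Y p u = D Y p (\<Sum>j\<in>UNIV. tderiv A (snd c) p u $ j *\<^sub>R coord_field A c (axis j 1) p)"
    using vec_eq_sum[OF c, of u] by simp
  then show ?thesis by (simp add: linear_sum[OF l] linear_scale[OF l])
qed

text \<open>On the right-hand side everything except \<open>chart_curvature c p u v w\<close> is symmetric in \<open>u\<close> and \<open>v\<close>,
  and therefore cancels in the curvature.\<close>

lemma second_derivative_extend_vec:
  fixes c p u v w
  defines "z \<equiv> ext_comp c p w" and "y \<equiv> ext_comp c p v" and
      "N \<equiv> \<lambda>k j q. D (coord_field A c (axis k 1)) q (coord_field A c (axis j 1) q)"
  assumes c: "c \<in> A" "p \<in> fst c"
  shows "D (\<lambda>q. D (extend_vec A p w) q (extend_vec A p v q)) p u =
    (\<Sum>k\<in>UNIV. tderiv A (\<lambda>q. tderiv A (z k) q (extend_vec A p v q)) p u *\<^sub>R coord_field A c (axis k 1) p)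
    + (\<Sum>k\<in>UNIV. \<Sum>j\<in>UNIV. (tderiv A (z k) p v * tderiv A (snd c) p u $ j
        + tderiv A (z k) p u * tderiv A (snd c) p v $ j
          + tderiv A (snd c) p w $ k * tderiv A (y j) p u) *\<^sub>R N k j p)
    + chart_curvature c p u v w"
proof -
  let ?W = "fst c \<inter> fst (chart_at A p)"
  let ?e = "\<lambda>k. coord_field A c (axis k 1)"
  let ?V = "extend_vec A p v"
  have W: "open ?W" "p \<in> ?W"
    using c chart_at_mem(2) open_chart_domain_Int[OF c(1) open_chart_domain[OF chart_at_mem(1)]] by auto
  have e: "smooth_field_on A ?W (?e k)" for k
    by (rule smooth_field_on_subset[OF smooth_coord_field[OF c(1)]]) simp
  have N: "smooth_field_on A ?W (N k j)" for k j
    unfolding N_def by (intro D_smooth W e)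
  have V: "smooth_field_on A ?W ?V" "smooth_field_on A ?W (extend_vec A p w)"
    by (auto intro: smooth_extend_vec)
  have z: "smooth_fun_on A ?W (z k)" and y: "smooth_fun_on A ?W (y j)" for k j
    unfolding z_def y_def by (rule smooth_ext_comp[OF c(1)])+
  have a: "smooth_fun_on A ?W (\<lambda>q. tderiv A (z k) q (?V q))" for k
    by (rule smooth_tderiv[OF W(1) z V(1)])
  have b: "smooth_fun_on A ?W (\<lambda>q. z k q * y j q)" for k j
    by (rule smooth_fun_on_mult[OF W(1) z y])
  \<comment> \<open>The inner derivative is split over the frame of \<open>c\<close>:
    \<open>?F1\<close> collects the derivatives of the components of the extension of
    \<open>w\<close>, and \<open>?F2 k\<close> the Christoffel fields weighted with components. The
    outer derivative is then a product rule on each piece.\<close>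
  let ?F1 = "\<lambda>q. \<Sum>k\<in>UNIV. tderiv A (z k) q (?V q) *\<^sub>R ?e k q"
  let ?F2 = "\<lambda>k q. \<Sum>j\<in>UNIV. (z k q * y j q) *\<^sub>R N k j q"
  have F1: "smooth_field_on A ?W ?F1"
    by (intro smooth_field_on_sum smooth_field_on_scaleR W a e)
  have F2: "smooth_field_on A ?W (?F2 k)" for k
    by (intro smooth_field_on_sum smooth_field_on_scaleR W b N)
  have 1: "D (extend_vec A p w) q (?V q) = ?F1 q + (\<Sum>k\<in>UNIV. ?F2 k q)" if q: "q \<in> ?W" for q
  proof -
    have "D (?e k) q (?V q) = (\<Sum>j\<in>UNIV. y j q *\<^sub>R N k j q)" for k
      unfolding N_def y_def ext_comp_def
      by (rule D_eq_sum[OF c(1) _ W(1) e q]) (use q in simp)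
    then show ?thesis
      using D_extend_vec[OF c(1), of q p w "?V q"] q
      by (simp add: sum.distrib scaleR_sum_right z_def)
  qed
  have DF2: "D (?F2 k) p u = (\<Sum>j\<in>UNIV. (tderiv A (z k) p u * tderiv A (snd c) p v $ j
      + tderiv A (snd c) p w $ k * tderiv A (y j) p u) *\<^sub>R N k j p
      + (tderiv A (snd c) p w $ k * tderiv A (snd c) p v $ j) *\<^sub>R D (N k j) p u)" for k
    unfolding D_sum_scaleR[OF W(1) b N W(2)] tderiv_mult[OF z y W(2)]
    by (simp add: z_def y_def)
  have "D (\<lambda>q. D (extend_vec A p w) q (?V q)) p u = D (\<lambda>q. ?F1 q + (\<Sum>k\<in>UNIV. ?F2 k q)) p u"
    by (rule D_cong[OF W(1) D_smooth[OF W(1) V] 1 W(2)])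
  also have "\<dots> = D ?F1 p u + (\<Sum>k\<in>UNIV. D (?F2 k) p u)"
    by (subst D_add[OF W(1) F1 _ W(2)], rule smooth_field_on_sum[OF W(1)], rule F2,
      subst D_sum[OF W(1) _ W(2)], rule F2, rule refl)
  also have "D ?F1 p u = (\<Sum>k\<in>UNIV. tderiv A (\<lambda>q. tderiv A (z k) q (?V q)) p u *\<^sub>R ?e k p
     + tderiv A (z k) p v *\<^sub>R D (?e k) p u)"
    using D_sum_scaleR[OF W(1) a e W(2), where J = UNIV and v = u] by simp
  also have "\<dots> = (\<Sum>k\<in>UNIV. tderiv A (\<lambda>q. tderiv A (z k) q (?V q)) p u *\<^sub>R ?e k p)
     + (\<Sum>k\<in>UNIV. \<Sum>j\<in>UNIV. (tderiv A (z k) p v * tderiv A (snd c) p u $ j) *\<^sub>R N k j p)"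
  proof -
    have "D (?e k) p u = (\<Sum>j\<in>UNIV. tderiv A (snd c) p u $ j *\<^sub>R N k j p)" for k
      unfolding N_def by (rule D_eq_sum[OF c W(1) e W(2)])
    then show ?thesis by (simp add: sum.distrib scaleR_sum_right)
  qed
  finally show ?thesis
    unfolding chart_curvature_def N_def[symmetric] DF2
    by (simp add: sum.distrib scaleR_add_left add_ac N_def)
qed

lemma curvature_eq_chart:
  assumes c: "c \<in> A" "p \<in> fst c"
  shows "curvature A D p u v w = chart_curvature c p u v w - chart_curvature c p v u w"
proof -
  \<comment> \<open>Both extensions are coordinate fields of the preferred chart at
    \<open>p\<close>, so second derivatives along them commute.\<close>
  have s: "tderiv A (\<lambda>q. tderiv A (ext_comp c p w k) q (extend_vec A p v q)) p u =
        tderiv A (\<lambda>q. tderiv A (ext_comp c p w k) q (extend_vec A p u q)) p v" for k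
    using tderiv_coord_field_symmetric[OF open_chart_domain_Int[OF c(1) open_chart_domain[OF chart_at_mem(1)]] _
        smooth_ext_comp[OF c(1)] chart_at_mem, where v = v and w = u] c chart_at_mem(2)
    by (simp add: extend_vec_def[symmetric])
  have D0: "D (extend_vec A p w) p 0 = 0"
    using linear_0[OF D_linear[OF open_chart_domain[OF chart_at_mem(1)] smooth_extend_vec[OF order_refl] chart_at_mem(2)]] .
  show ?thesis
    unfolding curvature_def Let_def lie_bracket_extend_vec extend_vec_self second_derivative_extend_vec[OF c] s[of _]
      tderiv_ext_comp_symmetric[OF c, of v _ u] D0
    by (simp add: algebra_simps)
qed

lemma D_chart_linear: "c \<in> A \<Longrightarrow> p \<in> fst c \<Longrightarrow>
    linear (D (\<lambda>q. D (coord_field A c v) q (coord_field A c w q)) p)"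
  by (rule D_linear[OF open_chart_domain smooth_christoffel])

lemma curvature_antisym: "curvature A D p v u w = - curvature A D p u v w"
  by (simp add: curvature_eq_chart[OF chart_at_mem])

lemma chart_curvature_linear:
  assumes c: "c \<in> A" "p \<in> fst c"
  shows "linear (\<lambda>u. chart_curvature c p u v w)" "linear (\<lambda>v. chart_curvature c p u v w)"
    "linear (\<lambda>w. chart_curvature c p u v w)"
  unfolding chart_curvature_def using linear_tderiv_chart[OF c] D_chart_linear[OF c]
  by (auto intro!: linearI simp: linear_add linear_scale sum.distrib[symmetric] scaleR_sum_right algebra_simps)

lemma curvature_linear:
  "linear (\<lambda>u. curvature A D p u v w)" "linear (\<lambda>v. curvature A D p u v w)"
  "linear (\<lambda>w. curvature A D p u v w)"
  unfolding curvature_eq_chart[OF chart_at_mem]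
  by (intro linear_compose_sub chart_curvature_linear chart_at_mem)+

end

section \<open>Connections compatible with a Riemannian metric\<close>

locale metric_connection = connection A D
  for A :: "('a::{t2_space,second_countable_topology}, 'm::finite) chart set" and D +
  fixes g :: "'a \<Rightarrow> real^'m \<Rightarrow> real^'m \<Rightarrow> real"
  assumes metric: "riemannian_metric A g"
    and metric_compatible: "\<And>U Y Z p v. open U \<Longrightarrow> smooth_field_on A U Y \<Longrightarrow> smooth_field_on A U Z \<Longrightarrow> p \<in> U \<Longrightarrow>
      tderiv A (\<lambda>q. g q (Y q) (Z q)) p v = g p (D Y p v) (Z p) + g p (Y p) (D Z p v)"
begin

lemma g_bilinear: "bilinear (g p)" and g_sym: "g p u v = g p v u" and g_pos: "u \<noteq> 0 \<Longrightarrow> g p u u > 0"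
  using metric unfolding riemannian_metric_def by blast+

lemma g_smooth:
  "open U \<Longrightarrow> smooth_field_on A U X \<Longrightarrow> smooth_field_on A U Y \<Longrightarrow> smooth_fun_on A U (\<lambda>q. g q (X q) (Y q))"
  using metric unfolding riemannian_metric_def by blast

lemmas g_linear = bilinear_ladd[OF g_bilinear] bilinear_radd[OF g_bilinear]
  bilinear_lsub[OF g_bilinear] bilinear_rsub[OF g_bilinear]
  bilinear_lmul[OF g_bilinear] bilinear_rmul[OF g_bilinear]
  bilinear_lzero[OF g_bilinear] bilinear_rzero[OF g_bilinear]
  bilinear_lneg[OF g_bilinear] bilinear_rneg[OF g_bilinear]

lemma g_nonneg: "g p u u \<ge> 0"
  using g_pos[of u p] by (cases "u = 0") (auto simp: g_linear less_imp_le)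

lemma g_eq_0_iff: "g p u u = 0 \<longleftrightarrow> u = 0"
  using g_pos[of u p] by (cases "u = 0") (auto simp: g_linear)

text \<open>Differentiate g(Z,Z) along the commuting extensions of \<open>v\<close> and
  \<open>u\<close>. The second derivatives agree in both orders and the term g(\<nabla>_v Z,
  \<nabla>_u Z) is symmetric, so the difference leaves twice g(R(u,v)w, w).\<close>

lemma curvature_skew: "g p (curvature A D p u v w) w = 0"
proof -
  let ?c = "chart_at A p"
  let ?U = "fst ?c"
  let ?Z = "extend_vec A p w"
  let ?h = "\<lambda>q. g q (?Z q) (?Z q)"
  have U: "open ?U" "p \<in> ?U" using chart_at_mem open_chart_domain by auto
  have s: "smooth_field_on A ?U (extend_vec A p v)" for v
    by (rule smooth_extend_vec[OF order_refl])
  have DZ: "smooth_field_on A ?U (\<lambda>q. D ?Z q (extend_vec A p v q))" for v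
    by (rule D_smooth[OF U(1) s s])
  have h: "smooth_fun_on A ?U ?h" by (rule g_smooth[OF U(1) s s])
  have 2: "tderiv A (\<lambda>q. tderiv A ?h q (extend_vec A p v q)) p u =
      2 * (g p (D (\<lambda>q. D ?Z q (extend_vec A p v q)) p u) w + g p (D ?Z p v) (D ?Z p u))" for u v
  proof -
    let ?k = "\<lambda>q. g q (D ?Z q (extend_vec A p v q)) (?Z q)"
    have k: "smooth_fun_on A ?U ?k" by (rule g_smooth[OF U(1) DZ s])
    have "tderiv A (\<lambda>q. tderiv A ?h q (extend_vec A p v q)) p u = tderiv A (\<lambda>q. ?k q + ?k q) p u"
      by (rule tderiv_cong[OF U]) (simp add: metric_compatible[OF U(1) s s] g_sym)
    also have "\<dots> = 2 * tderiv A ?k p u"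
      unfolding tderiv_add[OF k k U(2)] by (rule mult_2[symmetric])
    also have "tderiv A ?k p u = g p (D (\<lambda>q. D ?Z q (extend_vec A p v q)) p u) w
        + g p (D ?Z p v) (D ?Z p u)"
      using metric_compatible[OF U(1) DZ s U(2)] by simp
    finally show ?thesis .
  qed
  have "tderiv A (\<lambda>q. tderiv A ?h q (extend_vec A p v q)) p u
      = tderiv A (\<lambda>q. tderiv A ?h q (extend_vec A p u q)) p v"
    using tderiv_coord_field_symmetric[OF U h chart_at_mem, of v u]
      by (simp add: extend_vec_def[symmetric])
  then have "g p (D (\<lambda>q. D ?Z q (extend_vec A p v q)) p u) w
      = g p (D (\<lambda>q. D ?Z q (extend_vec A p u q)) p v) w"
    unfolding 2 by (simp add: g_sym)
  then show ?thesis
    using linear_0[OF D_linear[OF U(1) s U(2)]]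
    by (simp add: curvature_def Let_def g_linear)
qed

lemma curvature_skew2: "g p (curvature A D p u v w) x = - g p (curvature A D p u v x) w"
proof -
  have "g p (curvature A D p u v (w + x)) (w + x) = 0" by (rule curvature_skew)
  then show ?thesis
    by (simp add: linear_add[OF curvature_linear(3)] g_linear curvature_skew)
qed

end

section \<open>Fields along a curve\<close>

lemma (in metric_connection) g_sum_left: "g p (\<Sum>i\<in>J. f i) w = (\<Sum>i\<in>J. g p (f i) w)"
  using g_bilinear linear_sum unfolding bilinear_def by blast

lemma (in metric_connection) g_sum_right: "g p w (\<Sum>i\<in>J. f i) = (\<Sum>i\<in>J. g p w (f i))"
  using g_bilinear linear_sum unfolding bilinear_def by blast

lemma (in metric_connection) g_sum:
  "g p (\<Sum>i\<in>J. f i) (\<Sum>j\<in>K. h j) = (\<Sum>i\<in>J. \<Sum>j\<in>K. g p (f i) (h j))"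
  unfolding g_sum_left by (simp add: g_sum_right)

lemma differentiable_nth:
  fixes f :: "real \<Rightarrow> real^'n"
  shows "f differentiable F \<Longrightarrow> (\<lambda>s. f s $ i) differentiable F"
  unfolding differentiable_def using bounded_linear.has_derivative[OF bounded_linear_vec_nth] by blast

text \<open>Excluding one-point intervals ensures that no point of \<open>I\<close> is isolated, so
  that derivatives within \<open>I\<close> are unique; endpoints of \<open>I\<close> remain
  allowed.\<close>

locale curve = metric_connection A D g
  for A :: "('a::{t2_space,second_countable_topology}, 'm::finite) chart set" and D and g +
  fixes I :: "real set" and \<gamma> :: "real \<Rightarrow> 'a"
  assumes interval: "is_interval I" and nontrivial: "\<And>x. I \<noteq> {x}" and smooth: "smooth_curve A I \<gamma>"
begin

abbreviation vel :: "real \<Rightarrow> real^'m" where "vel \<equiv> velocity A I \<gamma>"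

abbreviation coords :: "('a, 'm) chart \<Rightarrow> (real \<Rightarrow> real^'m) \<Rightarrow> real \<Rightarrow> real^'m" where
  "coords c V s \<equiv> tderiv A (snd c) (\<gamma> s) (V s)"

abbreviation cov :: "(real \<Rightarrow> real^'m) \<Rightarrow> real \<Rightarrow> real^'m" where "cov \<equiv> cov_deriv_along A D I \<gamma>"

text \<open>A single derivative is what the product rule for the metric consumes. Asking for no more
  keeps the verification short for covariant derivatives and for the torsion term.\<close>

definition diff_along :: "(real \<Rightarrow> real^'m) \<Rightarrow> real \<Rightarrow> bool" where
  "diff_along V t \<longleftrightarrow> (\<forall>c\<in>A. \<gamma> t \<in> fst c \<longrightarrow> coords c V differentiable (at t within I))"

lemma not_bot: "t \<in> I \<Longrightarrow> at t within I \<noteq> bot"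
  using connected_imp_perfect[of I t] interval nontrivial
  by (auto simp: trivial_limit_within is_interval_connected)

text \<open>By continuity the parameters with \<gamma> in \<open>U\<close> form a relatively open
  set, which does not change the filter at \<open>t\<close>. This reconciles smoothness, defined by
  derivatives within chart preimages, with velocity and covariant derivative, defined within
  \<open>I\<close>.\<close>

lemma at_within_chart:
  assumes "open U" "t \<in> I" "\<gamma> t \<in> U"
  shows "at t within {s\<in>I. \<gamma> s \<in> U} = at t within I"
proof -
  have "openin (top_of_set I) (I \<inter> \<gamma> -` U)"
    using smooth assms by (intro continuous_openin_preimage_gen) (auto simp: smooth_curve_def)
  then obtain S where S: "open S" "I \<inter> \<gamma> -` U = I \<inter> S" by (auto simp: openin_open)
  show ?thesis
    by (rule at_within_nhd[of t S]) (use S assms in auto)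
qed

lemma has_vector_derivative_local:
  assumes "open U" "t \<in> I" "\<gamma> t \<in> U" "\<And>s. s \<in> I \<Longrightarrow> \<gamma> s \<in> U \<Longrightarrow> h s = f s"
    "(f has_vector_derivative d) (at t within I)"
  shows "(h has_vector_derivative d) (at t within I)"
  unfolding at_within_chart[OF assms(1-3), symmetric]
  by (rule has_vector_derivative_transform[where f = f])
    (use assms in \<open>auto simp: at_within_chart[OF assms(1-3)]\<close>)

lemma differentiable_local:
  fixes f :: "real \<Rightarrow> 'b::real_normed_vector"
  assumes "open U" "t \<in> I" "\<gamma> t \<in> U" "\<And>s. s \<in> I \<Longrightarrow> \<gamma> s \<in> U \<Longrightarrow> h s = f s"
    "f differentiable (at t within I)"
  shows "h differentiable (at t within I)"
  by (rule differentiableI_vector[OF has_vector_derivative_local[OF assms(1-4)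
    vector_derivative_works[THEN iffD1, OF assms(5)]]])

lemma Ck_curve_differentiable:
  fixes f :: "real \<Rightarrow> 'b::real_normed_vector"
  assumes "open U" "t \<in> I" "\<gamma> t \<in> U" "smooth_curve_on {s\<in>I. \<gamma> s \<in> U} f"
  shows "f differentiable (at t within I)"
      "(\<lambda>s. vector_derivative f (at s within I)) differentiable (at t within I)"
proof -
  let ?S = "{s\<in>I. \<gamma> s \<in> U}"
  have "Ck_curve_on (Suc (Suc 0)) ?S f" using assms(4) unfolding smooth_curve_on_def by blast
  then have *: "f differentiable_on ?S"
      "(\<lambda>t. vector_derivative f (at t within ?S)) differentiable_on ?S" by auto
  have t: "t \<in> ?S" using assms(2,3) by blast
  show "f differentiable (at t within I)"
    using differentiable_onD[OF *(1) t] unfolding at_within_chart[OF assms(1-3)] .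
  have "(\<lambda>t. vector_derivative f (at t within ?S)) differentiable (at t within I)"
    using differentiable_onD[OF *(2) t] unfolding at_within_chart[OF assms(1-3)] .
  then show "(\<lambda>s. vector_derivative f (at s within I)) differentiable (at t within I)"
    by (rule differentiable_local[OF assms(1-3), rotated]) (simp add: at_within_chart[OF assms(1)])
qed

lemma curve_differentiable:
  assumes "c \<in> A" "t \<in> I" "\<gamma> t \<in> fst c"
  shows "(snd c \<circ> \<gamma>) differentiable (at t within I)"
    "(\<lambda>s. vector_derivative (snd c \<circ> \<gamma>) (at s within I)) differentiable (at t within I)"
  using Ck_curve_differentiable[OF open_chart_domain[OF assms(1)] assms(2,3), of "snd c \<circ> \<gamma>"] smooth assms
  unfolding smooth_curve_def by auto

lemma has_vector_derivative_along:
  assumes "open U" "smooth_fun_on A U h" "t \<in> I" "\<gamma> t \<in> U"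
  shows "((\<lambda>s. h (\<gamma> s)) has_vector_derivative tderiv A h (\<gamma> t) (vel t)) (at t within I)"
proof -
  let ?c = "chart_at A (\<gamma> t)"
  have "((snd ?c \<circ> \<gamma>) has_vector_derivative vel t) (at t within I)"
    unfolding velocity_def using curve_differentiable(1)[OF chart_at_mem(1) assms(3) chart_at_mem(2)]
    by (simp add: vector_derivative_works)
  from vector_derivative_diff_chain_within[OF this has_derivative_at_withinI]
  have "((h \<circ> chart_inv ?c) \<circ> (snd ?c \<circ> \<gamma>)
      has_vector_derivative tderiv A h (\<gamma> t) (vel t)) (at t within I)"
    using tderiv_has_derivative[OF assms(2,4)] by simp
  then show ?thesis
    by (rule has_vector_derivative_local[OF open_chart_domain[OF chart_at_mem(1)] assms(3) chart_at_mem(2), rotated])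
      (simp add: chart_inv_chart chart_at_mem)
qed

text \<open>\<open>velocity\<close> uses a chart that depends on \<gamma> t. In a fixed chart its
  components are an ordinary derivative, and so can be differentiated again.\<close>

lemma coords_vel:
  assumes "c \<in> A" "t \<in> I" "\<gamma> t \<in> fst c"
  shows "coords c vel t = vector_derivative (snd c \<circ> \<gamma>) (at t within I)"
  using has_vector_derivative_along[OF open_chart_domain[OF assms(1)] smooth_fun_on_chart[OF assms(1)] assms(2,3)]
  by (intro vector_derivative_within[OF not_bot[OF assms(2)], symmetric]) (simp add: o_def)

lemma diff_along_vel: "t \<in> I \<Longrightarrow> diff_along vel t"
  unfolding diff_along_def
proof (intro ballI impI)
  fix c assume t: "t \<in> I" and c: "c \<in> A" "\<gamma> t \<in> fst c"
  show "coords c vel differentiable (at t within I)"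
    by (rule differentiable_local[OF open_chart_domain[OF c(1)] t c(2) coords_vel[OF c(1)] curve_differentiable(2)[OF c(1) t c(2)]])
qed

text \<open>The components in \<open>c\<close> are those in \<open>d\<close> times the Jacobian
  columns \<open>J i\<close> evaluated along the curve; this is their product rule.\<close>

lemma coords_change_chart:
  assumes c: "c \<in> A" "\<gamma> t \<in> fst c" and d: "d \<in> A" "\<gamma> t \<in> fst d" and t: "t \<in> I"
    and V: "(coords d V has_vector_derivative \<delta>) (at t within I)"
  defines "J \<equiv> \<lambda>i q. tderiv A (snd c) q (coord_field A d (axis i 1) q)"
  shows "(coords c V has_vector_derivative
    (\<Sum>i\<in>UNIV. coords d V t $ i *\<^sub>R tderiv A (J i) (\<gamma> t) (vel t) + \<delta> $ i *\<^sub>R J i (\<gamma> t))) (at t within I)"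
proof -
  let ?U = "fst c \<inter> fst d"
  have U: "open ?U" "\<gamma> t \<in> ?U" using c d open_chart_domain_Int open_chart_domain by auto
  have J: "smooth_fun_on A ?U (J i)" for i
    unfolding J_def by (rule smooth_field_onD[OF smooth_coord_field[OF d(1)] c(1)])
  have "((\<lambda>s. \<Sum>i\<in>UNIV. coords d V s $ i *\<^sub>R J i (\<gamma> s)) has_vector_derivative
    (\<Sum>i\<in>UNIV. coords d V t $ i *\<^sub>R tderiv A (J i) (\<gamma> t) (vel t) + \<delta> $ i *\<^sub>R J i (\<gamma> t))) (at t within I)"
    by (intro has_vector_derivative_sum has_vector_derivative_scaleR has_vector_derivative_along[OF U(1) J t U(2)])
      (simp add: has_real_derivative_iff_has_vector_derivative bounded_linear.has_vector_derivative[OF bounded_linear_vec_nth V])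
  then show ?thesis
  proof (rule has_vector_derivative_local[OF U(1) t U(2), rotated])
    fix s assume s: "\<gamma> s \<in> ?U"
    note l = linear_tderiv_chart[OF c(1), of "\<gamma> s"]
    have "coords c V s
        = tderiv A (snd c) (\<gamma> s) (\<Sum>i\<in>UNIV. coords d V s $ i *\<^sub>R coord_field A d (axis i 1) (\<gamma> s))"
      using vec_eq_sum[OF d(1), of "\<gamma> s" "V s"] s by simp
    then show "coords c V s = (\<Sum>i\<in>UNIV. coords d V s $ i *\<^sub>R J i (\<gamma> s))"
      using s by (simp add: linear_sum[OF l] linear_scale[OF l] J_def)
  qed
qed

lemma diff_alongI:
  assumes "c \<in> A" "\<gamma> t \<in> fst c" "t \<in> I" "coords c V differentiable (at t within I)"
  shows "diff_along V t"
  unfolding diff_along_def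
proof (intro ballI impI)
  fix d assume d: "d \<in> A" "\<gamma> t \<in> fst d"
  show "coords d V differentiable (at t within I)"
    using coords_change_chart[OF d assms(1-3), of V] assms(4) differentiableI_vector vector_derivative_works by blast
qed

lemma diff_alongD:
  "diff_along V t \<Longrightarrow> c \<in> A \<Longrightarrow> \<gamma> t \<in> fst c \<Longrightarrow>
    (coords c V has_vector_derivative vector_derivative (coords c V) (at t within I)) (at t within I)"
  unfolding diff_along_def vector_derivative_works by blast

section \<open>Covariant differentiation along the curve in an arbitrary chart\<close>

text \<open>At \<open>p\<close> the coordinate frame of the preferred chart is the standard basis.
  This gives \<nabla> the same shape as the definition of \<open>cov_deriv_along\<close>.\<close>

lemma D_eq_preferred_chart:
  assumes "open U" "smooth_field_on A U Y" "p \<in> U"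
  defines "c \<equiv> chart_at A p"
  shows "D Y p v = tderiv A (\<lambda>q. tderiv A (snd c) q (Y q)) p v
      + (\<Sum>k\<in>UNIV. Y p $ k *\<^sub>R D (coord_field A c (axis k 1)) p v)"
proof -
  have c: "c \<in> A" "p \<in> fst c" unfolding c_def by (rule chart_at_mem)+
  let ?U = "fst c \<inter> U"
  have U: "open ?U" "p \<in> ?U" using c assms open_chart_domain_Int by auto
  let ?F = "\<lambda>q. tderiv A (snd c) q (Y q)"
  have F: "smooth_fun_on A ?U ?F" by (rule smooth_field_onD[OF assms(2) c(1)])
  have "D Y p v = D (\<lambda>q. \<Sum>k\<in>UNIV. ?F q $ k *\<^sub>R coord_field A c (axis k 1) q) p v"
    by (rule D_cong[OF U(1) smooth_field_on_subset[OF assms(2)] vec_eq_sum[OF c(1)] U(2)]) auto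
  also have "\<dots>
      = (\<Sum>k\<in>UNIV. tderiv A (\<lambda>q. ?F q $ k) p v *\<^sub>R coord_field A c (axis k 1) p
      + ?F p $ k *\<^sub>R D (coord_field A c (axis k 1)) p v)"
    by (rule D_sum_scaleR[OF U(1) smooth_fun_on_nth[OF U(1) F] _ U(2)])
      (rule smooth_field_on_subset[OF smooth_coord_field[OF c(1)]], simp)
  also have "\<dots> = tderiv A ?F p v + (\<Sum>k\<in>UNIV. Y p $ k *\<^sub>R D (coord_field A c (axis k 1)) p v)"
  proof -
    have "coord_field A c w p = w" "tderiv A (snd c) p w = w" for w
      using coord_field_components[OF c, of w] unfolding c_def by simp_all
    then show ?thesis
      by (simp add: tderiv_nth[OF F U(2)] sum.distrib vec_expansion)
  qed
  finally show ?thesis .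
qed

text \<open>Chart independence of the covariant derivative along \<gamma>. Changing charts produces
  derivatives of the Jacobian columns; these are exactly the terms by which \<nabla> of a coordinate
  field of \<open>c\<close> differs from its Christoffel part in the preferred chart, so they are
  absorbed.\<close>

lemma cov_eq_chart:
  assumes c: "c \<in> A" "\<gamma> t \<in> fst c" and t: "t \<in> I"
    and V: "(coords c V has_vector_derivative \<delta>) (at t within I)"
  shows "cov V t = coord_field A c \<delta> (\<gamma> t) +
    (\<Sum>i\<in>UNIV. coords c V t $ i *\<^sub>R D (coord_field A c (axis i 1)) (\<gamma> t) (vel t))"
proof -
  let ?d = "chart_at A (\<gamma> t)"
  let ?e = "\<lambda>i. coord_field A c (axis i 1)"
  let ?J = "\<lambda>i q. tderiv A (snd ?d) q (?e i q)"
  let ?\<Gamma> = "\<lambda>k. D (coord_field A ?d (axis k 1)) (\<gamma> t) (vel t)"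
  have D: "D (?e i) (\<gamma> t) (vel t) = tderiv A (?J i) (\<gamma> t) (vel t)
      + (\<Sum>k\<in>UNIV. ?e i (\<gamma> t) $ k *\<^sub>R ?\<Gamma> k)" for i
    by (rule D_eq_preferred_chart[OF open_chart_domain[OF c(1)] smooth_coord_field[OF c(1)] c(2)])
  have Vk: "V t $ k = (\<Sum>i\<in>UNIV. coords c V t $ i * ?e i (\<gamma> t) $ k)" for k
  proof -
    have "V t $ k = (\<Sum>i\<in>UNIV. coords c V t $ i *\<^sub>R ?e i (\<gamma> t)) $ k"
      by (rule arg_cong[OF vec_eq_sum[OF c]])
    also have "\<dots> = (\<Sum>i\<in>UNIV. coords c V t $ i * ?e i (\<gamma> t) $ k)"
      by simp
    finally show ?thesis .
  qed
  have "(\<Sum>k\<in>UNIV. V t $ k *\<^sub>R ?\<Gamma> k) = (\<Sum>k\<in>UNIV. \<Sum>i\<in>UNIV. (coords c V t $ i * ?e i (\<gamma> t) $ k) *\<^sub>R ?\<Gamma> k)"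
    unfolding scaleR_sum_left[symmetric] by (intro sum.cong refl arg_cong2[where f = scaleR] Vk)
  also have "\<dots> = (\<Sum>i\<in>UNIV. \<Sum>k\<in>UNIV. (coords c V t $ i * ?e i (\<gamma> t) $ k) *\<^sub>R ?\<Gamma> k)"
    by (rule sum.swap)
  finally have S:
      "(\<Sum>k\<in>UNIV. V t $ k *\<^sub>R ?\<Gamma> k) = (\<Sum>i\<in>UNIV. coords c V t $ i *\<^sub>R (\<Sum>k\<in>UNIV. ?e i (\<gamma> t) $ k *\<^sub>R ?\<Gamma> k))"
    by (simp add: scaleR_sum_right)
  have "vector_derivative (coords ?d V) (at t within I) =
    (\<Sum>i\<in>UNIV. coords c V t $ i *\<^sub>R tderiv A (?J i) (\<gamma> t) (vel t) + \<delta> $ i *\<^sub>R ?J i (\<gamma> t))"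
    by (rule vector_derivative_within[OF not_bot[OF t] coords_change_chart[OF chart_at_mem c t V]])
  then show ?thesis
    unfolding cov_deriv_along_def Let_def S D coord_field_eq_sum[OF c, of \<delta>]
    by (simp add: sum.distrib scaleR_add_right algebra_simps)
qed

text \<open>Fields along \<gamma> need not be restrictions of fields on the manifold, so metric
  compatibility does not apply to them directly. It applies to the coefficients g(\<partial>i,
  \<partial>j) of a fixed chart, and the product rule does the rest.\<close>

lemma metric_along:
  assumes "t \<in> I" "diff_along V t" "diff_along W t"
  shows "((\<lambda>s. g (\<gamma> s) (V s) (W s)) has_real_derivative
    g (\<gamma> t) (cov V t) (W t) + g (\<gamma> t) (V t) (cov W t)) (at t within I)"
proof -
  let ?c = "chart_at A (\<gamma> t)"
  have c: "?c \<in> A" "\<gamma> t \<in> fst ?c" by (rule chart_at_mem)+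
  let ?e = "\<lambda>i. coord_field A ?c (axis i 1)"
  let ?g = "\<lambda>i j q. g q (?e i q) (?e j q)"
  let ?v = "\<lambda>s i. coords ?c V s $ i" and ?w = "\<lambda>s i. coords ?c W s $ i"
  let ?D = "\<lambda>i. D (?e i) (\<gamma> t) (vel t)"
  have U: "open (fst ?c)" by (rule open_chart_domain[OF c(1)])
  note s = smooth_coord_field[OF c(1)]
  define v' where "v' = vector_derivative (coords ?c V) (at t within I)"
  define w' where "w' = vector_derivative (coords ?c W) (at t within I)"
  have V: "(coords ?c V has_vector_derivative v') (at t within I)"
    and W: "(coords ?c W has_vector_derivative w') (at t within I)"
    unfolding v'_def w'_def using diff_alongD[OF _ c] assms by auto
  have vi: "((\<lambda>s. ?v s i) has_real_derivative v' $ i) (at t within I)"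
    and wi: "((\<lambda>s. ?w s i) has_real_derivative w' $ i) (at t within I)" for i
    unfolding has_real_derivative_iff_has_vector_derivative
    by (rule bounded_linear.has_vector_derivative[OF bounded_linear_vec_nth V]
        bounded_linear.has_vector_derivative[OF bounded_linear_vec_nth W])+
  have gij: "((\<lambda>s. ?g i j (\<gamma> s)) has_real_derivative g (\<gamma> t) (?D i) (?e j (\<gamma> t))
      + g (\<gamma> t) (?e i (\<gamma> t)) (?D j)) (at t within I)" for i j
    using has_vector_derivative_along[OF U g_smooth[OF U s s] assms(1) c(2), of "axis i 1" "axis j 1"]
    unfolding metric_compatible[OF U s s c(2)] has_real_derivative_iff_has_vector_derivative .
  have ex: "cov V t = (\<Sum>i\<in>UNIV. v' $ i *\<^sub>R ?e i (\<gamma> t) + ?v t i *\<^sub>R ?D i)"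
     "cov W t = (\<Sum>i\<in>UNIV. w' $ i *\<^sub>R ?e i (\<gamma> t) + ?w t i *\<^sub>R ?D i)"
    unfolding cov_eq_chart[OF c assms(1) V] cov_eq_chart[OF c assms(1) W]
      coord_field_eq_sum[OF c, of v'] coord_field_eq_sum[OF c, of w'] sum.distrib by (rule refl)+
  have eV: "V t = (\<Sum>i\<in>UNIV. ?v t i *\<^sub>R ?e i (\<gamma> t))" and eW: "W t = (\<Sum>i\<in>UNIV. ?w t i *\<^sub>R ?e i (\<gamma> t))"
    by (rule vec_eq_sum[OF c])+
  have expand: "g (\<gamma> s) (V s) (W s) = (\<Sum>i\<in>UNIV. \<Sum>j\<in>UNIV. ?v s i * ?w s j * ?g i j (\<gamma> s))"
    if "\<gamma> s \<in> fst ?c" for s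
  proof -
    have "g (\<gamma> s) (V s) (W s)
        = g (\<gamma> s) (\<Sum>i\<in>UNIV. ?v s i *\<^sub>R ?e i (\<gamma> s)) (\<Sum>i\<in>UNIV. ?w s i *\<^sub>R ?e i (\<gamma> s))"
      using vec_eq_sum[OF c(1) that, of "V s"] vec_eq_sum[OF c(1) that, of "W s"] by simp
    then show ?thesis
      by (simp add: g_sum g_linear mult_ac)
  qed
  have "((\<lambda>s. \<Sum>i\<in>UNIV. \<Sum>j\<in>UNIV. ?v s i * ?w s j * ?g i j (\<gamma> s)) has_real_derivative
    (\<Sum>i\<in>UNIV. \<Sum>j\<in>UNIV. (v' $ i * ?w t j + w' $ j * ?v t i) * ?g i j (\<gamma> t)
      + (g (\<gamma> t) (?D i) (?e j (\<gamma> t))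
          + g (\<gamma> t) (?e i (\<gamma> t)) (?D j)) * (?v t i * ?w t j))) (at t within I)"
    by (intro DERIV_sum DERIV_mult' DERIV_mult vi wi gij)
  \<comment> \<open>The four terms are sorted by the field whose component or frame vector is
    differentiated; each group is then the expansion of one covariant derivative from
    \<open>ex\<close>.\<close>
  also have "(\<Sum>i\<in>UNIV. \<Sum>j\<in>UNIV. (v' $ i * ?w t j + w' $ j * ?v t i) * ?g i j (\<gamma> t)
      + (g (\<gamma> t) (?D i) (?e j (\<gamma> t)) + g (\<gamma> t) (?e i (\<gamma> t)) (?D j)) * (?v t i * ?w t j)) =
      (\<Sum>i\<in>UNIV. \<Sum>j\<in>UNIV. ?w t j * (v' $ i * ?g i j (\<gamma> t) + ?v t i * g (\<gamma> t) (?D i) (?e j (\<gamma> t)))) +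
      (\<Sum>i\<in>UNIV. \<Sum>j\<in>UNIV. ?v t i * (w' $ j * ?g i j (\<gamma> t) + ?w t j * g (\<gamma> t) (?e i (\<gamma> t)) (?D j)))"
    unfolding sum.distrib[symmetric] by (intro sum.cong refl) (simp add: algebra_simps)
  also have "\<dots> = g (\<gamma> t) (cov V t) (\<Sum>i\<in>UNIV. ?w t i *\<^sub>R ?e i (\<gamma> t))
      + g (\<gamma> t) (\<Sum>i\<in>UNIV. ?v t i *\<^sub>R ?e i (\<gamma> t)) (cov W t)"
    unfolding ex g_sum
    by (simp add: g_linear algebra_simps)
  also have "\<dots> = g (\<gamma> t) (cov V t) (W t) + g (\<gamma> t) (V t) (cov W t)"
    unfolding eV[symmetric] eW[symmetric] by (rule refl)
  finally show ?thesis
    unfolding has_real_derivative_iff_has_vector_derivative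
    by (rule has_vector_derivative_local[OF U assms(1) c(2) expand, rotated])
qed

lemma
  assumes "open U" "smooth_field_on A U Z" "t \<in> I" "\<gamma> t \<in> U"
  shows diff_along_restrict: "diff_along (\<lambda>s. Z (\<gamma> s)) t"
    and cov_restrict: "cov (\<lambda>s. Z (\<gamma> s)) t = D Z (\<gamma> t) (vel t)"
proof -
  let ?c = "chart_at A (\<gamma> t)"
  have c: "?c \<in> A" "\<gamma> t \<in> fst ?c" by (rule chart_at_mem)+
  have U: "open (fst ?c \<inter> U)" "\<gamma> t \<in> fst ?c \<inter> U" using c assms open_chart_domain_Int by auto
  note h = has_vector_derivative_along[OF U(1) smooth_field_onD[OF assms(2) c(1)] assms(3) U(2)]
  show "diff_along (\<lambda>s. Z (\<gamma> s)) t"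
    by (rule diff_alongI[OF c assms(3) differentiableI_vector[OF h]])
  show "cov (\<lambda>s. Z (\<gamma> s)) t = D Z (\<gamma> t) (vel t)"
    unfolding cov_deriv_along_def Let_def vector_derivative_within[OF not_bot[OF assms(3)] h]
      D_eq_preferred_chart[OF assms(1,2,4)] by (rule refl)
qed

text \<open>In the chart \<open>c\<close> the components are sums of products of components of
  \<open>V\<close> and \<open>W\<close> with Christoffel symbols. Both the torsion and the
  connection part of \<open>cov\<close> have this form.\<close>

lemma diff_along_D:
  assumes t: "t \<in> I" and V: "\<forall>s\<in>I. diff_along V s" and W: "\<forall>s\<in>I. diff_along W s" and c: "c \<in> A"
      "\<gamma> t \<in> fst c"
  shows "diff_along (\<lambda>s. \<Sum>i\<in>UNIV. coords c V s $ i *\<^sub>R D (coord_field A c (axis i 1)) (\<gamma> s) (W s)) t"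
proof (rule diff_alongI[OF c t])
  let ?e = "\<lambda>i. coord_field A c (axis i 1)"
  let ?G = "\<lambda>i j q. tderiv A (snd c) q (D (?e i) q (?e j q))"
  have U: "open (fst c)" by (rule open_chart_domain[OF c(1)])
  have G: "(\<lambda>s. ?G i j (\<gamma> s)) differentiable (at t within I)" for i j
  proof -
    have "smooth_fun_on A (fst c) (?G i j)"
      using smooth_field_onD[OF smooth_christoffel[OF c(1)] c(1)] by simp
    from differentiableI_vector[OF has_vector_derivative_along[OF U this t c(2)]] show ?thesis .
  qed
  have "(\<lambda>s. \<Sum>i\<in>UNIV. \<Sum>j\<in>UNIV. (coords c V s $ i) *\<^sub>R (coords c W s $ j) *\<^sub>R ?G i j (\<gamma> s)) differentiable (at t within I)"
    using V W t c G unfolding diff_along_def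
    by (intro differentiable_sum ballI differentiable_scaleR differentiable_nth) auto
  then show "coords c (\<lambda>s. \<Sum>i\<in>UNIV. coords c V s $ i *\<^sub>R D (?e i) (\<gamma> s) (W s)) differentiable (at t within I)"
  proof (rule differentiable_local[OF U t c(2), rotated])
    fix s assume s: "\<gamma> s \<in> fst c"
    note l = linear_tderiv_chart[OF c(1) s]
    have "D (?e i) (\<gamma> s) (W s) = (\<Sum>j\<in>UNIV. coords c W s $ j *\<^sub>R D (?e i) (\<gamma> s) (?e j (\<gamma> s)))" for i
      by (rule D_eq_sum[OF c(1) s U smooth_coord_field[OF c(1)] s])
    then show "coords c (\<lambda>s. \<Sum>i\<in>UNIV. coords c V s $ i *\<^sub>R D (?e i) (\<gamma> s) (W s)) s =
      (\<Sum>i\<in>UNIV. \<Sum>j\<in>UNIV. (coords c V s $ i) *\<^sub>R (coords c W s $ j) *\<^sub>R ?G i j (\<gamma> s))"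
      by (simp add: linear_sum[OF l] linear_scale[OF l] scaleR_sum_right)
  qed
qed

lemma diff_along_torsion:
  assumes t: "t \<in> I" and V: "\<forall>s\<in>I. diff_along V s" and W: "\<forall>s\<in>I. diff_along W s"
  shows "diff_along (\<lambda>s. torsion A D (\<gamma> s) (V s) (W s)) t"
proof -
  let ?c = "chart_at A (\<gamma> t)"
  have c: "?c \<in> A" "\<gamma> t \<in> fst ?c" by (rule chart_at_mem)+
  have U: "open (fst ?c)" by (rule open_chart_domain[OF c(1)])
  let ?F = "\<lambda>V W s. \<Sum>i\<in>UNIV. coords ?c V s $ i *\<^sub>R D (coord_field A ?c (axis i 1)) (\<gamma> s) (W s)"
  have "(\<lambda>s. coords ?c (?F W V) s - coords ?c (?F V W) s) differentiable (at t within I)"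
    using diff_along_D[OF t V W c] diff_along_D[OF t W V c] c unfolding diff_along_def
    by (intro differentiable_diff) auto
  then have "coords ?c (\<lambda>s. torsion A D (\<gamma> s) (V s) (W s)) differentiable (at t within I)"
    by (rule differentiable_local[OF U t c(2), rotated])
      (simp add: torsion_eq_chart[OF c(1)] linear_diff[OF linear_tderiv_chart[OF c(1)]])
  then show ?thesis by (rule diff_alongI[OF c t])
qed

lemma diff_along_smooth:
  assumes "smooth_field_along A I \<gamma> V" "t \<in> I"
  shows "diff_along V t"
  using assms(1) Ck_curve_differentiable(1)[OF open_chart_domain assms(2)]
  unfolding diff_along_def smooth_field_along_def by blast

lemma diff_along_cov:
  assumes V: "smooth_field_along A I \<gamma> V" and t: "t \<in> I"
  shows "diff_along (cov V) t"
proof -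
  let ?c = "chart_at A (\<gamma> t)"
  have c: "?c \<in> A" "\<gamma> t \<in> fst ?c" by (rule chart_at_mem)+
  have U: "open (fst ?c)" by (rule open_chart_domain[OF c(1)])
  let ?F = "\<lambda>s. \<Sum>i\<in>UNIV. coords ?c V s $ i *\<^sub>R D (coord_field A ?c (axis i 1)) (\<gamma> s) (vel s)"
  have "(\<lambda>s. vector_derivative (coords ?c V) (at s within I)) differentiable (at t within I)"
    using Ck_curve_differentiable(2)[OF U t c(2)] V c unfolding smooth_field_along_def by blast
  moreover have "coords ?c ?F differentiable (at t within I)"
    using diff_along_D[OF t _ _ c, of V vel] diff_along_smooth[OF V] diff_along_vel c
    unfolding diff_along_def by blast
  ultimately have
      "(\<lambda>s. vector_derivative (coords ?c V) (at s within I)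
      + coords ?c ?F s) differentiable (at t within I)"
    by (rule differentiable_add)
  then have "coords ?c (cov V) differentiable (at t within I)"
  proof (rule differentiable_local[OF U t c(2), rotated])
    fix s assume s: "s \<in> I" "\<gamma> s \<in> fst ?c"
    show "coords ?c (cov V) s = vector_derivative (coords ?c V) (at s within I) + coords ?c ?F s"
      unfolding cov_eq_chart[OF c(1) s(2,1) diff_alongD[OF diff_along_smooth[OF V s(1)] c(1) s(2)]]
        linear_add[OF linear_tderiv_chart[OF c(1) s(2)]] components_coord_field[OF c(1) s(2)]
      by (rule refl)
  qed
  then show ?thesis by (rule diff_alongI[OF c t])
qed

end

section \<open>Functions of one real variable\<close>

lemma zero_derivative_within:
  fixes f :: "real \<Rightarrow> real"
  assumes "at t within S \<noteq> bot" "t \<in> S" "\<And>s. s \<in> S \<Longrightarrow> f s = 0"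
    "(f has_real_derivative d) (at t within S)"
  shows "d = 0"
proof -
  have "((\<lambda>s. 0::real) has_vector_derivative d) (at t within S)"
    by (rule has_vector_derivative_transform[where f = f])
      (use assms in \<open>auto simp: has_real_derivative_iff_has_vector_derivative\<close>)
  then show ?thesis
    using vector_derivative_unique_within[OF assms(1)] has_vector_derivative_const by blast
qed

lemma mono_within_interval:
  fixes f :: "real \<Rightarrow> real"
  assumes "is_interval S" "\<And>s. s \<in> S \<Longrightarrow> (f has_real_derivative f' s) (at s within S)"
    "\<And>s. s \<in> S \<Longrightarrow> f' s \<ge> 0" "x \<in> S" "y \<in> S" "x \<le> y"
  shows "f x \<le> f y"
proof -
  have sub: "{x..y} \<subseteq> S" using assms(1,4,5) by (meson atLeastAtMost_iff mem_is_interval_1_I subsetI)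
  have "\<exists>z\<in>{x..y}. f y - f x = (*) (f' z) (y - x)"
  proof (rule mvt_very_simple[OF assms(6)])
    fix z assume "x \<le> z" "z \<le> y"
    then have "(f has_real_derivative f' z) (at z within {x..y})"
      using assms(2)[of z] sub by (intro has_field_derivative_subset[OF assms(2) sub]) auto
    then show "(f has_derivative (*) (f' z)) (at z within {x..y})"
      by (simp add: has_field_derivative_def)
  qed
  then obtain z where z: "z \<in> {x..y}" "f y - f x = f' z * (y - x)" by blast
  then have "f' z * (y - x) \<ge> 0" using assms(3)[of z] sub assms(6) by (intro mult_nonneg_nonneg) auto
  then show ?thesis using z(2) by linarith
qed

text \<open>To the right of \<open>t\<close> the function f(s) exp(-C s) is nonincreasing, to the
  left f(s) exp(C s) is nondecreasing towards \<open>t\<close>. Being nonnegative and zero at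
  \<open>t\<close>, each vanishes.\<close>

lemma gronwall_zero:
  fixes f :: "real \<Rightarrow> real"
  assumes S: "is_interval S" and f: "\<And>s. s \<in> S \<Longrightarrow> (f has_real_derivative f' s) (at s within S)"
    and nonneg: "\<And>s. s \<in> S \<Longrightarrow> f s \<ge> 0" and bound: "\<And>s. s \<in> S \<Longrightarrow> \<bar>f' s\<bar> \<le> C * f s"
    and t: "t \<in> S" "f t = 0" and s: "s \<in> S"
  shows "f s = 0"
proof (cases "t \<le> s")
  case True
  have "- (f t * exp (- C * t)) \<le> - (f s * exp (- C * s))"
  proof (rule mono_within_interval[OF S _ _ t(1) s True])
    fix r assume r: "r \<in> S"
    show "((\<lambda>r. - (f r * exp (- C * r)))
        has_real_derivative (C * f r - f' r) * exp (- C * r)) (at r within S)"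
      by (auto intro!: derivative_eq_intros f[OF r] simp: algebra_simps)
    show "(C * f r - f' r) * exp (- C * r) \<ge> 0"
      using bound[OF r] by (intro mult_nonneg_nonneg) auto
  qed
  then have "f s * exp (- C * s) \<le> 0" using t by simp
  then show ?thesis using nonneg[OF s] by (simp add: mult_le_0_iff)
next
  case False
  have "f s * exp (C * s) \<le> f t * exp (C * t)"
  proof (rule mono_within_interval[OF S _ _ s t(1)])
    fix r assume r: "r \<in> S"
    show "((\<lambda>r. f r * exp (C * r)) has_real_derivative (f' r + C * f r) * exp (C * r)) (at r within S)"
      by (auto intro!: derivative_eq_intros f[OF r] simp: algebra_simps)
    show "(f' r + C * f r) * exp (C * r) \<ge> 0"
      using bound[OF r] by (intro mult_nonneg_nonneg) auto
  qed (use False in simp)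
  then have "f s * exp (C * s) \<le> 0" using t by simp
  then show ?thesis using nonneg[OF s] by (simp add: mult_le_0_iff)
qed

text \<open>The entrywise sum is a crude constant, but it varies continuously with the coefficients,
  as is needed when they move along a curve.\<close>

lemma bilinear_sum_bound:
  fixes x y :: "real^'m" and M :: "'m \<Rightarrow> 'm \<Rightarrow> real"
  shows "\<bar>\<Sum>i\<in>UNIV. \<Sum>j\<in>UNIV. x $ i * y $ j * M i j\<bar> \<le> norm x * norm y * (\<Sum>i\<in>UNIV. \<Sum>j\<in>UNIV. \<bar>M i j\<bar>)"
proof -
  have "\<bar>\<Sum>i\<in>UNIV. \<Sum>j\<in>UNIV. x $ i * y $ j * M i j\<bar> \<le> (\<Sum>i\<in>UNIV. \<Sum>j\<in>UNIV. \<bar>x $ i * y $ j * M i j\<bar>)"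
    by (intro order_trans[OF sum_abs] sum_mono sum_abs)
  also have "\<dots> \<le> (\<Sum>i\<in>UNIV. \<Sum>j\<in>UNIV. norm x * norm y * \<bar>M i j\<bar>)"
    unfolding abs_mult by (intro sum_mono mult_mono component_le_norm_cart) auto
  finally show ?thesis by (simp add: sum_distrib_left)
qed

section \<open>Sectional curvature\<close>

context metric_connection
begin

lemma curvature_same: "curvature A D p u u w = 0"
  using curvature_antisym[of p u u w] by (simp add: eq_neg_iff_add_eq_0 vec_eq_iff)

text \<open>One factor \<open>a * d - b * c\<close> comes from skewness in the first two arguments,
  the other from skewness in the last two.\<close>

lemma curvature_change_basis:
  "g p (curvature A D p (a *\<^sub>R X + b *\<^sub>R Y) (c *\<^sub>R X + d *\<^sub>R Y) (c *\<^sub>R X + d *\<^sub>R Y)) (a *\<^sub>R X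
      + b *\<^sub>R Y) =
    (a * d - b * c)\<^sup>2 * g p (curvature A D p X Y Y) X"
proof -
  note l1 = linear_add[OF curvature_linear(1)] linear_scale[OF curvature_linear(1)]
  note l2 = linear_add[OF curvature_linear(2)] linear_scale[OF curvature_linear(2)]
  note l3 = linear_add[OF curvature_linear(3)] linear_scale[OF curvature_linear(3)]
  have 1: "curvature A D p (a *\<^sub>R X + b *\<^sub>R Y) (c *\<^sub>R X + d *\<^sub>R Y) w
      = (a * d - b * c) *\<^sub>R curvature A D p X Y w" for w
    using curvature_antisym[of p Y X w]
    by (simp add: l1 l2 curvature_same algebra_simps)
  have 2: "g p (curvature A D p X Y (c *\<^sub>R X + d *\<^sub>R Y)) (a *\<^sub>R X + b *\<^sub>R Y)
      = (a * d - b * c) * g p (curvature A D p X Y Y) X"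
    using curvature_skew2[of p X Y X Y]
    by (simp add: l3 g_linear curvature_skew algebra_simps)
  show ?thesis
    unfolding 1 bilinear_lmul[OF g_bilinear] 2 by (simp add: power2_eq_square)
qed

lemma span_pair: "w \<in> span {X, Y} \<Longrightarrow> \<exists>a b. w = a *\<^sub>R X + b *\<^sub>R (Y::real^'m)"
proof -
  assume "w \<in> span {X, Y}"
  then obtain a b where "w - a *\<^sub>R X = b *\<^sub>R Y"
    unfolding span_breakdown_eq span_singleton by blast
  then have "w = a *\<^sub>R X + b *\<^sub>R Y" by (simp add: diff_eq_eq add.commute)
  then show ?thesis by blast
qed

text \<open>The definite description in \<open>psh_sectional_curvature\<close> is meaningful because the determinant in
  \<open>curvature_change_basis\<close> is \<open>\<plusminus>1\<close> for orthonormal bases.\<close>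

lemma psh_sectional_curvature_eq:
  assumes "g p X X = 1" "g p Y Y = 1" "g p X Y = 0"
  shows "psh_sectional_curvature A g D p (span {X, Y}) = 1/4 * g p (curvature A D p X Y Y) X"
  unfolding psh_sectional_curvature_def
proof (rule the_equality)
  fix k assume "\<exists>X' Y'. span {X', Y'} = span {X, Y} \<and> g p X' X' = 1 \<and> g p Y' Y' = 1 \<and> g p X' Y' = 0 \<and>
    k = 1/4 * g p (curvature A D p X' Y' Y') X'"
  then obtain X' Y' where *: "span {X', Y'} = span {X, Y}" "g p X' X' = 1" "g p Y' Y' = 1"
      "g p X' Y' = 0"
    "k = 1/4 * g p (curvature A D p X' Y' Y') X'" by blast
  have "X' \<in> span {X, Y}" "Y' \<in> span {X, Y}"
    using span_base[of X' "{X', Y'}"] span_base[of Y' "{X', Y'}"] *(1) by auto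
  then obtain a b c d where X': "X' = a *\<^sub>R X + b *\<^sub>R Y" and Y': "Y' = c *\<^sub>R X + d *\<^sub>R Y"
    using span_pair by meson
  have YX: "g p Y X = 0" using assms(3) g_sym by simp
  have "a * a + b * b = 1" "c * c + d * d = 1" "a * c + b * d = 0"
    using *(2-4) unfolding X' Y' by (simp_all add: g_linear assms YX mult.commute)
  \<comment> \<open>Lagrange's identity: the square equals (a^2 + b^2)(c^2 + d^2) - (a c + b
    d)^2.\<close>
  then have "(a * d - b * c)\<^sup>2 = 1"
    by (algebra)
  then show "k = 1/4 * g p (curvature A D p X Y Y) X"
    using *(5) unfolding X' Y' curvature_change_basis by simp
qed (use assms in blast)

text \<open>The hypothesis speaks of planes, hence of orthonormal pairs. Gram-Schmidt reduces an
  arbitrary pair to such a pair; linearly dependent pairs span no plane, but there the expression is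
  zero.\<close>

lemma curvature_nonpos:
  assumes "\<forall>\<sigma>. subspace \<sigma> \<and> dim \<sigma> = 2 \<longrightarrow> psh_sectional_curvature A g D p \<sigma> \<le> 0"
  shows "g p (curvature A D p u v v) u \<le> 0"
proof (cases "v = 0")
  case True
  then show ?thesis using linear_0[OF curvature_linear(3)] by (simp add: g_linear)
next
  case False
  define \<nu> where "\<nu> = sqrt (g p v v)"
  have \<nu>: "\<nu> > 0" "\<nu> * \<nu> = g p v v" using g_pos[OF False, of p] by (auto simp: \<nu>_def)
  define Y where "Y = (1/\<nu>) *\<^sub>R v"
  have Y: "g p Y Y = 1" using \<nu>(1) by (simp add: Y_def g_linear flip: \<nu>(2))
  have v: "v = \<nu> *\<^sub>R Y" using \<nu> by (simp add: Y_def)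
  define W where "W = u - g p u Y *\<^sub>R Y"
  have WY: "g p W Y = 0" by (simp add: W_def g_linear Y)
  show ?thesis
  proof (cases "W = 0")
    case True
    then have u: "g p u Y *\<^sub>R Y = u" by (simp add: W_def)
    have "curvature A D p (g p u Y *\<^sub>R Y) (\<nu> *\<^sub>R Y) v = 0"
      by (simp add: linear_scale[OF curvature_linear(1)] linear_scale[OF curvature_linear(2)] curvature_same)
    then show ?thesis unfolding u v[symmetric] by (simp add: g_linear)
  next
    case False
    define \<mu> where "\<mu> = sqrt (g p W W)"
    have \<mu>: "\<mu> > 0" "\<mu> * \<mu> = g p W W" using g_pos[OF False, of p] by (auto simp: \<mu>_def)
    define X where "X = (1/\<mu>) *\<^sub>R W"
    have X: "g p X X = 1" "g p X Y = 0" using \<mu>(1) WY by (simp_all add: X_def g_linear flip: \<mu>(2))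
    have W: "W = \<mu> *\<^sub>R X" using \<mu> by (simp add: X_def)
    have "X \<notin> span {Y}"
    proof
      assume "X \<in> span {Y}"
      then obtain k where k: "X = k *\<^sub>R Y" unfolding span_singleton by blast
      then have "k = 0" using X(2) Y by (simp add: g_linear)
      then show False using X(1) k by (simp add: g_linear)
    qed
    moreover have "independent {Y}" using Y by (auto simp: g_linear)
    ultimately have ind: "independent {X, Y}" "X \<noteq> Y"
      using independent_insertI span_base by blast+
    then have "dim (span {X, Y}) = 2"
      using dim_span_eq_card_independent[OF ind(1)] by simp
    then have "psh_sectional_curvature A g D p (span {X, Y}) \<le> 0"
      using assms by (simp add: subspace_span)
    then have k: "g p (curvature A D p X Y Y) X \<le> 0"
      unfolding psh_sectional_curvature_eq[OF X(1) Y X(2)] by simp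
    \<comment> \<open>The change of basis is triangular with determinant
      \<open>\<mu> * \<nu>\<close>, whose square does not affect the sign.\<close>
    have "u = \<mu> *\<^sub>R X + g p u Y *\<^sub>R Y" "v = 0 *\<^sub>R X + \<nu> *\<^sub>R Y"
      using v by (simp_all add: W[symmetric]) (simp add: W_def)
    then have "g p (curvature A D p u v v) u = (\<mu> * \<nu> - g p u Y * 0)\<^sup>2 * g p (curvature A D p X Y Y) X"
      using curvature_change_basis[of p \<mu> X "g p u Y" Y 0 \<nu>] by simp
    then show ?thesis using k by (simp add: mult_nonneg_nonpos)
  qed
qed

text \<open>The extensions in \<open>curvature\<close> change with the point, so smoothness is not
  visible in the definition. On the frame of a fixed chart the sum in \<open>chart_curvature\<close>
  collapses to one iterated derivative of coordinate fields, which is smooth.\<close>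

lemma smooth_curvature:
  assumes c: "c \<in> A"
  shows "smooth_field_on A (fst c)
    (\<lambda>q. curvature A D q (coord_field A c (axis i 1) q) (coord_field A c (axis j 1) q) (coord_field A c (axis k 1) q))"
proof -
  let ?e = "\<lambda>i. coord_field A c (axis i 1)"
  let ?N = "\<lambda>k j q. D (?e k) q (?e j q)"
  have U: "open (fst c)" by (rule open_chart_domain[OF c])
  have s: "smooth_field_on A (fst c) (\<lambda>q. D (?N k j) q (?e i q))" for i j k
    by (intro D_smooth U smooth_coord_field c)
  have "smooth_field_on A (fst c) (\<lambda>q. D (?N k j) q (?e i q) + (-1) *\<^sub>R D (?N k i) q (?e j q))"
    by (intro smooth_field_on_add smooth_field_on_scaleR smooth_fun_on_const U s)
  then show ?thesis
  proof (rule smooth_field_on_cong[OF U])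
    fix q assume q: "q \<in> fst c"
    have K: "chart_curvature c q (?e i q) (?e j q) (?e k q) = D (?N k j) q (?e i q)" for i j
    proof -
      have "chart_curvature c q (?e i q) (?e j q) (?e k q) =
        (\<Sum>k'\<in>UNIV. \<Sum>j'\<in>UNIV. if j' = j then if k' = k then D (?N k' j') q (?e i q) else 0 else 0)"
        unfolding chart_curvature_def components_coord_field[OF c q]
        by (intro sum.cong refl) (simp add: axis_def)
      then show ?thesis by simp
    qed
    show "D (?N k j) q (?e i q) + (-1) *\<^sub>R D (?N k i) q (?e j q)
        = curvature A D q (?e i q) (?e j q) (?e k q)"
      by (simp add: curvature_eq_chart[OF c q] K)
  qed
qed

end

section \<open>Jacobi fields\<close>

context curve
begin

lemma continuous_along:
  assumes "open U" "smooth_fun_on A U h" "t \<in> I" "\<gamma> t \<in> U"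
  shows "continuous (at t within I) (\<lambda>s. h (\<gamma> s))"
  using has_vector_derivative_along[OF assms] has_vector_derivative_continuous by blast

lemma near_chart:
  assumes "t \<in> I" "c \<in> A" "\<gamma> t \<in> fst c"
  obtains \<delta> where "\<delta> > 0" "\<And>s. s \<in> I \<Longrightarrow> dist s t < \<delta> \<Longrightarrow> \<gamma> s \<in> fst c"
proof -
  have "openin (top_of_set I) (I \<inter> \<gamma> -` fst c)"
    using smooth assms open_chart_domain
      by (intro continuous_openin_preimage_gen) (auto simp: smooth_curve_def)
  then obtain e where "e > 0" "\<forall>s\<in>I. dist s t < e \<longrightarrow> s \<in> I \<inter> \<gamma> -` fst c"
    using assms unfolding openin_euclidean_subtopology_iff by blast
  then show thesis using that[of e] by blast
qed

section \<open>Local bounds for the metric and the curvature along the curve\<close>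

text \<open>Compactness of the unit sphere gives a positive constant at \<gamma> t. Continuity of
  the coefficients of g in a fixed chart preserves half of it for nearby parameters.\<close>

lemma metric_lower_bound:
  assumes t: "t \<in> I"
  defines "c \<equiv> chart_at A (\<gamma> t)"
  obtains \<delta> m where "\<delta> > 0" "m > 0"
    "\<And>s u. s \<in> I \<Longrightarrow> dist s t < \<delta> \<Longrightarrow> m * (norm (tderiv A (snd c) (\<gamma> s) u))\<^sup>2 \<le> g (\<gamma> s) u u"
proof -
  have c: "c \<in> A" "\<gamma> t \<in> fst c" unfolding c_def by (rule chart_at_mem)+
  have U: "open (fst c)" by (rule open_chart_domain[OF c(1)])
  let ?e = "\<lambda>i. coord_field A c (axis i 1)"
  let ?g = "\<lambda>i j q. g q (?e i q) (?e j q)"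
  let ?p = "\<gamma> t"
  have "continuous_on (sphere 0 1) (\<lambda>x. g ?p x x)"
    by (intro bounded_bilinear.continuous_on[OF g_bilinear[unfolded bilinear_conv_bounded_bilinear]] continuous_on_id)
  moreover have "sphere 0 1 \<noteq> ({} :: (real^'m) set)"
    using norm_axis_1 by (metis dist_0_norm empty_iff mem_sphere)
  ultimately obtain x0 :: "real^'m" where x0: "x0 \<in> sphere 0 1"
      "\<And>x. x \<in> sphere 0 1 \<Longrightarrow> g ?p x0 x0 \<le> g ?p x x"
    using continuous_attains_inf[OF compact_sphere, of 0 1 "\<lambda>x. g ?p x x"] by blast
  define m where "m = g ?p x0 x0"
  have m: "m > 0" using x0(1) by (auto simp: m_def intro!: g_pos)
  have low: "m * (norm x)\<^sup>2 \<le> g ?p x x" for x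
  proof (cases "x = 0")
    case False
    have "m \<le> g ?p ((1 / norm x) *\<^sub>R x) ((1 / norm x) *\<^sub>R x)"
      unfolding m_def using False by (intro x0(2)) simp
    also have "\<dots> = g ?p x x / (norm x)\<^sup>2"
      by (simp add: g_linear power2_eq_square)
    finally show ?thesis using False by (simp add: field_simps)
  qed (simp add: g_linear)
  \<comment> \<open>\<open>?h\<close> vanishes at \<open>t\<close>, so continuity makes it smaller
    than m/2 nearby.\<close>
  let ?h = "\<lambda>s. \<Sum>i\<in>UNIV. \<Sum>j\<in>UNIV. \<bar>?g i j (\<gamma> s) - ?g i j ?p\<bar>"
  have "continuous (at t within I) ?h"
    by (intro continuous_sum continuous_rabs continuous_diff continuous_const
        continuous_along[OF U g_smooth[OF U smooth_coord_field[OF c(1)] smooth_coord_field[OF c(1)]] t c(2)])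
  then have "\<forall>e>0. \<exists>d>0. \<forall>s\<in>I. dist s t < d \<longrightarrow> dist (?h s) (?h t) < e"
    unfolding continuous_within_eps_delta .
  then obtain d1 where d1: "d1 > 0" "\<And>s. s \<in> I \<Longrightarrow> dist s t < d1 \<Longrightarrow> dist (?h s) (?h t) < m / 2"
    using half_gt_zero[OF m] by blast
  obtain d2 where d2: "d2 > 0" "\<And>s. s \<in> I \<Longrightarrow> dist s t < d2 \<Longrightarrow> \<gamma> s \<in> fst c"
    using near_chart[OF t c] by blast
  show thesis
  proof (rule that[of "min d1 d2" "m/2"])
    fix s u assume s: "s \<in> I" "dist s t < min d1 d2"
    define x where "x = tderiv A (snd c) (\<gamma> s) u"
    have cs: "\<gamma> s \<in> fst c" using d2 s by simp
    have h: "?h s < m / 2" using d1(2)[OF s(1)] s(2) by (simp add: dist_real_def)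
    have u: "u = (\<Sum>i\<in>UNIV. x $ i *\<^sub>R ?e i (\<gamma> s))" unfolding x_def by (rule vec_eq_sum[OF c(1) cs])
    \<comment> \<open>The component vector of \<open>u\<close> at \<gamma> s is reused as a tangent
      vector at \<gamma> t: there the frame of \<open>c\<close> is the standard basis, so
      \<open>x\<close> has itself as components.\<close>
    have xp: "x = (\<Sum>i\<in>UNIV. x $ i *\<^sub>R ?e i ?p)"
      using vec_eq_sum[OF c, of x] unfolding c_def tderiv_chart_at .
    have gs: "g (\<gamma> s) u u = (\<Sum>i\<in>UNIV. \<Sum>j\<in>UNIV. x $ i * x $ j * ?g i j (\<gamma> s))"
      by (subst (1 2) u) (simp add: g_sum g_linear algebra_simps)
    have gp: "g ?p x x = (\<Sum>i\<in>UNIV. \<Sum>j\<in>UNIV. x $ i * x $ j * ?g i j ?p)"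
      by (subst (1 2) xp) (simp add: g_sum g_linear algebra_simps)
    have "\<bar>g (\<gamma> s) u u - g ?p x x\<bar> = \<bar>\<Sum>i\<in>UNIV. \<Sum>j\<in>UNIV. x $ i * x $ j * (?g i j (\<gamma> s) - ?g i j ?p)\<bar>"
      unfolding gs gp by (simp add: sum_subtractf right_diff_distrib)
    also have "\<dots> \<le> norm x * norm x * ?h s" by (rule bilinear_sum_bound)
    also have "\<dots> \<le> norm x * norm x * (m / 2)" using h by (intro mult_left_mono) auto
    finally have "g ?p x x - norm x * norm x * (m / 2) \<le> g (\<gamma> s) u u" by linarith
    moreover have "norm x * norm x * (m / 2) = m * (norm x)\<^sup>2 / 2" by (simp add: power2_eq_square)
    ultimately show "m / 2 * (norm (tderiv A (snd c) (\<gamma> s) u))\<^sup>2 \<le> g (\<gamma> s) u u"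
      using low[of x] unfolding x_def[symmetric] by linarith
  qed (use d1 d2 m in auto)
qed

text \<open>\<open>M s\<close> is the matrix of the form g(R(\<cdot>,\<gamma>')\<gamma>', \<cdot>)
  in a fixed frame and \<open>B s\<close> its entrywise sum. By continuity \<open>B\<close> stays
  below \<open>B t + 1\<close> near \<open>t\<close>; dividing by the constant of
  \<open>metric_lower_bound\<close> turns norms of components into g. The right-hand side has the
  shape of the energy of a Jacobi field.\<close>

lemma curvature_bound:
  assumes t: "t \<in> I"
  obtains \<delta> C where "\<delta> > 0"
    "\<And>s u w. s \<in> I \<Longrightarrow> dist s t < \<delta> \<Longrightarrow>
      \<bar>g (\<gamma> s) (curvature A D (\<gamma> s) u (vel s) (vel s)) w\<bar> \<le> C * (g (\<gamma> s) u u + g (\<gamma> s) w w)"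
proof -
  let ?c = "chart_at A (\<gamma> t)"
  have c: "?c \<in> A" "\<gamma> t \<in> fst ?c" by (rule chart_at_mem)+
  have U: "open (fst ?c)" by (rule open_chart_domain[OF c(1)])
  let ?e = "\<lambda>i. coord_field A ?c (axis i 1)"
  let ?R = "\<lambda>i j k l q. g q (curvature A D q (?e i q) (?e j q) (?e k q)) (?e l q)"
  let ?v = "\<lambda>s i. coords ?c vel s $ i"
  define M where "M = (\<lambda>s i l. \<Sum>j\<in>UNIV. \<Sum>k\<in>UNIV. ?v s j * ?v s k * ?R i j k l (\<gamma> s))"
  define B where "B = (\<lambda>s. \<Sum>i\<in>UNIV. \<Sum>l\<in>UNIV. \<bar>M s i l\<bar>)"
  have v: "continuous (at t within I) (\<lambda>s. ?v s i)" for i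
    using diff_along_vel[OF t] c unfolding diff_along_def
    by (intro differentiable_imp_continuous_within differentiable_nth) auto
  have "continuous (at t within I) B"
    unfolding B_def M_def
    by (intro continuous_sum continuous_rabs continuous_mult v
        continuous_along[OF U g_smooth[OF U smooth_curvature[OF c(1)] smooth_coord_field[OF c(1)]] t c(2)])
  then have "\<forall>e>0. \<exists>d>0. \<forall>s\<in>I. dist s t < d \<longrightarrow> dist (B s) (B t) < e"
    unfolding continuous_within_eps_delta .
  then obtain d1 where d1: "d1 > 0" "\<And>s. s \<in> I \<Longrightarrow> dist s t < d1 \<Longrightarrow> dist (B s) (B t) < 1"
    using zero_less_one by blast
  obtain d2 where d2: "d2 > 0" "\<And>s. s \<in> I \<Longrightarrow> dist s t < d2 \<Longrightarrow> \<gamma> s \<in> fst ?c"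
    using near_chart[OF t c] by blast
  obtain d3 m where d3: "d3 > 0" "m > 0"
    "\<And>s u. s \<in> I \<Longrightarrow> dist s t < d3 \<Longrightarrow> m * (norm (tderiv A (snd ?c) (\<gamma> s) u))\<^sup>2 \<le> g (\<gamma> s) u u"
    using metric_lower_bound[OF t] by blast
  show thesis
  proof (rule that[of "min d1 (min d2 d3)" "(B t + 1) / m"])
    fix s u w assume s: "s \<in> I" "dist s t < min d1 (min d2 d3)"
    let ?p = "\<gamma> s"
    define x where "x = tderiv A (snd ?c) ?p u"
    define y where "y = tderiv A (snd ?c) ?p w"
    have cs: "?p \<in> fst ?c" using d2 s by simp
    have u: "u = (\<Sum>i\<in>UNIV. x $ i *\<^sub>R ?e i ?p)" unfolding x_def by (rule vec_eq_sum[OF c(1) cs])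
    have w: "w = (\<Sum>i\<in>UNIV. y $ i *\<^sub>R ?e i ?p)" unfolding y_def by (rule vec_eq_sum[OF c(1) cs])
    have vs: "vel s = (\<Sum>i\<in>UNIV. ?v s i *\<^sub>R ?e i ?p)" by (rule vec_eq_sum[OF c(1) cs])
    note l1 = linear_sum[OF curvature_linear(1)] linear_scale[OF curvature_linear(1)]
    note l2 = linear_sum[OF curvature_linear(2)] linear_scale[OF curvature_linear(2)]
    note l3 = linear_sum[OF curvature_linear(3)] linear_scale[OF curvature_linear(3)]
    have MR: "g ?p (curvature A D ?p (?e i ?p) (vel s) (vel s)) (?e l ?p) = M s i l" for i l
    proof -
      have "curvature A D ?p (?e i ?p) (vel s) (vel s) =
        curvature A D ?p (?e i ?p) (\<Sum>i\<in>UNIV. ?v s i *\<^sub>R ?e i ?p) (\<Sum>i\<in>UNIV. ?v s i *\<^sub>R ?e i ?p)"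
        by (rule arg_cong2[OF vs vs, where f = "curvature A D ?p (?e i ?p)"])
      also have "\<dots>
          = (\<Sum>j\<in>UNIV. \<Sum>k\<in>UNIV. (?v s j * ?v s k) *\<^sub>R curvature A D ?p (?e i ?p) (?e j ?p) (?e k ?p))"
        unfolding l2 by (simp add: l3 scaleR_sum_right)
      finally show ?thesis by (simp add: g_sum_left g_linear M_def)
    qed
    have "g ?p (curvature A D ?p u (vel s) (vel s)) w = (\<Sum>i\<in>UNIV. \<Sum>l\<in>UNIV. x $ i * y $ l * M s i l)"
    proof -
      have "g ?p (curvature A D ?p u (vel s) (vel s)) w
          = g ?p (curvature A D ?p (\<Sum>i\<in>UNIV. x $ i *\<^sub>R ?e i ?p) (vel s) (vel s))
          (\<Sum>i\<in>UNIV. y $ i *\<^sub>R ?e i ?p)"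
        by (rule arg_cong2[OF u w, where f = "\<lambda>u w. g ?p (curvature A D ?p u (vel s) (vel s)) w"])
      also have "\<dots>
          = (\<Sum>i\<in>UNIV. \<Sum>l\<in>UNIV. (x $ i * y $ l) * g ?p (curvature A D ?p (?e i ?p) (vel s) (vel s)) (?e l ?p))"
        unfolding l1 g_sum by (simp add: g_linear mult_ac)
      finally show ?thesis unfolding MR .
    qed
    then have "\<bar>g ?p (curvature A D ?p u (vel s) (vel s)) w\<bar> \<le> norm x * norm y * B s"
      unfolding B_def by (simp add: bilinear_sum_bound)
    also have "\<dots> \<le> norm x * norm y * (B t + 1)"
      using d1(2)[OF s(1)] s(2) by (intro mult_left_mono) (auto simp: dist_real_def)
    also have "\<dots> \<le> ((norm x)\<^sup>2 + (norm y)\<^sup>2) * (B t + 1)"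
    proof (rule mult_right_mono)
      show "norm x * norm y \<le> (norm x)\<^sup>2 + (norm y)\<^sup>2"
        using sum_squares_bound[of "norm x"
            "norm y"] mult_nonneg_nonneg[OF norm_ge_zero[of x] norm_ge_zero[of y]]
        unfolding mult.assoc by linarith
      show "0 \<le> B t + 1" unfolding B_def by (intro add_nonneg_nonneg sum_nonneg) auto
    qed
    also have "\<dots> \<le> ((g ?p u u + g ?p w w) / m) * (B t + 1)"
    proof (rule mult_right_mono)
      show "0 \<le> B t + 1" unfolding B_def by (intro add_nonneg_nonneg sum_nonneg) auto
      show "(norm x)\<^sup>2 + (norm y)\<^sup>2 \<le> (g ?p u u + g ?p w w) / m"
        using d3(3)[OF s(1), of u] d3(3)[OF s(1), of w] s(2) d3(2)
        by (simp add: x_def y_def field_simps)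
    qed
    finally show "\<bar>g ?p (curvature A D ?p u (vel s) (vel s)) w\<bar> \<le> (B t + 1) / m * (g ?p u u + g ?p w w)"
      by (simp add: field_simps)
  qed (use d1 d2 d3 in auto)
qed

section \<open>Horizontal and vertical fields along the curve\<close>

text \<open>Differentiate g(Y,T) = 0 along the curve; the term with the derivative of the parallel
  field \<open>T\<close> drops out.\<close>

lemma horizontal_cov:
  assumes T: "smooth_field_on A UNIV T" "\<And>p v. D T p v = 0"
    and Y: "\<And>s. s \<in> I \<Longrightarrow> g (\<gamma> s) (Y s) (T (\<gamma> s)) = 0" "t \<in> I" "diff_along Y t"
  shows "g (\<gamma> t) (cov Y t) (T (\<gamma> t)) = 0"
proof -
  have "((\<lambda>s. g (\<gamma> s) (Y s) (T (\<gamma> s))) has_real_derivative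
    g (\<gamma> t) (cov Y t) (T (\<gamma> t)) + g (\<gamma> t) (Y t) (cov (\<lambda>s. T (\<gamma> s)) t)) (at t within I)"
    by (rule metric_along[OF Y(2,3) diff_along_restrict[OF open_UNIV T(1) Y(2) UNIV_I]])
  from zero_derivative_within[OF not_bot[OF Y(2)] Y(2) Y(1) this]
  show ?thesis by (simp add: cov_restrict[OF open_UNIV T(1) Y(2) UNIV_I] T(2) g_linear)
qed

text \<open>Differentiating g(V,Y) = 0 moves the derivative onto the horizontal field
  \<open>Y\<close>. The factor \<open>f\<close> itself is never differentiated, so it may be any
  function.\<close>

lemma vertical_cov:
  assumes T: "smooth_field_on A UNIV T" "\<And>p v. D T p v = 0"
    and Y: "\<And>s. s \<in> I \<Longrightarrow> g (\<gamma> s) (Y s) (T (\<gamma> s)) = 0" "t \<in> I" "diff_along Y t"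
    and V: "\<And>s. s \<in> I \<Longrightarrow> V s = f s *\<^sub>R T (\<gamma> s)" "diff_along V t"
  shows "g (\<gamma> t) (cov V t) (Y t) = 0"
proof -
  have VY: "g (\<gamma> s) (V s) (Y s) = 0" if "s \<in> I" for s
    using Y(1)[OF that] V(1)[OF that] by (simp add: g_linear g_sym)
  from zero_derivative_within[OF not_bot[OF Y(2)] Y(2) VY metric_along[OF Y(2) V(2) Y(3)]]
  have "g (\<gamma> t) (cov V t) (Y t) + g (\<gamma> t) (V t) (cov Y t) = 0" .
  moreover have "g (\<gamma> t) (V t) (cov Y t) = 0"
    using horizontal_cov[OF T Y] V(1)[OF Y(2)] by (simp add: g_linear g_sym)
  ultimately show ?thesis by simp
qed

lemma horizontal_jacobi_field_vanishes:
  assumes T: "smooth_field_on A UNIV T" "\<And>p v. D T p v = 0"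
    and K: "\<And>p u v. g p (curvature A D p u v v) u \<le> 0"
    and X: "jacobi_field A D I \<gamma> X" "\<And>s. s \<in> I \<Longrightarrow> g (\<gamma> s) (X s) (T (\<gamma> s)) = 0"
    and tor: "\<And>s. s \<in> I \<Longrightarrow> torsion A D (\<gamma> s) (X s) (vel s) = f s *\<^sub>R T (\<gamma> s)"
    and ab: "a \<in> I" "b \<in> I" "a < b" "X a = 0" "X b = 0"
    and t: "t \<in> I"
  shows "X t = 0"
proof -
  let ?X' = "cov X"
  have smX: "smooth_field_along A I \<gamma> X" using X(1) by (simp add: jacobi_field_def)
  have dX: "diff_along X s" and dX': "diff_along ?X' s" if "s \<in> I" for s
    using diff_along_smooth[OF smX that] diff_along_cov[OF smX that] by auto
  let ?V = "\<lambda>s. torsion A D (\<gamma> s) (X s) (vel s)"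
  have dV: "diff_along ?V s" if "s \<in> I" for s
    by (rule diff_along_torsion[OF that]) (use dX diff_along_vel in auto)
  have hX': "g (\<gamma> s) (?X' s) (T (\<gamma> s)) = 0" if "s \<in> I" for s
    by (rule horizontal_cov[OF T X(2) that dX[OF that]])
  let ?R = "\<lambda>s. curvature A D (\<gamma> s) (X s) (vel s) (vel s)"
  have X'': "cov ?X' s = - cov ?V s - ?R s" if "s \<in> I" for s
  proof -
    have "cov ?X' s + cov ?V s + ?R s = 0" using X(1) that by (simp add: jacobi_field_def)
    then show ?thesis by (simp add: algebra_simps eq_neg_iff_add_eq_0)
  qed
  \<comment> \<open>Pairing with a horizontal field removes the torsion term. Below,
    \<open>Y\<close> is \<open>X\<close> for the monotonicity and \<open>?X'\<close> for the
    energy.\<close>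
  have X''Y: "g (\<gamma> s) (cov ?X' s) (Y s) = - g (\<gamma> s) (?R s) (Y s)"
    if "\<And>s. s \<in> I \<Longrightarrow> g (\<gamma> s) (Y s) (T (\<gamma> s)) = 0" "s \<in> I" "diff_along Y s" for Y s
    using vertical_cov[OF T that tor dV[OF that(2)]] by (simp add: X''[OF that(2)] g_linear)
  let ?P = "\<lambda>s. g (\<gamma> s) (X s) (?X' s)"
  let ?P' = "\<lambda>s. g (\<gamma> s) (?X' s) (?X' s) - g (\<gamma> s) (?R s) (X s)"
  have P': "(?P has_real_derivative ?P' s) (at s within I)" if s: "s \<in> I" for s
    using metric_along[OF s dX[OF s] dX'[OF s]] X''Y[OF X(2) s dX[OF s]] by (simp add: g_sym)
  have u': "((\<lambda>s. g (\<gamma> s) (X s) (X s)) has_real_derivative 2 * ?P s) (at s within I)" if s: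
      "s \<in> I" for s
    using metric_along[OF s dX[OF s] dX[OF s]] by (simp add: g_sym)
  have v': "((\<lambda>s. g (\<gamma> s) (?X' s) (?X' s)) has_real_derivative
      - 2 * g (\<gamma> s) (?R s) (?X' s)) (at s within I)"
    if s: "s \<in> I" for s
    using metric_along[OF s dX'[OF s] dX'[OF s]] X''Y[OF hX' s dX'[OF s]] by (simp add: g_sym)
  have P'0: "?P' s \<ge> 0" if "s \<in> I" for s
    using K[of "\<gamma> s" "X s" "vel s"] g_nonneg[of "\<gamma> s" "?X' s"] by simp
  have sub: "{a..b} \<subseteq> I" using interval ab by (meson atLeastAtMost_iff mem_is_interval_1_I subsetI)
  have P0: "?P s = 0" if s: "s \<in> {a..b}" for s
  proof -
    have "?P a \<le> ?P s"
      by (rule mono_within_interval[OF interval P' P'0]) (use s sub ab in auto)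
    moreover have "?P s \<le> ?P b"
      by (rule mono_within_interval[OF interval P' P'0]) (use s sub ab in auto)
    ultimately show ?thesis using ab by (simp add: g_linear)
  qed
  have ivl: "is_interval {a..b}" by (rule is_interval_cc)
  \<comment> \<open>On {a..b} the derivative 2 g(X,X') of g(X,X) is zero, so g(X,X) keeps its value
    0 from \<open>a\<close>.\<close>
  have X0: "X s = 0" if s: "s \<in> {a..b}" for s
  proof -
    have "- g (\<gamma> a) (X a) (X a) \<le> - g (\<gamma> s) (X s) (X s)"
    proof (rule mono_within_interval[OF ivl, where f = "\<lambda>s. - g (\<gamma> s) (X s) (X s)" and f' = "\<lambda>_. 0"])
      fix r assume r: "r \<in> {a..b}"
      show "((\<lambda>s. - g (\<gamma> s) (X s) (X s)) has_real_derivative 0) (at r within {a..b})"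
        using has_field_derivative_subset[OF u' sub, of r] r sub P0[OF r]
        by (auto intro!: derivative_eq_intros)
    qed (use s ab in auto)
    then show ?thesis
      using g_nonneg[of "\<gamma> s" "X s"] g_eq_0_iff[of "\<gamma> s" "X s"] ab by (simp add: g_linear)
  qed
  \<comment> \<open>At an interior point the vanishing of \<open>?P\<close> on {a..b} forces
    \<open>?P' m = 0\<close>. As X vanishes there, this says g(X',X') = 0, which provides the
    initial zero of the energy.\<close>
  define m where "m = (a + b) / 2"
  have m: "a < m" "m < b" "m \<in> {a..b}" "m \<in> I" using ab sub by (auto simp: m_def)
  have "?P' m = 0"
  proof (rule zero_derivative_within[OF _ m(3) P0])
    show "at m within {a..b} \<noteq> bot" using m by (simp add: at_within_Icc_at at_neq_bot)
    show "(?P has_real_derivative ?P' m) (at m within {a..b})"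
      by (rule has_field_derivative_subset[OF P'[OF m(4)] sub])
  qed
  then have X'm: "?X' m = 0"
    using X0[OF m(3)] g_eq_0_iff[of "\<gamma> m" "?X' m"] by (simp add: g_linear)
  define E where "E = (\<lambda>s. g (\<gamma> s) (X s) (X s) + g (\<gamma> s) (?X' s) (?X' s))"
  have E': "(E has_real_derivative 2 * ?P s - 2 * g (\<gamma> s) (?R s) (?X' s)) (at s within I)" if s:
      "s \<in> I" for s
    unfolding E_def using DERIV_add[OF u'[OF s] v'[OF s]] by simp
  have E0: "E s \<ge> 0" for s unfolding E_def by (intro add_nonneg_nonneg g_nonneg)
  have "continuous_on I E"
    unfolding continuous_on_eq_continuous_within using DERIV_continuous[OF E'] by blast
  then have closed: "closedin (top_of_set I) {s\<in>I. E s = 0}"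
    by (rule continuous_closedin_preimage_constant)
  \<comment> \<open>The curvature constant is only local, so Gronwall's inequality is applied on
    small intervals; connectedness of \<open>I\<close> makes the conclusion global.\<close>
  have "openin (top_of_set I) {s\<in>I. E s = 0}"
    unfolding openin_euclidean_subtopology_iff
  proof (intro conjI ballI)
    fix r assume "r \<in> {s\<in>I. E s = 0}"
    then have r: "r \<in> I" "E r = 0" by auto
    obtain \<delta> C where \<delta>: "\<delta> > 0" "\<And>s u w. s \<in> I \<Longrightarrow> dist s r < \<delta> \<Longrightarrow>
      \<bar>g (\<gamma> s) (curvature A D (\<gamma> s) u (vel s) (vel s)) w\<bar> \<le> C * (g (\<gamma> s) u u + g (\<gamma> s) w w)"
      using curvature_bound[OF r(1)] by blast
    let ?J = "I \<inter> ball r \<delta>"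
    \<comment> \<open>In the constant \<open>1 + 2 * C\<close> the 1 bounds 2 g(X,X'), by expanding
      the nonnegative squares of X + X' and X - X', and 2 C comes from the curvature term.\<close>
    have "E s = 0" if s: "s \<in> I" "dist s r < \<delta>" for s
    proof (rule gronwall_zero[where f = E and S = ?J and C = "1 + 2 * C" and t = r and
        f' = "\<lambda>q. 2 * ?P q - 2 * g (\<gamma> q) (?R q) (?X' q)"])
      show "is_interval ?J" by (intro is_interval_Int interval is_interval_ball_real)
      show "r \<in> ?J" "E r = 0" "s \<in> ?J" using r s \<delta> by (auto simp: dist_commute)
      fix q assume q: "q \<in> ?J"
      show "E q \<ge> 0" by (rule E0)
      show "(E has_real_derivative 2 * ?P q - 2 * g (\<gamma> q) (?R q) (?X' q)) (at q within ?J)"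
        using q by (intro has_field_derivative_subset[OF E']) auto
      have "\<bar>g (\<gamma> q) (?R q) (?X' q)\<bar> \<le> C * E q"
        unfolding E_def using q by (intro \<delta>(2)) (auto simp: dist_commute)
      moreover have "\<bar>2 * ?P q\<bar> \<le> E q"
        using g_nonneg[of "\<gamma> q" "X q + ?X' q"] g_nonneg[of "\<gamma> q" "X q - ?X' q"]
        unfolding E_def by (simp add: g_linear g_sym[of _ "?X' q" "X q"] abs_le_iff)
      ultimately show "\<bar>2 * ?P q - 2 * g (\<gamma> q) (?R q) (?X' q)\<bar> \<le> (1 + 2 * C) * E q"
        by (simp add: algebra_simps abs_le_iff)
    qed
    then show "\<exists>e>0. \<forall>s\<in>I. dist s r < e \<longrightarrow> s \<in> {s\<in>I. E s = 0}" using \<delta>(1) by blast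
  qed auto
  with closed have "{s\<in>I. E s = 0} = {} \<or> {s\<in>I. E s = 0} = I"
    using is_interval_connected[OF interval] unfolding connected_clopen by blast
  moreover have "m \<in> {s\<in>I. E s = 0}"
    using m(4) X0[OF m(3)] X'm by (simp add: E_def g_linear)
  ultimately have "E t = 0" using t by blast
  then have "g (\<gamma> t) (X t) (X t) = 0"
    unfolding E_def using g_nonneg[of "\<gamma> t" "X t"] g_nonneg[of "\<gamma> t" "?X' t"] by linarith
  then show ?thesis by (simp add: g_eq_0_iff)
qed

end

section \<open>The Tanaka-Webster connection\<close>

text \<open>Z + cnj W and Z + W have the same real part, so one vector of type (1,0) represents each
  horizontal vector.\<close>

lemma levi_distribution_Re:
  fixes T10 :: "'a \<Rightarrow> (complex^'m::finite) set"
  assumes "vec.subspace (T10 p)" "X \<in> levi_distribution T10 p"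
  obtains Z where "Z \<in> T10 p" "X = vec_Re Z"
proof -
  obtain Z W where "X = vec_Re (Z + vec_cnj W)" "Z \<in> T10 p" "W \<in> T10 p"
    using assms(2) unfolding levi_distribution_def by blast
  moreover have "vec_Re (Z + vec_cnj W) = vec_Re (Z + W)"
    by (simp add: vec_Re_def vec_cnj_def)
  ultimately show thesis using that[of "Z + W"] vec.subspace_add[OF assms(1)] by simp
qed

lemma (in connection) torsion_minus: "torsion A D p u (- v) = - torsion A D p u v"
proof -
  let ?c = "chart_at A p"
  have l: "linear (D (coord_field A ?c (axis j 1)) p)" for j
    by (rule D_linear[OF open_chart_domain smooth_coord_field]) (rule chart_at_mem)+
  show ?thesis
    unfolding torsion_eq_chart[OF chart_at_mem] by (simp add: linear_neg[OF l] sum_negf)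
qed

text \<open>Write X = Re Z, Y = Re W and let B be the torsion. The real part of B(Z,W) = 0 says
  B(X,Y) = B(Im Z, Im W). The real part of the condition on B(Z, cnj W) says that B(X,Y) + B(Im Z,
  Im W) is a multiple of \<open>T\<close>. The sum of the two isolates B(X,Y).\<close>

lemma (in connection) torsion_horizontal:
  assumes "vec.subspace (T10 p)"
    and tor: "\<And>Z W. Z \<in> T10 p \<Longrightarrow> W \<in> T10 p \<Longrightarrow> cext_vec (torsion A D p) Z W = 0 \<and>
        cext_vec (torsion A D p) Z (vec_cnj W)
            = (2 * cext_form (ext_deriv A \<theta> p) Z (vec_cnj W)) *s vec_complex (T p)"
    and "X \<in> levi_distribution T10 p" "Y \<in> levi_distribution T10 p"
  shows "\<exists>f. torsion A D p X Y = f *\<^sub>R T p"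
proof -
  obtain Z where Z: "Z \<in> T10 p" "X = vec_Re Z" using levi_distribution_Re[OF assms(1,3)] by blast
  obtain W where W: "W \<in> T10 p" "Y = vec_Re W" using levi_distribution_Re[OF assms(1,4)] by blast
  let ?B = "torsion A D p"
  let ?r = "Re (cext_form (ext_deriv A \<theta> p) Z (vec_cnj W))"
  have cnj: "vec_Re (vec_cnj W) = vec_Re W" "vec_Im (vec_cnj W) = - vec_Im W"
    by (simp_all add: vec_Re_def vec_Im_def vec_cnj_def vec_eq_iff)
  have "?B X Y $ i = (?r *\<^sub>R T p) $ i" for i
  proof -
    have "Re (cext_vec ?B Z W $ i) = 0" using tor[OF Z(1) W(1)] by simp
    then have 1: "?B X Y $ i - ?B (vec_Im Z) (vec_Im W) $ i = 0"
      by (simp add: cext_vec_def cext_form_def Z(2) W(2))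
    have "Re (cext_vec ?B Z (vec_cnj W) $ i)
        = Re (((2 * cext_form (ext_deriv A \<theta> p) Z (vec_cnj W)) *s vec_complex (T p)) $ i)"
      using tor[OF Z(1) W(1)] by simp
    moreover have "Re (cext_vec ?B Z (vec_cnj W) $ i) = ?B X Y $ i + ?B (vec_Im Z) (vec_Im W) $ i"
      by (simp add: cext_vec_def cext_form_def cnj torsion_minus Z(2) W(2))
    moreover have
        "Re (((2 * cext_form (ext_deriv A \<theta> p) Z (vec_cnj W)) *s vec_complex (T p)) $ i)
        = 2 * ?r * T p $ i"
      by (simp add: vec_complex_def)
    ultimately show ?thesis using 1 by simp
  qed
  then have "?B X Y = ?r *\<^sub>R T p" unfolding vec_eq_iff by blast
  then show ?thesis by blast
qed

text \<open>Constant length makes \<nabla>T orthogonal to \<open>T\<close>. For horizontal Y,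
  differentiating g(Y,T) = 0 and using that \<nabla>Y is horizontal makes \<nabla>T orthogonal to Y.
  Together these directions span the tangent space.\<close>

lemma (in metric_connection) characteristic_field_parallel:
  assumes \<theta>: "one_form A \<theta>" and T: "smooth_field_on A UNIV T" "\<And>p. \<theta> p (T p) = 1"
      "\<And>p. g p (T p) (T p) = 1"
    and orth: "\<And>p v. \<theta> p v = 0 \<Longrightarrow> g p v (T p) = 0"
    and hor: "\<And>U Y p v. open U \<Longrightarrow> smooth_field_on A U Y \<Longrightarrow> (\<And>q. q \<in> U \<Longrightarrow> \<theta> q (Y q) = 0) \<Longrightarrow> p \<in> U
        \<Longrightarrow> \<theta> p (D Y p v) = 0"
  shows "D T p v = 0"
proof -
  let ?U = "fst (chart_at A p)"
  have U: "open ?U" "p \<in> ?U" using chart_at_mem open_chart_domain by auto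
  have sT: "smooth_field_on A ?U T" by (rule smooth_field_on_subset[OF T(1)]) simp
  have TT: "g p (T p) (D T p v) = 0"
  proof -
    have "tderiv A (\<lambda>q. g q (T q) (T q)) p v = g p (D T p v) (T p) + g p (T p) (D T p v)"
      by (rule metric_compatible[OF U(1) sT sT U(2)])
    then show ?thesis by (simp add: T(3) g_sym)
  qed
  have "g p w (D T p v) = 0" for w
  proof -
    let ?E = "extend_vec A p w"
    \<comment> \<open>The projection of the extension of \<open>w\<close> to the kernel of \<theta>
      along \<open>T\<close>: a smooth horizontal field differing from it by a multiple of
      \<open>T\<close>.\<close>
    let ?Y = "\<lambda>q. ?E q + (- \<theta> q (?E q)) *\<^sub>R T q"
    have sE: "smooth_field_on A ?U ?E" by (rule smooth_extend_vec[OF order_refl])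
    have "smooth_fun_on A ?U (\<lambda>q. \<theta> q (?E q))"
      using \<theta> U(1) sE unfolding one_form_def by blast
    from smooth_fun_on_mult[OF U(1) smooth_fun_on_const[of ?U "-1"] this]
    have sY: "smooth_field_on A ?U ?Y"
      by (intro smooth_field_on_add smooth_field_on_scaleR U sE sT) simp
    have l: "linear (\<theta> q)" for q using \<theta> unfolding one_form_def by blast
    have Y0: "\<theta> q (?Y q) = 0" for q
      by (simp add: linear_add[OF l] linear_scale[OF l] linear_neg[OF l] linear_diff[OF l] T(2))
    have "tderiv A (\<lambda>q. g q (?Y q) (T q)) p v = g p (D ?Y p v) (T p) + g p (?Y p) (D T p v)"
      by (rule metric_compatible[OF U(1) sY sT U(2)])
    moreover have "(\<lambda>q. g q (?Y q) (T q)) = (\<lambda>q. 0)" using orth[OF Y0] by (rule ext)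
    moreover have "g p (D ?Y p v) (T p) = 0"
      by (rule orth[OF hor[OF U(1) sY Y0 U(2)]])
    ultimately have "g p (?Y p) (D T p v) = 0" by simp
    then show ?thesis by (simp add: g_linear TT)
  qed
  then show ?thesis using g_eq_0_iff by blast
qed

theorem theorem4:
  fixes A :: "('a::{t2_space,second_countable_topology}, 'm::finite) chart set"
    and n :: nat
    and T10 :: "'a \<Rightarrow> (complex^'m) set"
    and \<theta> :: "'a \<Rightarrow> real^'m \<Rightarrow> real"
    and T :: "'a \<Rightarrow> real^'m"
    and g :: "'a \<Rightarrow> real^'m \<Rightarrow> real^'m \<Rightarrow> real"
    and D :: "('a, 'm) connection"
  assumes "CR_manifold A n T10"
    and "contact_form A T10 \<theta>"
    and "G_positive_definite A T10 \<theta>"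
    and "characteristic_field A \<theta> T"
    and "webster_metric A T10 \<theta> T g"
    and "tanaka_webster A T10 \<theta> T g D"
    and "\<forall>p \<sigma>. subspace \<sigma> \<and> dim \<sigma> = 2 \<longrightarrow> psh_sectional_curvature A g D p \<sigma> \<le> 0"
  shows "\<forall>I \<gamma> a b. geodesic A D I \<gamma> \<and> lengthy A T10 I \<gamma> \<and>
           (\<forall>t\<in>I. g (\<gamma> t) (velocity A I \<gamma> t) (velocity A I \<gamma> t) = 1) \<and>
           a \<in> I \<and> b \<in> I \<and> a \<noteq> b \<longrightarrow>
           \<not> horizontally_conjugate A T10 D I \<gamma> a b"
proof (intro allI impI notI)
  fix I \<gamma> a b
  assume asm: "geodesic A D I \<gamma> \<and> lengthy A T10 I \<gamma> \<and>
           (\<forall>t\<in>I. g (\<gamma> t) (velocity A I \<gamma> t) (velocity A I \<gamma> t) = 1) \<and>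
           a \<in> I \<and> b \<in> I \<and> a \<noteq> b"
    and "horizontally_conjugate A T10 D I \<gamma> a b"
  then obtain X where X: "jacobi_field A D I \<gamma> X" "\<exists>t\<in>I. X t \<noteq> 0"
    "\<forall>t\<in>I. X t \<in> levi_distribution T10 (\<gamma> t)" "X a = 0" "X b = 0"
    unfolding horizontally_conjugate_def by blast
  have tw1: "linear_connection A D" using assms(6) unfolding tanaka_webster_def by (rule conjunct1)
  have tw2: "\<forall>U Y. open U \<and> smooth_field_on A U Y \<longrightarrow>
        ((\<forall>q\<in>U. Y q \<in> levi_distribution T10 q) \<longrightarrow>
           (\<forall>p\<in>U. \<forall>v. D Y p v \<in> levi_distribution T10 p)) \<and>
        (\<forall>Z. smooth_field_on A U Z \<longrightarrow>
           (\<forall>p\<in>U. \<forall>v. tderiv A (\<lambda>q. g q (Y q) (Z q)) p v = g p (D Y p v) (Z p) + g p (Y p) (D Z p v))) \<and>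
        (\<forall>p\<in>U. \<forall>v. D (\<lambda>q. full_J T10 \<theta> T q (Y q)) p v = full_J T10 \<theta> T p (D Y p v))"
    using assms(6) unfolding tanaka_webster_def by (elim conjE)
  have tw3: "\<forall>p. \<forall>Z\<in>T10 p. \<forall>W\<in>T10 p.
        cext_vec (torsion A D p) Z W = 0 \<and>
        cext_vec (torsion A D p) Z (vec_cnj W)
          = (2 * cext_form (ext_deriv A \<theta> p) Z (vec_cnj W)) *s vec_complex (T p)"
    using assms(6) unfolding tanaka_webster_def by (elim conjE)
  have levi: "X \<in> levi_distribution T10 p \<longleftrightarrow> \<theta> p X = 0" for p X
    using assms(2) unfolding contact_form_def by blast
  have wm: "riemannian_metric A g" "\<And>p X. X \<in> levi_distribution T10 p \<Longrightarrow> g p X (T p) = 0"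
      "\<And>p. g p (T p) (T p) = 1"
    using assms(5) unfolding webster_metric_def by blast+
  have ab: "a \<in> I" "b \<in> I" "a \<noteq> b" and geo: "is_interval I" "smooth_curve A I \<gamma>"
    and len: "\<And>s. s \<in> I \<Longrightarrow> velocity A I \<gamma> s \<in> levi_distribution T10 (\<gamma> s)"
    using asm unfolding geodesic_def lengthy_def by blast+
  interpret curve A D g I \<gamma>
  proof unfold_locales
    show "smooth_atlas A" using assms(1) unfolding CR_manifold_def by blast
    show "linear_connection A D" by (rule tw1)
    show "riemannian_metric A g" by (rule wm)
    show "is_interval I" "smooth_curve A I \<gamma>" by (rule geo)+
    show "I \<noteq> {x}" for x using ab by blast
    fix U Y Z p v
    assume U: "open U" and Y: "smooth_field_on A U Y" and Z: "smooth_field_on A U Z" and p: "p \<in> U"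
    show "tderiv A (\<lambda>q. g q (Y q) (Z q)) p v = g p (D Y p v) (Z p) + g p (Y p) (D Z p v)"
      by (rule tw2[rule_format, OF conjI[OF U Y], THEN conjunct2, THEN conjunct1, rule_format, OF Z p])
  qed
  have T: "smooth_field_on A UNIV T" "\<And>p. \<theta> p (T p) = 1"
    using assms(4) unfolding characteristic_field_def by blast+
  have DT: "D T p v = 0" for p v
  proof (rule characteristic_field_parallel[where \<theta> = \<theta> and T = T, OF _ T wm(3)])
    show "one_form A \<theta>" using assms(2) unfolding contact_form_def by blast
    show "g p v (T p) = 0" if "\<theta> p v = 0" for p v using wm(2) levi that by blast
    fix U Y p v
    assume U: "open U" and Y: "smooth_field_on A U Y" "\<And>q. q \<in> U \<Longrightarrow> \<theta> q (Y q) = 0" and p: "p \<in> U"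
    have "D Y p v \<in> levi_distribution T10 p"
      by (rule tw2[rule_format, OF conjI[OF U Y(1)], THEN conjunct1, rule_format, OF _ p])
        (use Y(2) levi in blast)
    then show "\<theta> p (D Y p v) = 0" using levi by blast
  qed
  have T10: "vec.subspace (T10 p)" for p
  proof -
    have "complex_subbundle A n T10" using assms(1) unfolding CR_manifold_def by (elim conjE)
    from spec[OF this[unfolded complex_subbundle_def], of p]
    obtain U Z where U: "open U \<and> p \<in> U \<and> (\<forall>j<n. smooth_cfield_on A U (Z j)) \<and>
        (\<forall>q\<in>U. T10 q = vec.span ((\<lambda>j. Z j q) ` {..<n}) \<and> vec.dim (T10 q) = n)"
      by (elim exE)
    have "T10 p = vec.span ((\<lambda>j. Z j p) ` {..<n})"
      by (rule conjunct1[OF bspec[OF U[THEN conjunct2, THEN conjunct2, THEN conjunct2] U[THEN conjunct2, THEN conjunct1]]])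
    show ?thesis unfolding \<open>T10 p = _\<close> by (rule vec.subspace_span)
  qed
  have "\<forall>s\<in>I. \<exists>f. torsion A D (\<gamma> s) (X s) (velocity A I \<gamma> s) = f *\<^sub>R T (\<gamma> s)"
  proof
    fix s assume s: "s \<in> I"
    show "\<exists>f. torsion A D (\<gamma> s) (X s) (velocity A I \<gamma> s) = f *\<^sub>R T (\<gamma> s)"
      by (rule torsion_horizontal[where p = "\<gamma> s" and T = T and \<theta>
          = \<theta>, OF T10 tw3[rule_format] X(3)[rule_format, OF s] len[OF s]])
  qed
  \<comment> \<open>The coefficient is chosen separately at each parameter, so no regularity of
    \<open>f\<close> is available afterwards.\<close>
  from bchoice[OF this] obtain f where
    tor: "\<forall>s\<in>I. torsion A D (\<gamma> s) (X s) (velocity A I \<gamma> s) = f s *\<^sub>R T (\<gamma> s)" ..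
  have K: "g p (curvature A D p u v v) u \<le> 0" for p u v
    by (rule curvature_nonpos) (use assms(7) in blast)
  have XT: "g (\<gamma> s) (X s) (T (\<gamma> s)) = 0" if "s \<in> I" for s
    using wm(2) X(3) that by blast
  have vanish: "X t = 0" if "c \<in> I" "d \<in> I" "c < d" "X c = 0" "X d = 0" "t \<in> I" for c d t
    by (rule horizontal_jacobi_field_vanishes[where T = T and X = X and f = f, OF T(1) DT K X(1) XT
      tor[rule_format] that])
  have "X t = 0" if "t \<in> I" for t
  proof (cases "a < b")
    case True
    show ?thesis by (rule vanish[OF ab(1,2) True X(4,5) that])
  next
    case False
    then have "b < a" using ab(3) by simp
    show ?thesis by (rule vanish[OF ab(2,1) \<open>b < a\<close> X(5,4) that])
  qed
  then show False using X(2) by blast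
qed

end
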